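(* Let $p$ be a fixed odd prime. There are at least $(p+1)/2$ different integers $d$ with $2\le d\le p$ for which the equation $D(pqr)=d$ is soluble in arbitrarily large primes $q$ and $r$ (i.e. for every $N$ there are primes $q,r$ with $q>N$ and $r>q>p$ such that $D(pqr)=d$).
   Context: For distinct odd primes $p,q,r$, $D(pqr)$ denotes the diameter of the cyclotomic polynomial $\Phi_{pqr}$, i.e. the difference between its largest and its smallest coefficient. *)

theory Defs
  imports
    Complex_Main
    "HOL-Computational_Algebra.Computational_Algebra"
    "HOL-Number_Theory.Totient"
begin

definition cyclotomic_complex :: "nat \<Rightarrow> complex poly" where
  "cyclotomic_complex n =
     (\<Prod>k\<in>totatives n. [:- cis (2 * pi * real k / real n), 1:])"

text \<open>
  The coefficients of the product above are integers, so that they can be compared: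
  the description is justified by \<open>of_int_cyclotomic\<close> below.
\<close>

definition cyclotomic :: "nat \<Rightarrow> int poly" where
  "cyclotomic n = (THE f. map_poly of_int f = cyclotomic_complex n)"

definition poly_diameter :: "int poly \<Rightarrow> int" where
  "poly_diameter f = Max (set (coeffs f)) - Min (set (coeffs f))"

definition cyclotomic_diameter :: "nat \<Rightarrow> int" where
  "cyclotomic_diameter n = poly_diameter (cyclotomic n)"

lemma monic_cyclotomic_complex: "lead_coeff (cyclotomic_complex n) = 1"
  unfolding cyclotomic_complex_def lead_coeff_prod by simp

lemma prod_roots_of_unity:
  assumes "n > 0"
  shows "(\<Prod>k\<in>{0<..n}. [:- cis (2 * pi * real k / real n), 1:]) = monom 1 n - 1"
proof -
  define f where "f = (\<lambda>k. [:- cis (2 * pi * real k / real n), 1:])"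
  let ?p = "monom 1 n - 1 :: complex poly"
  have roots: "{z. poly ?p z = 0} = {z. z ^ n = 1}"
    by (simp add: poly_monom)
  have deg: "degree ?p = n"
    using degree_add_eq_left[of "-1" "monom 1 n :: complex poly"] assms
    by (simp add: degree_monom_eq)
  have lc: "lead_coeff ?p = 1"
    unfolding deg using assms by simp
  have "rsquarefree ?p"
    unfolding rsquarefree_roots
    using assms by (auto simp: poly_monom pderiv_diff pderiv_monom power_0_left)
  from complex_poly_decompose_rsquarefree[OF this]
  have p: "(\<Prod>z\<in>{z. z ^ n = 1}. [:-z, 1:]) = ?p"
    unfolding lc roots by simp
  have "(\<Prod>z\<in>{z. z ^ n = 1}. [:-z, 1:]) = prod f {..<n}"
    unfolding f_def by (rule prod.reindex_bij_betw[OF bij_betw_roots_unity[OF assms], symmetric])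
  also have "{..<n} = insert 0 {0<..<n}"
    using assms by auto
  also have "prod f \<dots> = f 0 * prod f {0<..<n}"
    by (subst prod.insert) auto
  also have "f 0 = f n"
    using assms by (simp add: f_def)
  also have "f n * prod f {0<..<n} = prod f (insert n {0<..<n})"
    by (subst prod.insert) auto
  also have "insert n {0<..<n} = {0<..n}"
    using assms by auto
  finally show ?thesis
    unfolding p f_def by simp
qed

lemma prod_cyclotomic_complex:
  assumes "n > 0"
  shows "(\<Prod>d | d dvd n. cyclotomic_complex d) = monom 1 n - 1"
proof -
  define f where "f = (\<lambda>k. [:- cis (2 * pi * real k / real n), 1:])"
  have fin: "finite {d. d dvd n}"
    using assms by simp
  have "(\<Prod>d | d dvd n. cyclotomic_complex d) = (\<Prod>d | d dvd n. cyclotomic_complex (n div d))"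
    by (rule prod.reindex_bij_witness[of _ "\<lambda>d. n div d" "\<lambda>d. n div d"])
       (use assms in \<open>auto elim!: dvdE\<close>)
  also have "\<dots> = (\<Prod>d | d dvd n. prod f {k\<in>{0<..n}. gcd k n = d})"
  proof (rule prod.cong[OF refl])
    fix d assume "d \<in> {d. d dvd n}"
    then have d: "d dvd n" by simp
    have "d > 0" using d assms by (auto intro: Nat.gr0I)
    have "cyclotomic_complex (n div d) = (\<Prod>k\<in>totatives (n div d). f (k * d))"
      unfolding cyclotomic_complex_def f_def
      using d \<open>d > 0\<close> by (intro prod.cong) (auto simp: real_of_nat_div mult.assoc)
    also have "\<dots> = prod f {k\<in>{0<..n}. gcd k n = d}"
      by (rule prod.reindex_bij_betw[OF bij_betw_totatives_gcd_eq[OF d assms]])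
    finally show "cyclotomic_complex (n div d) = prod f {k\<in>{0<..n}. gcd k n = d}" .
  qed
  also have "\<dots> = prod f {0<..n}"
    by (rule prod.group) (use fin in auto)
  finally show ?thesis
    using prod_roots_of_unity[OF assms] by (simp add: f_def)
qed

lemma map_poly_of_int_mult:
  "map_poly of_int (f * g) = (map_poly of_int f * map_poly of_int g :: complex poly)"
  by (rule poly_eqI) (simp add: coeff_map_poly coeff_mult)

lemma map_poly_of_int_add:
  "map_poly of_int (f + g) = (map_poly of_int f + map_poly of_int g :: complex poly)"
  by (rule poly_eqI) (simp add: coeff_map_poly)

lemma map_poly_of_int_diff:
  "map_poly of_int (f - g) = (map_poly of_int f - map_poly of_int g :: complex poly)"
  by (rule poly_eqI) (simp add: coeff_map_poly)

lemma map_poly_of_int_prod: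
  "map_poly of_int (prod f A) = (\<Prod>x\<in>A. map_poly of_int (f x) :: complex poly)"
  by (induction A rule: infinite_finite_induct) (simp_all add: map_poly_of_int_mult)

lemma map_poly_of_int_eq_iff:
  "(map_poly of_int f :: complex poly) = map_poly of_int g \<longleftrightarrow> f = g"
  by (auto simp: poly_eq_iff coeff_map_poly)

lemma cyclotomic_complex_integral:
  "\<exists>f :: int poly. map_poly of_int f = cyclotomic_complex n"
proof (induction n rule: less_induct)
  case (less n)
  show ?case
  proof (cases "n = 0")
    case True
    then show ?thesis
      by (auto simp: cyclotomic_complex_def intro!: exI[of _ 1])
  next
    case False
    then have n: "n > 0" by simp
    define D where "D = {d. d dvd n} - {n}"
    have D: "finite D" "n \<notin> D" "{d. d dvd n} = insert n D"
      using n by (auto simp: D_def)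
    have "\<forall>d\<in>D. \<exists>f :: int poly. map_poly of_int f = cyclotomic_complex d"
    proof
      fix d assume "d \<in> D"
      then have "d < n"
        using dvd_imp_le[OF _ n, of d] by (simp add: D_def)
      then show "\<exists>f :: int poly. map_poly of_int f = cyclotomic_complex d"
        by (rule less.IH)
    qed
    then obtain F :: "nat \<Rightarrow> int poly"
      where F: "\<And>d. d \<in> D \<Longrightarrow> map_poly of_int (F d) = cyclotomic_complex d"
      by metis
    define g where "g = prod F D"
    let ?G = "map_poly of_int g :: complex poly"
    have G: "?G = (\<Prod>d\<in>D. cyclotomic_complex d)"
      using F by (simp add: g_def map_poly_of_int_prod)
    have lcG: "lead_coeff ?G = 1"
      unfolding G lead_coeff_prod by (simp add: monic_cyclotomic_complex)
    have degG: "degree ?G = degree g"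
      by (rule degree_map_poly) simp
    have lcg: "lead_coeff g = 1"
      using lcG unfolding degG by (simp add: coeff_map_poly)
    have "g \<noteq> 0" using lcg by auto
    have prodG: "cyclotomic_complex n * ?G = monom 1 n - 1"
      using prod_cyclotomic_complex[OF n] D by (simp add: G)
    obtain q r where qr: "pseudo_divmod (monom 1 n - 1) g = (q, r)"
      by (cases "pseudo_divmod (monom 1 n - 1) g") auto
    have div: "monom 1 n - 1 = g * q + r" and r: "r = 0 \<or> degree r < degree g"
      using pseudo_divmod[OF \<open>g \<noteq> 0\<close> qr] lcg by auto
    have "monom 1 n - 1 = ?G * map_poly of_int q + map_poly of_int r"
      using arg_cong[OF div, of "map_poly of_int :: int poly \<Rightarrow> complex poly"]
      by (simp add: map_poly_of_int_add map_poly_of_int_mult map_poly_of_int_diff map_poly_monom)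
    then have eq: "map_poly of_int r = ?G * (cyclotomic_complex n - map_poly of_int q)"
      using prodG by (simp add: algebra_simps)
    have "cyclotomic_complex n - map_poly of_int q = 0"
    proof (rule ccontr)
      assume nz: "cyclotomic_complex n - map_poly of_int q \<noteq> 0"
      have "?G \<noteq> 0" using lcG by auto
      with nz have "(map_poly of_int r :: complex poly) \<noteq> 0"
        unfolding eq by simp
      then have "r \<noteq> 0" by auto
      have "degree (map_poly of_int r :: complex poly) \<ge> degree ?G"
        unfolding eq using nz \<open>?G \<noteq> 0\<close> by (subst degree_mult_eq) auto
      moreover have "degree (map_poly of_int r :: complex poly) = degree r"
        by (rule degree_map_poly) simp
      ultimately show False
        using r \<open>r \<noteq> 0\<close> degG by simp
    qed
    then show ?thesis
      by (intro exI[of _ q]) simp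
  qed
qed

lemma of_int_cyclotomic: "map_poly of_int (cyclotomic n) = cyclotomic_complex n"
proof -
  obtain f :: "int poly" where f: "map_poly of_int f = cyclotomic_complex n"
    using cyclotomic_complex_integral by blast
  show ?thesis
    unfolding cyclotomic_def
  proof (rule theI)
    show "map_poly of_int f = cyclotomic_complex n"
      by (rule f)
    show "g = f" if "map_poly of_int g = cyclotomic_complex n" for g :: "int poly"
      using that f map_poly_of_int_eq_iff[of g f] by simp
  qed
qed

end

theory Submission
  imports "HOL-Number_Theory.Residue_Primitive_Roots" "HOL-Number_Theory.Prime_Powers" Defs
begin

text \<open>
  If $r (p + s q) \equiv 1 \pmod{pq}$ with $s = \pm 1$, then a coefficient of $\Phi_{pqr}$ is a sum of
  truncated coefficients of $\Phi_{pq}$ over $p$ consecutive points of a line in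
  $\mathbb{Z}/q \times \mathbb{Z}/p$, minus the same sum with the second coordinate shifted by
  $s q$. As $q$ is large compared to $p^2$, such a window meets at most one boundary of the support
  of $\Phi_{pq}$ and one jump of the truncation, so that the difference only counts points near the
  ends of the window. For $s = 1$ and $q \equiv c \pmod p$ with $1 \le c \le (p-1)/2$ the coefficients
  range from $-c$ to $c$, and for $s = -1$ and $q \equiv 1 \pmod p$ they range from $-2$ to $1$.
  Dirichlet's theorem supplies the primes $q$ and $r$, and the $(p+1)/2$ diameters
  $2, 4, \dots, p - 1$ and $3$ are attained. Dirichlet's theorem is proved by Shapiro's elementary
  argument, with Monsky's proof that $L(1, \chi) \ne 0$ for real $\chi$.
\<close>

text \<open>The condition on $r$ makes $p + s q$ its inverse modulo $pq$, so lowering an exponent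
  $z$ by 1 moves the pair (z mod q, s z mod p) by (-1, -s); this is why the $p$ terms produced by (1
  - x^p)/(1 - x) lie on a line. Taking $r > pq$ makes the truncation level \<open>n div r\<close>
  independent of \<open>n\<close> modulo $pq$: any line can be combined with any level, and the
  extreme values are found by choosing both. For the bounds, each window is rewritten as a function
  of the second coordinate alone, which cancels over $p$ consecutive points, plus one interval whose
  end moves by at most 1. Dirichlet's theorem is applied to the moduli $p$ and $pq$ only. Both are
  odd, so every prime power dividing them has a primitive root, from which enough characters are
  built explicitly.\<close>

section \<open>Counting points in a shifted window\<close>

text \<open>
  Translation by $c$ matches the two sets up to the $c$ points at one end of the window. Where $t$
  drops, one more point $x_0$ may be unmatched; then either $h$ or $l + c - 1$ makes up for it, since
  otherwise the interval of residues would recur within less than $p$ steps.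
\<close>

lemma window_count_le:
  fixes t :: "int \<Rightarrow> int" and p l h b c \<alpha> :: int
  assumes c: "0 < c" and len: "h < l + p" and \<alpha>: "0 \<le> \<alpha>"
    and anti: "\<And>x y. l \<le> x \<Longrightarrow> x \<le> y \<Longrightarrow> y \<le> h \<Longrightarrow> t y \<le> t x"
    and drop: "t l \<le> t h + 1"
  defines "N1 \<equiv> {x\<in>{l..h}. \<alpha> \<le> (x + b) mod p \<and> (x + b) mod p \<le> t x}"
    and "N2 \<equiv> {x\<in>{l..h}. \<alpha> \<le> (x + b - c) mod p \<and> (x + b - c) mod p \<le> t x}"
  shows "\<bar>int (card N1) - int (card N2)\<bar> \<le> c"
proof -
  have fin: "finite N1" "finite N2"
    unfolding N1_def N2_def by (rule finite_subset[of _ "{l..h}"], blast, simp)+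
  have img: "card (f ` A) \<le> card A" if "finite A" for f :: "int \<Rightarrow> int" and A
    using card_image_le[OF that] .
  have "N2 \<subseteq> {l..<l+c} \<union> (\<lambda>x. x + c) ` N1"
  proof
    fix x assume x: "x \<in> N2"
    show "x \<in> {l..<l+c} \<union> (\<lambda>x. x + c) ` N1"
    proof (cases "x < l + c")
      case False
      have "t x \<le> t (x - c)"
        using anti[of "x - c" x] x False c by (auto simp: N2_def)
      then have "x - c \<in> N1"
        using x False c by (auto simp: N1_def N2_def algebra_simps)
      then have "x \<in> (\<lambda>x. x + c) ` N1"
        by (rule rev_image_eqI) simp
      then show ?thesis by simp
    qed (use x in \<open>auto simp: N2_def\<close>)
  qed
  then have "card N2 \<le> card ({l..<l+c} \<union> (\<lambda>x. x + c) ` N1)"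
    using fin by (intro card_mono) auto
  also have "\<dots> \<le> card {l..<l+c} + card N1"
    using card_Un_le[of "{l..<l+c}" "(\<lambda>x. x + c) ` N1"] img[OF fin(1), of "\<lambda>x. x + c"] by linarith
  finally have le1: "int (card N2) \<le> int (card N1) + c"
    using c by simp
  have le2: "int (card N1) \<le> int (card N2) + c"
  proof (cases "\<forall>x\<in>N1. x + c \<le> h \<longrightarrow> x + c \<in> N2")
    case True
    have "N1 \<subseteq> {h-c<..h} \<union> (\<lambda>x. x - c) ` N2"
    proof
      fix x assume x: "x \<in> N1"
      show "x \<in> {h-c<..h} \<union> (\<lambda>x. x - c) ` N2"
      proof (cases "x + c \<le> h")
        case True': True
        then have "x + c \<in> N2" using True x by auto
        then have "x \<in> (\<lambda>x. x - c) ` N2"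
          by (rule rev_image_eqI) simp
        then show ?thesis by simp
      qed (use x in \<open>auto simp: N1_def\<close>)
    qed
    then have "card N1 \<le> card ({h-c<..h} \<union> (\<lambda>x. x - c) ` N2)"
      using fin by (intro card_mono) auto
    also have "\<dots> \<le> card {h-c<..h} + card N2"
      using card_Un_le[of "{h-c<..h}" "(\<lambda>x. x - c) ` N2"] img[OF fin(2), of "\<lambda>x. x - c"] by linarith
    finally show ?thesis using c by simp
  next
    case False
    then obtain x0 where x0: "x0 \<in> N1" "x0 + c \<le> h" "x0 + c \<notin> N2" by auto
    define \<tau> where "\<tau> = t x0"
    have x0l: "l \<le> x0" using x0 by (auto simp: N1_def)
    have p: "p > 0" using x0l x0(2) c len by linarith
    have notle: "t (x0 + c) < (x0 + b) mod p"
      using x0 x0l c by (auto simp: N1_def N2_def algebra_simps)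
    have tx: "t x0 \<le> t l" "t h \<le> t (x0 + c)"
      using anti[of l x0] anti[of "x0+c" h] x0 x0l c by auto
    \<comment> \<open>The residue is squeezed: it exceeds \<open>t (x0 + c)\<close>, which is at
      least \<open>t h\<close> and so at least \<open>t l - 1\<close>, and it is at most
      \<open>t x0\<close>, hence at most \<open>t l\<close>.\<close>
    have y0: "(x0 + b) mod p = \<tau>" "t h = \<tau> - 1" "t l = \<tau>" "\<alpha> \<le> \<tau>"
      using notle tx drop x0(1) by (auto simp: N1_def \<tau>_def)
    have tge: "\<tau> - 1 \<le> t x" "t x \<le> \<tau>" if "l \<le> x" "x \<le> h" for x
      using anti[of x h] anti[of l x] that y0 by auto
    have uniq: "x = x0" if x: "x \<in> N1" "x + c \<le> h" "x + c \<notin> N2" for x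
    proof -
      have xl: "l \<le> x" "x \<le> h" using x c by (auto simp: N1_def)
      have "t (x + c) < (x + b) mod p"
        using x xl c by (auto simp: N1_def N2_def algebra_simps)
      moreover have "\<tau> - 1 \<le> t (x + c)" using tge[of "x + c"] x xl c by auto
      moreover have "(x + b) mod p \<le> t x" using x by (auto simp: N1_def)
      ultimately have "(x + b) mod p = \<tau>" using tge[of x] xl by auto
      then have "(x + b) mod p = (x0 + b) mod p" using y0 by simp
      then have "p dvd (x - x0)" by (simp add: mod_eq_dvd_iff)
      moreover have "\<bar>x - x0\<bar> < p" using xl x0l x0(2) c len by auto
      ultimately show ?thesis using dvd_imp_le_int[of "x - x0" p] by auto
    qed
    have sub: "N1 \<subseteq> {h-c<..h} \<inter> N1 \<union> (\<lambda>x. x - c) ` {x\<in>N2. l \<le> x - c} \<union> {x0}"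
    proof
      fix x assume x: "x \<in> N1"
      show "x \<in> {h-c<..h} \<inter> N1 \<union> (\<lambda>x. x - c) ` {x\<in>N2. l \<le> x - c} \<union> {x0}"
      proof (cases "x + c \<le> h \<and> x + c \<in> N2")
        case True
        then have "x + c \<in> {x\<in>N2. l \<le> x - c}" using x by (auto simp: N1_def)
        then have "x \<in> (\<lambda>x. x - c) ` {x\<in>N2. l \<le> x - c}"
          by (rule rev_image_eqI) simp
        then show ?thesis by simp
      qed (use x uniq in \<open>auto simp: N1_def\<close>)
    qed
    have "h \<notin> N1 \<or> l + c - 1 \<in> N2"
    proof (rule ccontr)
      assume "\<not> ?thesis"
      then have h: "h \<in> N1" and l: "l + c - 1 \<notin> N2" by auto
      have lh: "l + c - 1 \<le> h" using x0 x0l by linarith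
      \<comment> \<open>Going down from \<open>x0\<close>, the residues \<tau>, ..., \<alpha> belong
        to the points from \<open>x0\<close> to \<open>x0 - m\<close>. If \<open>l\<close> cut this
        run short, \<open>l + c - 1\<close>, which in \<open>N2\<close> has the residue of
        \<open>l - 1\<close>, would lie in \<open>N2\<close>. So the run fits in the window, and
        fewer than \<open>p - m\<close> steps are left from \<open>x0\<close> to \<open>h\<close>,
        too few to reach \<alpha> again.\<close>
      define m where "m = \<tau> - \<alpha>"
      have "l \<le> x0 - m"
      proof (rule ccontr)
        assume "\<not> l \<le> x0 - m"
        define d where "d = x0 - (l - 1)"
        have d: "1 \<le> d" "d \<le> m" using \<open>\<not> l \<le> x0 - m\<close> x0l by (auto simp: d_def)
        have "\<tau> < p" "0 \<le> \<tau>" using y0(1) p by (auto simp flip: y0(1))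
        have "(l - 1 + b) mod p = ((x0 + b) mod p - d) mod p"
          unfolding mod_diff_left_eq by (simp add: d_def add.commute)
        also have "\<dots> = \<tau> - d"
          using d \<alpha> \<open>\<tau> < p\<close> unfolding y0(1) by (intro mod_pos_pos_trivial) (auto simp: m_def)
        finally have r: "(l - 1 + b) mod p = \<tau> - d" .
        have e: "l + c - 1 + b - c = l - 1 + b" by simp
        have "l + c - 1 \<in> N2"
          unfolding N2_def using lh c d r tge[of "l + c - 1"] by (simp add: e m_def)
        then show False using l by simp
      qed
      define d where "d = h - x0"
      have d: "1 \<le> d" "d \<le> p - m - 1"
        using x0 c len \<open>l \<le> x0 - m\<close> by (auto simp: d_def)
      have \<tau>: "\<tau> < p" "0 \<le> \<tau>" using y0(1) p by (auto simp flip: y0(1))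
      have hr: "(h + b) mod p = (\<tau> + d) mod p"
        unfolding y0(1)[symmetric] mod_add_left_eq by (simp add: d_def add.commute)
      have hN: "\<alpha> \<le> (h + b) mod p" "(h + b) mod p \<le> \<tau> - 1"
        using h y0 by (auto simp: N1_def)
      show False
      proof (cases "\<tau> + d < p")
        case True
        then have "(\<tau> + d) mod p = \<tau> + d" using \<tau> d by (intro mod_pos_pos_trivial) auto
        then show False using hN hr d by simp
      next
        case False
        then have "(\<tau> + d - p) mod p = \<tau> + d - p"
          using \<tau> d \<alpha> y0 by (intro mod_pos_pos_trivial) (auto simp: m_def)
        then have "(\<tau> + d) mod p = \<tau> + d - p" by simp
        then show False using hN hr d by (simp add: m_def)
      qed
    qed
    \<comment> \<open>The 1 on the left pays for the unmatched point \<open>x0\<close>.\<close>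
    then have less: "card ({h-c<..h} \<inter> N1) + card {x\<in>N2. l \<le> x - c} + 1 \<le> nat c + card N2"
    proof
      assume "h \<notin> N1"
      then have "card ({h-c<..h} \<inter> N1) \<le> card {h-c<..<h}"
        by (intro card_mono) (auto simp: order.order_iff_strict)
      moreover have "card {h-c<..<h} + 1 = nat c"
        using c by simp
      moreover have "card {x\<in>N2. l \<le> x - c} \<le> card N2"
        using fin by (intro card_mono) auto
      ultimately show ?thesis by linarith
    next
      assume "l + c - 1 \<in> N2"
      moreover have "l + c - 1 \<notin> {x\<in>N2. l \<le> x - c}" by simp
      ultimately have "{x\<in>N2. l \<le> x - c} \<subset> N2" by blast
      then have "card {x\<in>N2. l \<le> x - c} < card N2"
        using fin by (intro psubset_card_mono) auto
      moreover have "card ({h-c<..h} \<inter> N1) \<le> card {h-c<..h}"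
        by (intro card_mono) auto
      ultimately show ?thesis by simp
    qed
    have "card N1 \<le> card ({h-c<..h} \<inter> N1 \<union> (\<lambda>x. x - c) ` {x\<in>N2. l \<le> x - c} \<union> {x0})"
      using fin by (intro card_mono[OF _ sub]) auto
    also have "\<dots> \<le> card ({h-c<..h} \<inter> N1) + card ((\<lambda>x. x - c) ` {x\<in>N2. l \<le> x - c}) + card {x0}"
      by (meson add_le_mono card_Un_le le_refl order_trans)
    also have "\<dots> \<le> card ({h-c<..h} \<inter> N1) + card {x\<in>N2. l \<le> x - c} + 1"
      using img[of "{x\<in>N2. l \<le> x - c}" "\<lambda>x. x - c"] fin by auto
    also note less
    finally show ?thesis using c by linarith
  qed
  show ?thesis using le1 le2 by linarith
qed

text \<open>Translation by 1 matches the sets up to one end point in each direction. From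
  \<open>N1\<close> to \<open>N2\<close> the drop of \<open>t\<close> can lose one further point,
  and here nothing need make up for it; hence the asymmetric constants 1 and 2.\<close>

lemma reversed_window_count:
  fixes t :: "int \<Rightarrow> int" and p l h b \<alpha> :: int
  assumes len: "h < l + p" and \<alpha>: "0 \<le> \<alpha>"
    and anti: "\<And>x y. l \<le> x \<Longrightarrow> x \<le> y \<Longrightarrow> y \<le> h \<Longrightarrow> t y \<le> t x"
    and drop: "t l \<le> t h + 1"
  defines "N1 \<equiv> {x\<in>{l..h}. \<alpha> \<le> (b - x) mod p \<and> (b - x) mod p \<le> t x}"
    and "N2 \<equiv> {x\<in>{l..h}. \<alpha> \<le> (b - x + 1) mod p \<and> (b - x + 1) mod p \<le> t x}"
  shows "card N2 \<le> card N1 + 1" and "card N1 \<le> card N2 + 2"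
proof -
  have fin: "finite N1" "finite N2"
    unfolding N1_def N2_def by (rule finite_subset[of _ "{l..h}"], blast, simp)+
  have img: "card (f ` A) \<le> card A" if "finite A" for f :: "int \<Rightarrow> int" and A
    using card_image_le[OF that] .
  have "N2 \<subseteq> {l} \<union> (\<lambda>x. x + 1) ` N1"
  proof
    fix x assume x: "x \<in> N2"
    show "x \<in> {l} \<union> (\<lambda>x. x + 1) ` N1"
    proof (cases "x = l")
      case False
      have "t x \<le> t (x - 1)"
        using anti[of "x - 1" x] x False by (auto simp: N2_def)
      then have "x - 1 \<in> N1"
        using x False by (auto simp: N1_def N2_def algebra_simps)
      then have "x \<in> (\<lambda>x. x + 1) ` N1"
        by (rule rev_image_eqI) simp
      then show ?thesis by simp
    qed auto
  qed
  then have "card N2 \<le> card ({l} \<union> (\<lambda>x. x + 1) ` N1)"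
    using fin by (intro card_mono) auto
  also have "\<dots> \<le> card {l} + card N1"
    using card_Un_le[of "{l}" "(\<lambda>x. x + 1) ` N1"] img[OF fin(1), of "\<lambda>x. x + 1"] by linarith
  finally show "card N2 \<le> card N1 + 1" by simp
  \<comment> \<open>The points whose partner is lost to the drop of \<open>t\<close>. Their residue
    must be \<open>t l\<close>, which occurs at most once among fewer than \<open>p + 1\<close>
    consecutive points.\<close>
  define E where "E = {x\<in>N1. x < h \<and> x + 1 \<notin> N2}"
  have "x = x'" if "x \<in> E" "x' \<in> E" for x x'
  proof -
    have mod: "(b - x) mod p = t l" if "x \<in> E" for x
    proof -
      have "t (x + 1) < (b - x) mod p" "(b - x) mod p \<le> t x"
        using that by (auto simp: E_def N1_def N2_def algebra_simps)
      moreover have "t h \<le> t (x + 1)" "t x \<le> t l"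
        using anti[of "x + 1" h] anti[of l x] that by (auto simp: E_def N1_def)
      ultimately show ?thesis using drop by linarith
    qed
    have "(b - x) mod p = (b - x') mod p" using mod that by simp
    then have "p dvd (x' - x)" by (simp add: mod_eq_dvd_iff)
    moreover have "\<bar>x' - x\<bar> < p" using that len by (auto simp: E_def N1_def)
    ultimately show ?thesis using dvd_imp_le_int[of "x' - x" p] by auto
  qed
  then have E: "card E \<le> 1"
    using fin by (simp add: card_le_Suc0_iff_eq E_def)
  have "N1 \<subseteq> {h} \<union> E \<union> (\<lambda>x. x - 1) ` N2"
  proof
    fix x assume x: "x \<in> N1"
    show "x \<in> {h} \<union> E \<union> (\<lambda>x. x - 1) ` N2"
    proof (cases "x < h \<and> x + 1 \<in> N2")
      case True
      then have "x \<in> (\<lambda>x. x - 1) ` N2"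
        by (intro rev_image_eqI[of "x + 1"]) auto
      then show ?thesis by simp
    qed (use x in \<open>auto simp: E_def N1_def\<close>)
  qed
  then have "card N1 \<le> card ({h} \<union> E \<union> (\<lambda>x. x - 1) ` N2)"
    using fin by (intro card_mono) (auto simp: E_def)
  also have "\<dots> \<le> card {h} + card E + card ((\<lambda>x. x - 1) ` N2)"
    by (meson add_le_mono card_Un_le le_refl order_trans)
  finally show "card N1 \<le> card N2 + 2"
    using E img[OF fin(2), of "\<lambda>x. x - 1"] by simp
qed


text \<open>Exponents are written as \<open>x + b\<close> with \<open>b\<close> a multiple of $q$,
  so \<open>x\<close> alone determines the first coordinate and \<open>b\<close> only moves the
  second; \<open>c\<close> stands for $q$ modulo $p$.\<close>

definition shift_diff :: "int \<Rightarrow> int \<Rightarrow> int \<Rightarrow> int \<Rightarrow> int \<Rightarrow> int \<Rightarrow> (int \<Rightarrow> int \<Rightarrow> int) \<Rightarrow> int"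
  where "shift_diff p s c b l h f =
    (\<Sum>x=l..h. f x ((s * (x + b)) mod p) - f x ((s * (x + b) - s * c) mod p))"

lemma shift_diff_eq_card:
  "shift_diff p s c b l h (\<lambda>x y. of_bool (S x y)) =
     int (card {x\<in>{l..h}. S x ((s * (x + b)) mod p)}) -
     int (card {x\<in>{l..h}. S x ((s * (x + b) - s * c) mod p)})"
proof -
  have "(\<Sum>x=l..h. of_bool (P x)) = int (card {x\<in>{l..h}. P x})" for P
    by (subst sum_of_bool_eq) (simp_all add: Int_def)
  then show ?thesis by (simp only: shift_diff_def sum_subtractf)
qed

lemma sum_full_period:
  fixes p :: int
  assumes "p > 0" and s: "s = 1 \<or> s = -1"
  shows "(\<Sum>x=a..a+p-1. g ((s * x + d) mod p)) = (\<Sum>y\<in>{0..<p}. g y)"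
proof -
  let ?f = "\<lambda>x. (s * x + d) mod p"
  have inj: "inj_on ?f {a..a+p-1}"
  proof (rule inj_onI)
    fix x x' assume x: "x \<in> {a..a+p-1}" "x' \<in> {a..a+p-1}" "?f x = ?f x'"
    then have "p dvd (s * x + d) - (s * x' + d)" by (simp add: mod_eq_dvd_iff)
    then have "p dvd s * (x - x')" by (simp add: algebra_simps)
    then have "p dvd x - x'" using s by (auto simp: dvd_diff_commute)
    moreover have "\<bar>x - x'\<bar> < p" using x by auto
    ultimately show "x = x'" using dvd_imp_le_int[of "x - x'" p] by auto
  qed
  have "?f ` {a..a+p-1} = {0..<p}"
  proof (rule card_subset_eq)
    show "?f ` {a..a+p-1} \<subseteq> {0..<p}" using \<open>p > 0\<close> by auto
    show "card (?f ` {a..a+p-1}) = card {0..<p}"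
      using inj by (simp add: card_image)
  qed simp
  then have "(\<Sum>y\<in>{0..<p}. g y) = sum g (?f ` {a..a+p-1})" by simp
  also have "\<dots> = (\<Sum>x=a..a+p-1. g (?f x))"
    using inj by (simp add: sum.reindex)
  finally show ?thesis by simp
qed

text \<open>Along $p$ consecutive points the second coordinate takes each residue once, both before
  and after the shift. This disposes of every part of a coefficient that depends on the second
  coordinate only.\<close>

lemma shift_diff_const:
  assumes "p > 0" and s: "s = 1 \<or> s = -1"
  shows "shift_diff p s c b a (a + p - 1) (\<lambda>_. g) = 0"
proof -
  have "(\<Sum>x=a..a+p-1. g ((s * (x + b)) mod p)) = (\<Sum>y\<in>{0..<p}. g y)"
    using sum_full_period[OF assms, of g "s * b" a] by (simp add: algebra_simps)
  moreover have "(\<Sum>x=a..a+p-1. g ((s * (x + b) - s * c) mod p)) = (\<Sum>y\<in>{0..<p}. g y)"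
    using sum_full_period[OF assms, of g "s * b - s * c" a] by (simp add: algebra_simps)
  ultimately show ?thesis by (simp add: shift_diff_def sum_subtractf)
qed

lemma shift_diff_add:
  "shift_diff p s c b l h (\<lambda>x y. f x y + g x y) =
     shift_diff p s c b l h f + shift_diff p s c b l h g"
  unfolding shift_diff_def sum.distrib[symmetric] by (intro sum.cong refl) simp

lemma shift_diff_minus:
  "shift_diff p s c b l h (\<lambda>x y. - f x y) = - shift_diff p s c b l h f"
  unfolding shift_diff_def sum_negf[symmetric] by (intro sum.cong refl) simp

lemma shift_diff_cong:
  assumes "p > 0"
    and "\<And>x y. l \<le> x \<Longrightarrow> x \<le> h \<Longrightarrow> 0 \<le> y \<Longrightarrow> y < p \<Longrightarrow> f x y = g x y"
  shows "shift_diff p s c b l h f = shift_diff p s c b l h g"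
  unfolding shift_diff_def using assms by (intro sum.cong refl) simp

lemma shift_diff_restrict:
  assumes "l \<le> l'" "h' \<le> h" and "\<And>x y. l \<le> x \<Longrightarrow> x \<le> h \<Longrightarrow> \<not> (l' \<le> x \<and> x \<le> h') \<Longrightarrow> f x y = 0"
  shows "shift_diff p s c b l h f = shift_diff p s c b l' h' f"
  unfolding shift_diff_def using assms by (intro sum.mono_neutral_right) auto

text \<open>
  For $X$ and $Y$ with $pX + qY = pq + 1$ this is the coefficient of $\Phi_{pq}$ at the exponent
  $j \equiv px + qy \pmod{pq}$, replaced by $0$ if $j > J$.
\<close>

definition binary_coeff :: "int \<Rightarrow> int \<Rightarrow> int \<Rightarrow> int \<Rightarrow> int \<Rightarrow> int \<Rightarrow> int \<Rightarrow> int"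
  where "binary_coeff p q X Y J x y =
    of_bool (x < X \<and> y < Y \<and> p * x + q * y \<le> J) -
    of_bool (X \<le> x \<and> Y \<le> y \<and> p * x + q * y \<le> J + p * q)"

lemma le_int_div_iff:
  fixes y m q :: int
  assumes "0 < q"
  shows "y \<le> m div q \<longleftrightarrow> q * y \<le> m"
proof
  assume "y \<le> m div q"
  then have "q * y \<le> q * (m div q)" using assms by simp
  also have "\<dots> \<le> m" using assms by (simp add: minus_mod_eq_mult_div [symmetric])
  finally show "q * y \<le> m" .
next
  assume "q * y \<le> m"
  then have "(q * y) div q \<le> m div q" using assms by (rule zdiv_mono1)
  then show "y \<le> m div q" using assms by simp
qed

text \<open>The geometry of a window is the same for both signs $s$; only the counts at its ends
  differ. The three assumed bounds are the shapes that survive the case analysis. Their signs are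
  kept because \<open>{lo..hi}\<close> may be asymmetric, and an interval entering with a plus sign
  always stays in the rows below \<open>Y\<close>.\<close>

locale window_estimate =
  fixes p q X Y s c lo hi :: int
  assumes p: "1 < p" and q: "p * p < q" and XY: "p * X + q * Y = p * q + 1"
    and Y: "0 < Y" "Y < p" and s: "s = 1 \<or> s = -1"
    and antitone_bound: "\<And>l h b t \<alpha>. h < l + p \<Longrightarrow> 0 \<le> \<alpha> \<Longrightarrow>
        (\<And>x y. l \<le> x \<Longrightarrow> x \<le> y \<Longrightarrow> y \<le> h \<Longrightarrow> t y \<le> t x) \<Longrightarrow> t l \<le> t h + 1 \<Longrightarrow>
        - shift_diff p s c b l h (\<lambda>x y. of_bool (\<alpha> \<le> y \<and> y \<le> t x)) \<in> {lo..hi}"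
    and small_antitone_bound: "\<And>l h b t. h < l + p \<Longrightarrow>
        (\<And>x y. l \<le> x \<Longrightarrow> x \<le> y \<Longrightarrow> y \<le> h \<Longrightarrow> t y \<le> t x) \<Longrightarrow> t l \<le> t h + 1 \<Longrightarrow> t l < Y \<Longrightarrow>
        shift_diff p s c b l h (\<lambda>x y. of_bool (y \<le> t x)) \<in> {lo..hi}"
    and growing_bound: "\<And>l h b t. h < l + p \<Longrightarrow>
        (\<And>x y. l \<le> x \<Longrightarrow> x \<le> y \<Longrightarrow> y \<le> h \<Longrightarrow> t y \<le> t x) \<Longrightarrow> t l \<le> t h + 1 \<Longrightarrow>
        - shift_diff p s c b l h (\<lambda>x y. of_bool (t x \<le> y \<and> y < Y)) \<in> {lo..hi}"
begin

abbreviation "below J x y \<equiv> p * x + q * y \<le> J"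

abbreviation "step J x \<equiv> (J - p * x) div q"

lemma q_pos: "0 < q"
  using p q by (smt (verit) mult_pos_pos)

text \<open>As \<open>Y\<close> is neither 0 nor $p$, both \<open>p * X\<close> and
  \<open>p * (q - X)\<close> are at least about $q$, which exceeds $p^2$. So the boundaries 0 and
  \<open>X\<close>, taken cyclically modulo $q$, are too far apart for one window to cross
  both.\<close>

lemma X_bounds: "p < X" "p \<le> q - X"
proof -
  have "p * X = q * (p - Y) + 1" using XY by (simp add: algebra_simps)
  moreover have "q * 1 \<le> q * (p - Y)" using Y q_pos by (intro mult_left_mono) auto
  ultimately have "p * p < p * X" using q by simp
  then show "p < X" using p by simp
  have "p * (q - X) = q * Y - 1" using XY by (simp add: algebra_simps)
  moreover have "q * 1 \<le> q * Y" using Y q_pos by (intro mult_left_mono) auto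
  ultimately have "p * p \<le> p * (q - X)" using q by simp
  then show "p \<le> q - X" using p by simp
qed

lemma below_iff: "below J x y \<longleftrightarrow> y \<le> step J x"
  using le_int_div_iff[OF q_pos, of y "J - p * x"] by auto

lemma below_diff:
  assumes "x' \<le> x + p"
  shows "p * x' \<le> p * x + p * p"
  using mult_left_mono[OF assms, of p] p by (simp add: algebra_simps)

lemma step_antitone: "x \<le> y \<Longrightarrow> step J y \<le> step J x"
  using p q_pos by (intro zdiv_mono1) auto

text \<open>Along a window \<open>p * x\<close> changes by less than $q$, that is, by less than one
  row.\<close>

lemma step_drop:
  assumes "h < l + p"
  shows "step J l \<le> step J h + 1"
proof -
  have "J - p * l \<le> (J - p * h) + q"
    using below_diff[of h l] assms q by linarith
  then have "step J l \<le> (J - p * h + q) div q"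
    using q_pos by (intro zdiv_mono1) auto
  also have "\<dots> = step J h + 1" using q_pos by simp
  finally show ?thesis .
qed

text \<open>A negative \<open>x\<close> is represented by \<open>x + q\<close>, and the extra
  \<open>p * q\<close> is absorbed by the level \<open>J + p * q\<close>. For nonnegative
  \<open>x\<close> both indicators are enlarged by the same set, so that the second one no longer
  mentions the sign of \<open>x\<close>.\<close>

lemma wrapping_coeff:
  assumes x: "- p < x" "x < p"
  shows "binary_coeff p q X Y J (x mod q) y =
           of_bool (0 \<le> x \<and> below J x y) - of_bool (Y \<le> y \<and> below J x y)"
proof (cases "0 \<le> x")
  case True
  then have "x mod q = x"
    using x X_bounds by (intro mod_pos_pos_trivial) auto
  then show ?thesis using True x X_bounds by (auto simp: binary_coeff_def)
next
  case False
  have "(x + q) mod q = x + q"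
    using False x X_bounds by (intro mod_pos_pos_trivial) auto
  then have xq: "x mod q = x + q" by simp
  show ?thesis unfolding xq
    using False x X_bounds by (auto simp: binary_coeff_def algebra_simps)
qed

lemma wrapping_window:
  assumes a: "- p < a" "a < 0"
  shows "shift_diff p s c b a (a + p - 1) (\<lambda>x y. binary_coeff p q X Y J (x mod q) y) \<in> {lo..hi}"
proof -
  define h where "h = a + p - 1"
  let ?f = "\<lambda>x y. binary_coeff p q X Y J (x mod q) y"
  have f: "?f x y = of_bool (0 \<le> x \<and> below J x y) - of_bool (Y \<le> y \<and> below J x y)"
    if x: "a \<le> x" "x \<le> h" for x y
    using x a by (intro wrapping_coeff) (auto simp: h_def)
  show ?thesis
  \<comment> \<open>The level varies by less than one row along the window, so it cannot cut rows on
    both sides of \<open>Y\<close>: either no point with \<open>Y \<le> y\<close> lies below it, or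
    all points with \<open>y < Y\<close> do.\<close>
  proof (cases "\<forall>x y. a \<le> x \<longrightarrow> x \<le> h \<longrightarrow> Y \<le> y \<longrightarrow> \<not> below J x y")
    case True
    have "shift_diff p s c b a h ?f = shift_diff p s c b a h (\<lambda>x y. of_bool (0 \<le> x \<and> below J x y))"
      using True f p by (intro shift_diff_cong) auto
    also have "\<dots> = shift_diff p s c b 0 h (\<lambda>x y. of_bool (0 \<le> x \<and> below J x y))"
      using a by (intro shift_diff_restrict) auto
    also have "\<dots> = shift_diff p s c b 0 h (\<lambda>x y. of_bool (y \<le> step J x))"
      using p by (intro shift_diff_cong) (auto simp: below_iff)
    finally have eq: "shift_diff p s c b a h ?f = \<dots>" .
    have "\<not> below J 0 Y" using True[rule_format, of 0 Y] a by (simp add: h_def)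
    then have "step J 0 < Y" by (simp only: below_iff not_le)
    then show ?thesis
      unfolding eq h_def[symmetric] using a
      by (intro small_antitone_bound step_antitone step_drop) (auto simp: h_def)
  next
    case False
    then obtain x1 y1 where xy1: "a \<le> x1" "x1 \<le> h" "Y \<le> y1" "below J x1 y1" by auto
    have all: "below J x y" if "a \<le> x" "x \<le> h" "y < Y" for x y
    proof -
      have "q * y + q \<le> q * y1"
        using mult_left_mono[of "y + 1" y1 q] that xy1 q_pos by (simp add: algebra_simps)
      then show ?thesis using below_diff[of x x1] that xy1 q by (auto simp: h_def)
    qed
    have "shift_diff p s c b a h ?f = shift_diff p s c b a h
            (\<lambda>x y. of_bool (y < Y) + - of_bool (x < 0 \<and> below J x y))"
      using p f all by (intro shift_diff_cong) (auto simp: of_bool_def not_less)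
    also have "\<dots> = - shift_diff p s c b a h (\<lambda>x y. of_bool (x < 0 \<and> below J x y))"
      unfolding shift_diff_add shift_diff_minus h_def using p s by (simp add: shift_diff_const)
    also have "shift_diff p s c b a h (\<lambda>x y. of_bool (x < 0 \<and> below J x y)) =
        shift_diff p s c b a (-1) (\<lambda>x y. of_bool (x < 0 \<and> below J x y))"
      using a by (intro shift_diff_restrict) (auto simp: h_def)
    also have "\<dots> = shift_diff p s c b a (-1) (\<lambda>x y. of_bool (0 \<le> y \<and> y \<le> step J x))"
      using p by (intro shift_diff_cong) (auto simp: below_iff)
    finally have eq: "shift_diff p s c b a h ?f = - \<dots>" .
    show ?thesis
      unfolding eq h_def[symmetric] using a
      by (intro antitone_bound step_antitone step_drop) auto
  qed
qed

lemma crossing_window: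
  assumes a: "0 \<le> a" "a < X" "X \<le> a + p - 1"
  shows "shift_diff p s c b a (a + p - 1) (\<lambda>x y. binary_coeff p q X Y J x y) \<in> {lo..hi}"
proof -
  define h where "h = a + p - 1"
  let ?f = "\<lambda>x y. binary_coeff p q X Y J x y"
  show ?thesis
  \<comment> \<open>The levels \<open>J\<close> (left of \<open>X\<close>) and
    \<open>J + p * q\<close> (right of \<open>X\<close>) are \<open>p\<close> full rows apart, so at
    most one of them cuts the rows 0 to \<open>p - 1\<close> inside the window.\<close>
  proof (cases "\<forall>x y. a \<le> x \<longrightarrow> x \<le> h \<longrightarrow> y < p \<longrightarrow> below (J + p * q) x y")
    case True
    \<comment> \<open>Passing to the complement on the left produces one term in \<open>y\<close>
      only and one in \<open>x\<close> only; both are killed by the shift difference.\<close>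
    have "shift_diff p s c b a h ?f = shift_diff p s c b a h
            (\<lambda>x y. (of_bool (y < Y) + - of_bool (X \<le> x)) + - of_bool (x < X \<and> y < Y \<and> \<not> below J x y))"
      using p True by (intro shift_diff_cong) (auto simp: of_bool_def binary_coeff_def)
    also have "\<dots> = - shift_diff p s c b a h (\<lambda>x y. of_bool (x < X \<and> y < Y \<and> \<not> below J x y))"
      unfolding shift_diff_add shift_diff_minus h_def using p s
      by (simp add: shift_diff_const) (simp add: shift_diff_def)
    also have "shift_diff p s c b a h (\<lambda>x y. of_bool (x < X \<and> y < Y \<and> \<not> below J x y)) =
        shift_diff p s c b a (X - 1) (\<lambda>x y. of_bool (x < X \<and> y < Y \<and> \<not> below J x y))"
      using a by (intro shift_diff_restrict) (auto simp: h_def)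
    also have "\<dots> = shift_diff p s c b a (X - 1) (\<lambda>x y. of_bool (step J x + 1 \<le> y \<and> y < Y))"
      using p by (intro shift_diff_cong) (auto simp: below_iff)
    finally have eq: "shift_diff p s c b a h ?f = - \<dots>" .
    have drop: "step J a + 1 \<le> step J (X - 1) + 1 + 1"
      using step_drop[of "X - 1" a J] a by simp
    show ?thesis
      unfolding eq h_def[symmetric]
    proof (rule growing_bound)
      show "step J y + 1 \<le> step J x + 1" if "x \<le> y" for x y
        using step_antitone[OF that, of J] by simp
    qed (use a drop in auto)
  next
    case False
    then obtain x1 y1 where xy1: "a \<le> x1" "x1 \<le> h" "y1 < p" "\<not> below (J + p * q) x1 y1" by auto
    have none: "\<not> below J x y" if "a \<le> x" "x \<le> h" "0 \<le> y" for x y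
    proof -
      have "q * y1 + q \<le> q * p"
        using mult_left_mono[of "y1 + 1" p q] xy1 q_pos by (simp add: algebra_simps)
      moreover have "0 \<le> q * y" using that q_pos by simp
      ultimately show ?thesis
        using below_diff[of x1 x] that xy1 q by (auto simp: h_def mult.commute[of q p])
    qed
    have "shift_diff p s c b a h ?f = shift_diff p s c b a h
            (\<lambda>x y. - of_bool (X \<le> x \<and> Y \<le> y \<and> below (J + p * q) x y))"
      using p none by (intro shift_diff_cong) (auto simp: of_bool_def binary_coeff_def)
    also have "\<dots> = - shift_diff p s c b a h (\<lambda>x y. of_bool (X \<le> x \<and> Y \<le> y \<and> below (J + p * q) x y))"
      by (rule shift_diff_minus)
    also have "shift_diff p s c b a h (\<lambda>x y. of_bool (X \<le> x \<and> Y \<le> y \<and> below (J + p * q) x y)) =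
        shift_diff p s c b X h (\<lambda>x y. of_bool (X \<le> x \<and> Y \<le> y \<and> below (J + p * q) x y))"
      using a by (intro shift_diff_restrict) (auto simp: h_def)
    also have "\<dots> = shift_diff p s c b X h (\<lambda>x y. of_bool (Y \<le> y \<and> y \<le> step (J + p * q) x))"
      using p by (intro shift_diff_cong) (auto simp: below_iff)
    finally have eq: "shift_diff p s c b a h ?f = - \<dots>" .
    show ?thesis
      unfolding eq h_def[symmetric] using a Y
      by (intro antitone_bound step_antitone step_drop) (auto simp: h_def)
  qed
qed

lemma lower_window:
  assumes a: "0 \<le> a" "a + p - 1 < X"
  shows "shift_diff p s c b a (a + p - 1) (\<lambda>x y. binary_coeff p q X Y J x y) \<in> {lo..hi}"
proof -
  have eq: "shift_diff p s c b a (a + p - 1) (\<lambda>x y. binary_coeff p q X Y J x y) =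
      shift_diff p s c b a (a + p - 1) (\<lambda>x y. of_bool (y \<le> min (Y - 1) (step J x)))"
    using p a by (intro shift_diff_cong) (auto simp: binary_coeff_def simp flip: below_iff)
  show ?thesis
    unfolding eq
  proof (rule small_antitone_bound)
    show "min (Y - 1) (step J y) \<le> min (Y - 1) (step J x)" if "x \<le> y" for x y
      using step_antitone[OF that, of J] by linarith
    show "min (Y - 1) (step J a) \<le> min (Y - 1) (step J (a + p - 1)) + 1"
      using step_drop[of "a + p - 1" a J] by linarith
  qed (use p in auto)
qed

lemma upper_window:
  assumes a: "X \<le> a"
  shows "shift_diff p s c b a (a + p - 1) (\<lambda>x y. binary_coeff p q X Y J x y) \<in> {lo..hi}"
proof -
  have "shift_diff p s c b a (a + p - 1) (\<lambda>x y. binary_coeff p q X Y J x y) =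
      shift_diff p s c b a (a + p - 1) (\<lambda>x y. - of_bool (Y \<le> y \<and> y \<le> step (J + p * q) x))"
    using p a by (intro shift_diff_cong) (auto simp: binary_coeff_def simp flip: below_iff)
  also have "\<dots> = - shift_diff p s c b a (a + p - 1) (\<lambda>x y. of_bool (Y \<le> y \<and> y \<le> step (J + p * q) x))"
    by (rule shift_diff_minus)
  finally have eq: "shift_diff p s c b a (a + p - 1) (\<lambda>x y. binary_coeff p q X Y J x y) = \<dots>" .
  show ?thesis
    unfolding eq using Y by (intro antitone_bound step_antitone step_drop) auto
qed

text \<open>A window is indexed by its last point, a residue from 0 to \<open>q - 1\<close>; hence
  the range of \<open>a\<close>.\<close>

theorem window_bound:
  assumes a: "- p < a" "a + p - 1 < q"
  shows "shift_diff p s c b a (a + p - 1) (\<lambda>x y. binary_coeff p q X Y J (x mod q) y) \<in> {lo..hi}"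
proof (cases "a < 0")
  case True
  then show ?thesis using a wrapping_window by blast
next
  case False
  have "shift_diff p s c b a (a + p - 1) (\<lambda>x y. binary_coeff p q X Y J (x mod q) y) =
        shift_diff p s c b a (a + p - 1) (\<lambda>x y. binary_coeff p q X Y J x y)"
    using False a p by (intro shift_diff_cong) (auto simp: mod_pos_pos_trivial)
  moreover consider "a + p - 1 < X" | "a < X" "X \<le> a + p - 1" | "X \<le> a" by linarith
  ultimately show ?thesis
    using False lower_window[of a b J] crossing_window[of a b J] upper_window[of a b J]
    by cases auto
qed

text \<open>The summand \<open>p * p\<close> is a safety margin: for \<open>x\<close> between
  \<open>- p\<close> and \<open>p\<close> the value \<open>p * x\<close> stays within
  \<open>p * p\<close> of 0, so with $2 p^2 < q$ the level contains all of row \<open>k\<close> and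
  nothing of row \<open>k + 1\<close>. The negative part then depends on \<open>y\<close> only and
  cancels.\<close>

lemma wrapping_window_eq:
  assumes h: "0 \<le> h" "h < p - 1" and "2 * p * p < q" and k: "0 \<le> k"
  shows "shift_diff p s c b (h - p + 1) h (\<lambda>x y. binary_coeff p q X Y (q * k + p * p) (x mod q) y) =
         shift_diff p s c b 0 h (\<lambda>x y. of_bool (y \<le> k))"
proof -
  have below: "below (q * k + p * p) x y \<longleftrightarrow> y \<le> k" if "- p < x" "x < p" for x y
  proof -
    have x: "p * x \<le> p * p" "- (p * p) \<le> p * x"
      using mult_left_mono[of x p p] mult_left_mono[of "-p" x p] that p by auto
    show ?thesis
    proof
      assume "y \<le> k"
      then have "q * y \<le> q * k" using q_pos by simp
      then show "below (q * k + p * p) x y" using x by linarith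
    next
      assume "below (q * k + p * p) x y"
      then have "q * y < q * (k + 1)" using x assms(3) by (simp add: algebra_simps)
      then have "y < k + 1" using q_pos by (simp add: mult_less_cancel_left_pos)
      then show "y \<le> k" by simp
    qed
  qed
  have "shift_diff p s c b (h - p + 1) h (\<lambda>x y. binary_coeff p q X Y (q * k + p * p) (x mod q) y) =
        shift_diff p s c b (h - p + 1) h (\<lambda>x y. of_bool (0 \<le> x \<and> y \<le> k) + (- of_bool (Y \<le> y \<and> y \<le> k)))"
    using p h by (intro shift_diff_cong) (auto simp: wrapping_coeff below)
  also have "\<dots> = shift_diff p s c b (h - p + 1) h (\<lambda>x y. of_bool (0 \<le> x \<and> y \<le> k))"
    using shift_diff_const[of p s c b "h - p + 1" "\<lambda>y. of_bool (Y \<le> y \<and> y \<le> k)"] p s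
    unfolding shift_diff_add shift_diff_minus by simp
  also have "\<dots> = shift_diff p s c b 0 h (\<lambda>x y. of_bool (0 \<le> x \<and> y \<le> k))"
    using h by (intro shift_diff_restrict) auto
  also have "\<dots> = shift_diff p s c b 0 h (\<lambda>x y. of_bool (y \<le> k))"
    using p by (intro shift_diff_cong) auto
  finally show ?thesis .
qed

end

section \<open>The estimates and extremal windows for $s = 1$ and $s = -1$\<close>

lemma shift_diff_cong_offset:
  assumes "b mod p = b' mod p"
  shows "shift_diff p s c b l h f = shift_diff p s c b' l h f"
proof -
  have "(s * (x + b)) mod p = (s * (x + b')) mod p" for x
    using assms by (metis mod_add_right_eq mod_mult_right_eq)
  moreover from this have "(s * (x + b) - s * c) mod p = (s * (x + b') - s * c) mod p" for x
    by (metis mod_diff_left_eq)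
  ultimately show ?thesis by (simp add: shift_diff_def)
qed

lemma window_estimate_direct:
  fixes p q X Y c :: int
  assumes p: "1 < p" and q: "p * p < q" and XY: "p * X + q * Y = p * q + 1"
    and Y: "0 < Y" "Y < p" and c: "0 < c"
  shows "window_estimate p q X Y 1 c (- c) c"
proof
  have bound: "\<bar>shift_diff p 1 c b l h (\<lambda>x y. of_bool (\<alpha> \<le> y \<and> y \<le> t x))\<bar> \<le> c"
    if "h < l + p" "0 \<le> \<alpha>" "\<And>x y. l \<le> x \<Longrightarrow> x \<le> y \<Longrightarrow> y \<le> h \<Longrightarrow> t y \<le> t x" "t l \<le> t h + 1"
    for l h b t \<alpha>
    using window_count_le[of c h l p \<alpha> t b] that c by (simp add: shift_diff_eq_card)
  show "- shift_diff p 1 c b l h (\<lambda>x y. of_bool (\<alpha> \<le> y \<and> y \<le> t x)) \<in> {- c..c}"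
    if "h < l + p" "0 \<le> \<alpha>" "\<And>x y. l \<le> x \<Longrightarrow> x \<le> y \<Longrightarrow> y \<le> h \<Longrightarrow> t y \<le> t x" "t l \<le> t h + 1"
    for l h b t \<alpha>
    using bound[OF that, of b] by auto
  show "shift_diff p 1 c b l h (\<lambda>x y. of_bool (y \<le> t x)) \<in> {- c..c}"
    if "h < l + p" "\<And>x y. l \<le> x \<Longrightarrow> x \<le> y \<Longrightarrow> y \<le> h \<Longrightarrow> t y \<le> t x" "t l \<le> t h + 1"
    for l h b t
  proof -
    have "shift_diff p 1 c b l h (\<lambda>x y. of_bool (y \<le> t x)) =
          shift_diff p 1 c b l h (\<lambda>x y. of_bool (0 \<le> y \<and> y \<le> t x))"
      using p by (intro shift_diff_cong) auto
    then show ?thesis using bound[of h l 0 t b] that by auto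
  qed
  show "- shift_diff p 1 c b l h (\<lambda>x y. of_bool (t x \<le> y \<and> y < Y)) \<in> {- c..c}"
    if len: "h < l + p" and anti: "\<And>x y. l \<le> x \<Longrightarrow> x \<le> y \<Longrightarrow> y \<le> h \<Longrightarrow> t y \<le> t x"
      and drop: "t l \<le> t h + 1" for l h b t
  proof -
    let ?g = "\<lambda>x y. of_bool (t x \<le> y \<and> y < Y) :: int"
    \<comment> \<open>Reflecting \<open>x\<close> to \<open>- x\<close> and \<open>y\<close> to
      \<open>p - 1 - y\<close> turns the rising lower end into an antitone upper end. The reflection
      also exchanges the shifted and the unshifted sum, whence the new offset
      \<open>- 1 - b + c\<close> and the change of sign.\<close>
    let ?f = "\<lambda>x y. of_bool (p - Y \<le> y \<and> y \<le> p - 1 - t (- x)) :: int"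
    have refl: "p - 1 - (v mod p) = (- 1 - v) mod p" for v
    proof -
      have "v mod p < p" "0 \<le> v mod p" using p by simp_all
      then have "p - 1 - (v mod p) = (p - 1 - v mod p) mod p"
        by (intro mod_pos_pos_trivial [symmetric]) auto
      also have "\<dots> = (- 1 - v + p) mod p"
        unfolding mod_diff_right_eq by (simp add: algebra_simps)
      finally show ?thesis by simp
    qed
    have g: "?g x (v mod p) = ?f (- x) ((- 1 - v) mod p)" for x v
      unfolding refl[symmetric] by auto
    have "shift_diff p 1 c b l h ?g =
        (\<Sum>x=l..h. ?f (- x) ((- x + (- 1 - b + c) - c) mod p) - ?f (- x) ((- x + (- 1 - b + c)) mod p))"
      unfolding shift_diff_def g
    proof (rule sum.cong[OF HOL.refl])
      fix x assume "x \<in> {l..h}"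
      have e: "- 1 - 1 * (x + b) = - x + (- 1 - b + c) - c"
        "- 1 - (1 * (x + b) - 1 * c) = - x + (- 1 - b + c)" by simp_all
      show "?f (- x) ((- 1 - 1 * (x + b)) mod p) - ?f (- x) ((- 1 - (1 * (x + b) - 1 * c)) mod p) =
        ?f (- x) ((- x + (- 1 - b + c) - c) mod p) - ?f (- x) ((- x + (- 1 - b + c)) mod p)"
        by (simp only: e)
    qed
    also have "\<dots> = (\<Sum>x=-h..-l. ?f x ((x + (- 1 - b + c) - c) mod p) - ?f x ((x + (- 1 - b + c)) mod p))"
      by (rule sum.reindex_bij_witness[of _ uminus uminus]) auto
    also have "\<dots> = - shift_diff p 1 c (- 1 - b + c) (- h) (- l) ?f"
      unfolding shift_diff_def sum_negf[symmetric] by (intro sum.cong) auto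
    finally have eq: "shift_diff p 1 c b l h ?g = \<dots>" .
    have "\<bar>shift_diff p 1 c (- 1 - b + c) (- h) (- l) ?f\<bar> \<le> c"
      using len Y drop by (intro bound) (auto intro!: anti)
    then show ?thesis unfolding eq by auto
  qed
qed (use assms in auto)

text \<open>With \<open>Y = 1\<close> the intervals below \<open>Y\<close> reduce to row 0, which a
  window of \<open>p\<close> points meets at most once before and once after the shift. So these
  contribute at most 1 in absolute value, and only the negated antitone intervals can reach
  -2.\<close>

lemma window_estimate_reversed:
  fixes p q X :: int
  assumes p: "1 < p" and q: "p * p < q" and X: "p * X + q = p * q + 1"
  shows "window_estimate p q X 1 (- 1) 1 (- 2) 1"
proof
  have card1: "card {x\<in>{l..h}. R x \<and> (d - x) mod p = 0} \<le> 1" if "h < l + p" for l h d R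
  proof -
    have "x = x'" if x: "x \<in> {l..h}" "x' \<in> {l..h}" "(d - x) mod p = 0" "(d - x') mod p = 0" for x x'
    proof -
      have "(d - x') mod p = (d - x) mod p" using x by simp
      then have "p dvd x - x'" by (simp add: mod_eq_dvd_iff)
      moreover have "\<bar>x - x'\<bar> < p" using x \<open>h < l + p\<close> by auto
      ultimately show ?thesis using dvd_imp_le_int[of "x - x'" p] by auto
    qed
    moreover have "finite {x\<in>{l..h}. R x \<and> (d - x) mod p = 0}"
      by (rule finite_subset[of _ "{l..h}"], blast, simp)
    ultimately show ?thesis
      unfolding One_nat_def by (subst card_le_Suc0_iff_eq) auto
  qed
  have arg: "- 1 * (x + b) = - b - x" "u - - 1 * 1 = u + 1" for x b u :: int
    by simp_all
  show "- shift_diff p (- 1) 1 b l h (\<lambda>x y. of_bool (\<alpha> \<le> y \<and> y \<le> t x)) \<in> {- 2..1}"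
    if "h < l + p" "0 \<le> \<alpha>" "\<And>x y. l \<le> x \<Longrightarrow> x \<le> y \<Longrightarrow> y \<le> h \<Longrightarrow> t y \<le> t x" "t l \<le> t h + 1"
    for l h b t \<alpha>
    using reversed_window_count[of h l p \<alpha> t "- b"] that
    unfolding shift_diff_eq_card arg atLeastAtMost_iff by force
  have small: "\<bar>shift_diff p (- 1) 1 b l h (\<lambda>x y. of_bool (R x \<and> y = 0))\<bar> \<le> 1"
    if "h < l + p" for l h b R
  proof -
    have e: "- b - x + 1 = (1 - b) - x" for x by simp
    show ?thesis
      using card1[OF that, of R "- b"] card1[OF that, of R "1 - b"]
      unfolding shift_diff_eq_card arg unfolding e by linarith
  qed
  show "shift_diff p (- 1) 1 b l h (\<lambda>x y. of_bool (y \<le> t x)) \<in> {- 2..1}"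
    if "h < l + p" "\<And>x y. l \<le> x \<Longrightarrow> x \<le> y \<Longrightarrow> y \<le> h \<Longrightarrow> t y \<le> t x" "t l \<le> t h + 1" "t l < 1"
    for l h b t
  proof -
    have "shift_diff p (- 1) 1 b l h (\<lambda>x y. of_bool (y \<le> t x)) =
          shift_diff p (- 1) 1 b l h (\<lambda>x y. of_bool (0 \<le> t x \<and> y = 0))"
    proof (intro shift_diff_cong)
      show "(of_bool (y \<le> t x) :: int) = of_bool (0 \<le> t x \<and> y = 0)" if "l \<le> x" "x \<le> h" "0 \<le> y" for x y
        using that \<open>t l < 1\<close> \<open>\<And>x y. l \<le> x \<Longrightarrow> x \<le> y \<Longrightarrow> y \<le> h \<Longrightarrow> t y \<le> t x\<close>[of l x] by auto
    qed (use p in auto)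
    then show ?thesis using small[OF that(1), of b "\<lambda>x. 0 \<le> t x"] by auto
  qed
  show "- shift_diff p (- 1) 1 b l h (\<lambda>x y. of_bool (t x \<le> y \<and> y < 1)) \<in> {- 2..1}"
    if "h < l + p" for l h b t
  proof -
    have "shift_diff p (- 1) 1 b l h (\<lambda>x y. of_bool (t x \<le> y \<and> y < 1)) =
          shift_diff p (- 1) 1 b l h (\<lambda>x y. of_bool (t x \<le> 0 \<and> y = 0))"
      using p by (intro shift_diff_cong) (auto simp: order.antisym)
    then show ?thesis using small[OF that(1), of b "\<lambda>x. t x \<le> 0"] by auto
  qed
qed (use assms in auto)

text \<open>With offset 0 the second coordinates are 0, ..., \<open>c - 1\<close>, and the shift
  sends them to \<open>p - c\<close>, ..., \<open>p - 1\<close>; with offset \<open>c\<close> they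
  are \<open>c\<close>, ..., \<open>2 * c - 1\<close>, and the shift brings them down to 0, ...,
  \<open>c - 1\<close>. The bound \<open>2 * c < p\<close> keeps the counted and uncounted rows
  apart.\<close>

lemma direct_extremes:
  fixes p c :: int
  assumes c: "0 < c" "2 * c < p"
  shows "shift_diff p 1 c 0 0 (c - 1) (\<lambda>x y. of_bool (y \<le> c - 1)) = c"
    and "shift_diff p 1 c c 0 (c - 1) (\<lambda>x y. of_bool (y \<le> c - 1)) = - c"
proof -
  have m: "x mod p = x" "(x + c) mod p = x + c" "(x - c) mod p = x - c + p" if "x \<in> {0..c-1}" for x
  proof -
    show "x mod p = x" "(x + c) mod p = x + c"
      using that c by (intro mod_pos_pos_trivial; simp)+
    have "(x - c + p) mod p = x - c + p"
      using that c by (intro mod_pos_pos_trivial) auto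
    then show "(x - c) mod p = x - c + p" by simp
  qed
  have "shift_diff p 1 c 0 0 (c - 1) (\<lambda>x y. of_bool (y \<le> c - 1)) = (\<Sum>x=0..c-1. 1)"
    unfolding shift_diff_def using c by (intro sum.cong refl) (simp add: m)
  then show "shift_diff p 1 c 0 0 (c - 1) (\<lambda>x y. of_bool (y \<le> c - 1)) = c" using c by simp
  have "shift_diff p 1 c c 0 (c - 1) (\<lambda>x y. of_bool (y \<le> c - 1)) = (\<Sum>x=0..c-1. - 1)"
    unfolding shift_diff_def using c by (intro sum.cong refl) (simp add: m)
  then show "shift_diff p 1 c c 0 (c - 1) (\<lambda>x y. of_bool (y \<le> c - 1)) = - c" using c by simp
qed

text \<open>The level \<open>q - 2 * p\<close> passes through the point (-2, 1): inside the window
  it leaves row 0 and just this point of row 1. The value -2 is made of the point with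
  \<open>x = - 2\<close> in the unshifted sum and the point with \<open>x = 0\<close> in the shifted
  one.\<close>

lemma reversed_extremes:
  fixes p q X :: int
  assumes p3: "2 < p" and q: "p * p < q" and X: "p * X + q = p * q + 1"
  shows "shift_diff p (- 1) 1 0 0 0 (\<lambda>x y. of_bool (y \<le> 0)) = 1"
    and "shift_diff p (- 1) 1 1 (- 2) (p - 3) (\<lambda>x y. binary_coeff p q X 1 (q - 2 * p) (x mod q) y) = - 2"
proof -
  show "shift_diff p (- 1) 1 0 0 0 (\<lambda>x y. of_bool (y \<le> 0)) = 1"
    using p3 by (simp add: shift_diff_def)
  interpret window_estimate p q X 1 "- 1" 1 "- 2" 1
    by (rule window_estimate_reversed) (use assms in auto)
  let ?f = "\<lambda>x y. binary_coeff p q X 1 (q - 2 * p) (x mod q) y"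
  have f: "?f x y = of_bool (0 \<le> x \<and> y = 0) - of_bool (x = - 2 \<and> y = 1)"
    if x: "- 2 \<le> x" "x \<le> p - 3" and y: "0 \<le> y" for x y
  proof -
    have "below (q - 2 * p) x y \<longleftrightarrow> y = 0 \<or> x = - 2 \<and> y = 1"
    proof (cases "y = 0")
      case True
      have "p * (x + 2) \<le> p * p" using x p3 by (intro mult_left_mono) auto
      then have "p * x \<le> p * p - 2 * p" by (simp add: algebra_simps)
      then show ?thesis using True q by simp
    next
      case False
      show ?thesis
      proof (cases "x = - 2")
        case True
        then have "below (q - 2 * p) x y \<longleftrightarrow> q * y \<le> q * 1" by simp
        also have "\<dots> \<longleftrightarrow> y \<le> 1" using q_pos by (subst mult_le_cancel_left_pos) auto
        finally show ?thesis using True y False by auto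
      next
        case False': False
        have "q * 1 \<le> q * y" using False y q_pos by (intro mult_left_mono) auto
        moreover have "p * (x + 2) > 0" using False' x p3 by simp
        then have "p * x > - 2 * p" by (simp add: algebra_simps)
        ultimately show ?thesis using False False' by simp
      qed
    qed
    moreover have "?f x y = of_bool (0 \<le> x \<and> below (q - 2 * p) x y) - of_bool (1 \<le> y \<and> below (q - 2 * p) x y)"
      using x p3 by (intro wrapping_coeff) auto
    ultimately show ?thesis using y by auto
  qed
  have "shift_diff p (- 1) 1 1 (- 2) (p - 3) ?f =
        (\<Sum>x=-2..p-3. (if x = - 2 then - 1 else 0) + (if x = 0 then - 1 else 0))"
    unfolding shift_diff_def
  proof (intro sum.cong refl)
    fix x assume x: "x \<in> {- 2..p - 3}"
    let ?y = "(- 1 * (x + 1)) mod p" and ?z = "(- 1 * (x + 1) - - 1 * 1) mod p"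
    have yz: "?y = (if x < 0 then - 1 - x else p - 1 - x)" "?z = (if x \<le> 0 then - x else p - x)"
    proof -
      have "(p - 1 - x) mod p = p - 1 - x" if "0 \<le> x"
        using that x by (intro mod_pos_pos_trivial) auto
      moreover have "(p - 1 - x) mod p = (- 1 - x) mod p"
        using mod_add_self2[of "- 1 - x" p] by (simp add: algebra_simps)
      moreover have "(- 1 - x) mod p = - 1 - x" if "x < 0"
        using that x p3 by (intro mod_pos_pos_trivial) auto
      ultimately show "?y = (if x < 0 then - 1 - x else p - 1 - x)" by (auto simp: algebra_simps)
      have "(p - x) mod p = p - x" if "0 < x"
        using that x by (intro mod_pos_pos_trivial) auto
      moreover have "(p - x) mod p = (- x) mod p" by simp
      moreover have "(- x) mod p = - x" if "x \<le> 0"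
        using that x p3 by (intro mod_pos_pos_trivial) auto
      ultimately show "?z = (if x \<le> 0 then - x else p - x)" by auto
    qed
    show "?f x ?y - ?f x ?z = (if x = - 2 then - 1 else 0) + (if x = 0 then - 1 else 0)"
    proof -
      have fy: "?f x ?y = of_bool (0 \<le> x \<and> ?y = 0) - of_bool (x = - 2 \<and> ?y = 1)"
        using x p3 by (intro f) auto
      have fz: "?f x ?z = of_bool (0 \<le> x \<and> ?z = 0) - of_bool (x = - 2 \<and> ?z = 1)"
        using x p3 by (intro f) auto
      show ?thesis
        unfolding fy fz unfolding yz using x p3 by auto
    qed
  qed
  also have "\<dots> = - 2"
    using p3 by (simp add: sum.distrib)
  finally show "shift_diff p (- 1) 1 1 (- 2) (p - 3) ?f = - 2" .
qed

section \<open>Coefficients of ternary cyclotomic polynomials\<close>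

lemma divisors_prime_times:
  fixes p m :: nat
  assumes "prime p"
  shows "{d. d dvd p * m} = {d. d dvd m} \<union> (\<lambda>d. p * d) ` {d. d dvd m}"
proof
  show "{d. d dvd p * m} \<subseteq> {d. d dvd m} \<union> (\<lambda>d. p * d) ` {d. d dvd m}"
  proof
    fix d assume "d \<in> {d. d dvd p * m}"
    then obtain a b where ab: "d = a * b" "a dvd p" "b dvd m"
      using division_decomp[of d p m] by auto
    then have "a = 1 \<or> a = p" using assms by (simp add: prime_nat_iff)
    then show "d \<in> {d. d dvd m} \<union> (\<lambda>d. p * d) ` {d. d dvd m}" using ab by auto
  qed
qed auto

lemma prod_divisors_prime_times:
  fixes f :: "nat \<Rightarrow> 'a :: comm_monoid_mult"
  assumes "prime p" "\<not> p dvd m" "m > 0"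
  shows "(\<Prod>d | d dvd p * m. f d) = (\<Prod>d | d dvd m. f d) * (\<Prod>d | d dvd m. f (p * d))"
proof -
  have "p > 0" using assms by (simp add: prime_gt_0_nat)
  have "(\<Prod>d | d dvd p * m. f d) = (\<Prod>d | d dvd m. f d) * (\<Prod>d\<in>(\<lambda>d. p * d) ` {d. d dvd m}. f d)"
    unfolding divisors_prime_times[OF assms(1)]
    using assms by (intro prod.union_disjoint) (auto dest: dvd_mult_left)
  also have "(\<Prod>d\<in>(\<lambda>d. p * d) ` {d. d dvd m}. f d) = (\<Prod>d | d dvd m. f (p * d))"
    using \<open>p > 0\<close> by (subst prod.reindex) (auto simp: inj_on_def)
  finally show ?thesis .
qed

text \<open>Splitting each $x^n - 1$ into cyclotomic factors gives the same factors on both sides.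
  The denominators of the usual quotient formula are multiplied out, and the identity is proved over
  the complex numbers and pulled back along the injective embedding of the integer
  polynomials.\<close>

lemma cyclotomic_ternary_identity:
  assumes "prime p" "prime q" "prime r" "p \<noteq> q" "p \<noteq> r" "q \<noteq> r"
  defines "M \<equiv> \<lambda>n. monom 1 n - 1 :: int poly"
  shows "cyclotomic (p * q * r) * (M (p * q) * M (p * r) * M (q * r) * M 1) =
           M (p * q * r) * (M p * M q * M r)"
proof -
  let ?P = cyclotomic_complex
  let ?M = "\<lambda>n. monom 1 n - 1 :: complex poly"
  have pos: "p > 0" "q > 0" "r > 0" using assms by (auto simp: prime_gt_0_nat)
  have ndvd: "\<not> p dvd 1" "\<not> p dvd q" "\<not> p dvd r" "\<not> p dvd q * r" "\<not> q dvd 1" "\<not> q dvd r" "\<not> r dvd 1"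
    using assms by (auto simp: primes_dvd_imp_eq prime_dvd_mult_iff dest: primes_dvd_imp_eq)
  have div1: "{d::nat. d dvd 1} = {1}" by auto
  note D = prod_divisors_prime_times
  have M: "?M n = (\<Prod>d | d dvd n. ?P d)" if "n > 0" for n
    using prod_cyclotomic_complex[OF that] by simp
  have M1: "?M 1 = ?P 1" by (subst M) (simp_all add: div1)
  have Mr: "?M r = ?P 1 * ?P r" "?M q = ?P 1 * ?P q" "?M p = ?P 1 * ?P p"
    using M[of r] M[of q] M[of p] pos
      D[OF assms(1) ndvd(1), of ?P] D[OF assms(2) ndvd(5), of ?P] D[OF assms(3) ndvd(7), of ?P]
    by (simp_all add: div1 del: One_nat_def)
  have div2: "prod f {d. d dvd r} = f 1 * f r" "prod f {d. d dvd q} = f 1 * f q" for f :: "nat \<Rightarrow> complex poly"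
    using D[OF assms(2) ndvd(5), of f] D[OF assms(3) ndvd(7), of f]
    by (simp_all add: div1 del: One_nat_def)
  have Mpq: "?M (p * q) = ?P 1 * ?P q * (?P p * ?P (p * q))"
      "?M (p * r) = ?P 1 * ?P r * (?P p * ?P (p * r))"
      "?M (q * r) = ?P 1 * ?P r * (?P q * ?P (q * r))"
    using M[of "p * q"] M[of "p * r"] M[of "q * r"] pos
      D[OF assms(1) ndvd(2), of ?P] D[OF assms(1) ndvd(3), of ?P] D[OF assms(2) ndvd(6), of ?P]
    by (simp_all add: div2)
  have div3: "prod f {d. d dvd q * r} = f 1 * f r * (f q * f (q * r))" for f :: "nat \<Rightarrow> complex poly"
    using D[OF assms(2) ndvd(6), of f] pos by (simp add: div2)
  have Mpqr: "?M (p * q * r) =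
      ?P 1 * ?P r * (?P q * ?P (q * r)) * (?P p * ?P (p * r) * (?P (p * q) * ?P (p * (q * r))))"
    using M[of "p * (q * r)"] pos D[OF assms(1) ndvd(4), of ?P] by (simp add: div3 mult.assoc)
  have "?P (p * q * r) * (?M (p * q) * ?M (p * r) * ?M (q * r) * ?M 1) =
          ?M (p * q * r) * (?M p * ?M q * ?M r)"
    unfolding Mpqr Mpq Mr M1 by (simp only: mult_ac)
  then have "map_poly of_int (cyclotomic (p * q * r) * (M (p * q) * M (p * r) * M (q * r) * M 1)) =
      (map_poly of_int (M (p * q * r) * (M p * M q * M r)) :: complex poly)"
    by (simp add: M_def map_poly_of_int_mult map_poly_of_int_diff of_int_cyclotomic map_poly_monom)
  then show ?thesis unfolding map_poly_of_int_eq_iff .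
qed

text \<open>Integer indices turn multiplication by a power of x into a plain shift, without
  truncated subtraction, for sequences that vanish at negative arguments.\<close>

definition int_fps :: "(int \<Rightarrow> int) \<Rightarrow> int fps"
  where "int_fps f = Abs_fps (\<lambda>n. f (int n))"

lemma int_fps_mult_X_power:
  assumes "\<And>z. z < 0 \<Longrightarrow> f z = 0"
  shows "int_fps f * fps_X ^ k = int_fps (\<lambda>z. f (z - int k))"
proof (rule fps_ext)
  fix n
  show "(int_fps f * fps_X ^ k) $ n = int_fps (\<lambda>z. f (z - int k)) $ n"
    using assms[of "int n - int k"] by (auto simp: fps_X_power_mult_right_nth int_fps_def of_nat_diff)
qed

lemma int_fps_mult_one_minus_X_power:
  assumes "\<And>z. z < 0 \<Longrightarrow> f z = 0"
  shows "int_fps f * (1 - fps_X ^ k) = int_fps (\<lambda>z. f z - f (z - int k))"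
  using int_fps_mult_X_power[of f k] assms
  by (simp add: algebra_simps) (simp add: int_fps_def fps_eq_iff)

lemma int_fps_mult_geometric:
  assumes "\<And>z. z < 0 \<Longrightarrow> f z = 0"
  shows "int_fps f * (\<Sum>e<k. fps_X ^ e) = int_fps (\<lambda>z. \<Sum>e<k. f (z - int e))"
proof -
  have "int_fps f * (\<Sum>e<k. fps_X ^ e) = (\<Sum>e<k. int_fps (\<lambda>z. f (z - int e)))"
    using int_fps_mult_X_power[of f] assms by (simp add: sum_distrib_left)
  also have "\<dots> = int_fps (\<lambda>z. \<Sum>e<k. f (z - int e))"
    by (simp add: fps_eq_iff int_fps_def fps_sum_nth)
  finally show ?thesis .
qed

lemma fps_of_monom_minus_1:
  "fps_of_poly (monom 1 n - 1 :: int poly) = - (1 - fps_X ^ n)"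
  by (simp add: fps_of_poly_diff fps_of_poly_monom')

text \<open>Lowering an exponent by 1 subtracts (\<open>X\<close>, \<open>Y\<close>) from its
  coordinates, as \<open>p * X + q * Y = p * q + 1\<close>. If exactly one coordinate wraps around,
  the two conditions coincide and cancel; if both or none do, \<open>J < p * q\<close> makes one of
  them false.\<close>

lemma binary_coeff_eq:
  assumes XY: "p * X + q * Y = p * q + 1" and X: "0 < X" "X < q" and Y: "0 < Y" "Y < p"
    and x: "0 \<le> x" "x < q" and y: "0 \<le> y" "y < p" and J: "J < p * q" and p: "0 < p" and q: "0 < q"
  shows "of_bool (p * x + q * y \<le> J) - of_bool (p * ((x - X) mod q) + q * ((y - Y) mod p) \<le> J - 1) =
           binary_coeff p q X Y J x y"
proof -
  have x': "(x - X) mod q = (if X \<le> x then x - X else x - X + q)"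
    using mod_add_self2[of "x - X" q] mod_pos_pos_trivial[of "x - X" q]
      mod_pos_pos_trivial[of "x - X + q" q] x X by auto
  have y': "(y - Y) mod p = (if Y \<le> y then y - Y else y - Y + p)"
    using mod_add_self2[of "y - Y" p] mod_pos_pos_trivial[of "y - Y" p]
      mod_pos_pos_trivial[of "y - Y + p" p] y Y by auto
  have XY': "p * X = p * q + 1 - q * Y" using XY by simp
  have nonneg: "0 \<le> p * x" "0 \<le> q * y" using x y p q by simp_all
  have ge: "p * X + q * Y \<le> p * x + q * y" if "X \<le> x" "Y \<le> y"
    using that p q by (intro add_mono mult_left_mono) auto
  show ?thesis
    using ge nonneg J XY
    by (auto simp: x' y' binary_coeff_def of_bool_def algebra_simps XY')
qed

lemma mod_diff_1: "((x::int) - 1) mod m = (if x mod m = 0 then m - 1 else x mod m - 1)" if "0 < m" for m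
proof -
  have "(x - 1) mod m = (x mod m - 1) mod m" by (simp add: mod_diff_left_eq)
  also have "\<dots> = (if x mod m = 0 then m - 1 else x mod m - 1)"
  proof (cases "x mod m = 0")
    case True
    then show ?thesis using that by (simp add: zmod_minus1)
  next
    case False
    moreover have "0 \<le> x mod m" "x mod m < m" using that by simp_all
    ultimately show ?thesis by (auto intro!: mod_pos_pos_trivial)
  qed
  finally show ?thesis .
qed

locale ternary =
  fixes p q r :: nat and s :: int
  assumes primes: "prime p" "prime q" "prime r" and less: "p < q" "q < r"
    and s: "s = 1 \<or> s = -1"
    and inverse: "[int r * (int p + s * int q) = 1] (mod int (p * q))"
begin

lemma pos: "0 < p" "0 < q" "0 < r" "1 < p"
  using primes prime_gt_1_nat[of p] by (auto simp: prime_gt_0_nat)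

lemma r_inverse: "[int r * int p = 1] (mod int q)" "[s * int r * int q = 1] (mod int p)"
proof -
  have "[int r * (int p + s * int q) = 1] (mod int q)"
    using inverse by (rule cong_dvd_modulus) simp
  moreover have "[int r * (int p + s * int q) = int r * int p] (mod int q)"
    by (simp add: cong_iff_dvd_diff algebra_simps)
  ultimately show "[int r * int p = 1] (mod int q)"
    by (meson cong_sym cong_trans)
  have "[int r * (int p + s * int q) = 1] (mod int p)"
    using inverse by (rule cong_dvd_modulus) simp
  moreover have "[int r * (int p + s * int q) = s * int r * int q] (mod int p)"
    by (simp add: cong_iff_dvd_diff algebra_simps)
  ultimately show "[s * int r * int q = 1] (mod int p)"
    by (meson cong_sym cong_trans)
qed

text \<open>
  Below $pqr$, \<open>gen\<close> is the coefficient sequence of $1 / ((1 - x^{pq}) (1 - x^{pr}) (1 - x^{qr}))$.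
\<close>

definition weight :: "int \<Rightarrow> int"
  where "weight z = int p * (z mod int q) + int q * ((s * z) mod int p)"

definition gen :: "int \<Rightarrow> int"
  where "gen z = of_bool (int r * weight z \<le> z)"

lemma weight_nonneg: "0 \<le> weight z"
  using pos by (simp add: weight_def)

lemma gen_neg: "z < 0 \<Longrightarrow> gen z = 0"
  using weight_nonneg[of z] by (simp add: gen_def) (smt (verit) mult_nonneg_nonneg of_nat_0_le_iff)

lemma coprime_pq: "coprime (int p) (int q)"
  using primes less by (simp add: primes_coprime)

text \<open>By \<open>r_inverse\<close>, \<open>z mod int q\<close> and
  \<open>(s * z) mod int p\<close> are the digits of \<open>z\<close> with respect to $pr$ and $qr$
  modulo $pq$. So \<open>int r * weight z\<close> is the least nonnegative combination of $pr$ and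
  $qr$ in the class of \<open>z\<close>, and \<open>gen\<close> asks whether \<open>z\<close> is
  reached from it by adding multiples of $pq$.\<close>

lemma weight_cong: "[int r * weight z = z] (mod int (p * q))"
proof -
  have "[int r * weight z = int r * (int p * z + 0)] (mod int q)"
    unfolding weight_def by (intro cong_mult cong_add cong_refl) (auto simp: cong_def)
  also have "int r * (int p * z + 0) = (int r * int p) * z" by simp
  also have "[(int r * int p) * z = 1 * z] (mod int q)"
    by (intro cong_mult r_inverse) simp
  finally have 1: "[int r * weight z = z] (mod int q)" by simp
  have "[int r * weight z = int r * (0 + int q * (s * z))] (mod int p)"
    unfolding weight_def by (intro cong_mult cong_add cong_refl) (auto simp: cong_def)
  also have "int r * (0 + int q * (s * z)) = (s * int r * int q) * z" by simp
  also have "[(s * int r * int q) * z = 1 * z] (mod int p)"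
    by (intro cong_mult r_inverse) simp
  finally have 2: "[int r * weight z = z] (mod int p)" by simp
  show ?thesis
    using coprime_cong_mult[OF 2 1 coprime_pq] by simp
qed

lemma weight_add_pq: "weight (z - int (p * q)) = weight z"
proof -
  have "(z - int (p * q)) mod int q = z mod int q"
    using mod_mult_self2[of "z - int (p * q)" "int q" "int p"] by (simp add: algebra_simps)
  moreover have "(s * (z - int (p * q))) mod int p = (s * z) mod int p"
    using mod_mult_self2[of "s * (z - int (p * q))" "int p" "s * int q"] by (simp add: algebra_simps)
  ultimately show ?thesis by (simp add: weight_def)
qed

lemma cong_le_imp_le:
  assumes "[a = z] (mod m)" "a \<le> z + d" "d < m"
  shows "a \<le> (z :: int)"
proof (rule ccontr)
  assume "\<not> a \<le> z"
  then have "0 < a - z" "a - z < m" using assms by auto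
  moreover have "m dvd a - z" using assms by (simp add: cong_iff_dvd_diff)
  ultimately show False by (simp add: zdvd_not_zless)
qed

lemma gen_diff_pq: "gen z - gen (z - int (p * q)) = of_bool (int r * weight z = z)"
proof -
  have "int r * weight z = z" if "int r * weight z \<le> z" "\<not> int r * weight z \<le> z - int (p * q)"
  proof (rule antisym)
    have "[z = int r * weight z] (mod int (p * q))" using weight_cong by (rule cong_sym)
    then show "z \<le> int r * weight z"
      using that pos cong_le_imp_le[of z "int r * weight z" "int (p * q)" "int (p * q) - 1"] by linarith
  qed (use that in auto)
  moreover have "0 < int (p * q)" using pos by simp
  ultimately show ?thesis
    unfolding gen_def weight_add_pq by (auto simp del: of_nat_mult)
qed

lemma residue_diff_pr:
  "(z - int (p * r)) mod int q = (z - 1) mod int q"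
  "(s * (z - int (p * r))) mod int p = (s * z) mod int p"
proof -
  have "[z - int r * int p = z - 1] (mod int q)"
    by (intro cong_diff r_inverse cong_refl)
  then show "(z - int (p * r)) mod int q = (z - 1) mod int q"
    by (simp add: cong_def mult.commute)
  show "(s * (z - int (p * r))) mod int p = (s * z) mod int p"
    using mod_mult_self2[of "s * (z - int (p * r))" "int p" "s * int r"] by (simp add: algebra_simps)
qed

lemma residue_diff_qr:
  "(z - int (q * r)) mod int q = z mod int q"
  "(s * (z - int (q * r))) mod int p = (s * z - 1) mod int p"
proof -
  show "(z - int (q * r)) mod int q = z mod int q"
    using mod_mult_self2[of "z - int (q * r)" "int q" "int r"] by (simp add: algebra_simps)
  have "[s * z - s * int r * int q = s * z - 1] (mod int p)"
    by (intro cong_diff r_inverse cong_refl)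
  then show "(s * (z - int (q * r))) mod int p = (s * z - 1) mod int p"
    by (simp add: cong_def algebra_simps)
qed

text \<open>Below $pqr$, what is left of \<open>gen\<close> once the factor 1 - x^(pq) has been
  cancelled; \<open>gen2\<close> is what is left when 1 - x^(pr) is cancelled too.\<close>

definition "gen1 z = (of_bool (int r * weight z = z) :: int)"

definition "gen2 z = (of_bool (z mod int q = 0 \<and> int r * int q * ((s * z) mod int p) = z) :: int)"

lemma gen1_diff:
  assumes "z < int (p * q * r)"
  shows "gen1 z - gen1 (z - int (p * r)) = gen2 z"
proof (cases "z mod int q = 0")
  case True
  \<comment> \<open>Subtracting $pr$ from a zero digit borrows: the digit becomes $q - 1$, and $pr(q
    - 1)$ alone is larger than $z - pr$ because $z < pqr$.\<close>
  have "weight (z - int (p * r)) = int p * (int q - 1) + int q * ((s * z) mod int p)"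
    using True pos by (simp add: weight_def residue_diff_pr mod_diff_1 del: of_nat_mult)
  then have "int r * weight (z - int (p * r)) = int r * (int p * (int q - 1) + int q * ((s * z) mod int p))"
    by (simp only:)
  then have w: "int r * weight (z - int (p * r)) =
      int (p * q * r) - int (p * r) + int r * int q * ((s * z) mod int p)"
    by (simp add: algebra_simps)
  have "0 \<le> int r * int q * ((s * z) mod int p)" using pos by simp
  then have "gen1 (z - int (p * r)) = 0" using w assms by (simp add: gen1_def)
  then show ?thesis using True by (simp add: gen1_def gen2_def weight_def algebra_simps)
next
  case False
  have "weight (z - int (p * r)) = int p * (z mod int q - 1) + int q * ((s * z) mod int p)"
    using False pos by (simp add: weight_def residue_diff_pr mod_diff_1 del: of_nat_mult)
  also have "\<dots> = weight z - int p"
    by (simp add: weight_def algebra_simps)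
  finally have "int r * weight (z - int (p * r)) = int r * (weight z - int p)"
    by (simp only:)
  then have "int r * weight (z - int (p * r)) = int r * weight z - int (p * r)"
    by (simp add: algebra_simps)
  then show ?thesis using False by (simp add: gen1_def gen2_def)
qed

lemma gen2_diff:
  assumes "z < int (p * q * r)"
  shows "gen2 z - gen2 (z - int (q * r)) = of_bool (z = 0)"
proof (cases "(s * z) mod int p = 0")
  case True
  have "int r * int q * (int p - 1) \<noteq> z - int (q * r)"
    using assms by (simp add: algebra_simps)
  then have "gen2 (z - int (q * r)) = 0"
    using True pos by (simp add: gen2_def residue_diff_qr mod_diff_1 del: of_nat_mult)
  then show ?thesis using True by (auto simp: gen2_def)
next
  case False
  then have "z \<noteq> 0" by auto
  have "int r * int q * ((s * z) mod int p - 1) = z - int (q * r) \<longleftrightarrow> int r * int q * ((s * z) mod int p) = z"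
    by (simp add: algebra_simps)
  then show ?thesis
    using False \<open>z \<noteq> 0\<close> pos by (simp add: gen2_def residue_diff_qr mod_diff_1 del: of_nat_mult)
qed

lemma gen_product:
  assumes "n < p * q * r"
  shows "(int_fps gen * (1 - fps_X ^ (p * q)) * (1 - fps_X ^ (p * r)) * (1 - fps_X ^ (q * r))) $ n =
           of_bool (n = 0)"
proof -
  have neg1: "gen1 z = 0" if "z < 0" for z
  proof -
    have "0 \<le> int r * weight z" using weight_nonneg by simp
    then show ?thesis using that by (simp add: gen1_def)
  qed
  \<comment> \<open>\<open>gen1_diff\<close> is valid only below $pqr$. The power series is
    therefore formed with \<open>g\<close>, which agrees with \<open>gen2\<close> at every index
    that is finally evaluated.\<close>
  define g where "g z = gen1 z - gen1 (z - int (p * r))" for z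
  have g: "g z = gen2 z" if "z < int (p * q * r)" for z
    using gen1_diff[OF that] by (simp only: g_def)
  have "int_fps gen * (1 - fps_X ^ (p * q)) = int_fps (\<lambda>z. gen z - gen (z - int (p * q)))"
    using gen_neg by (rule int_fps_mult_one_minus_X_power)
  also have "(\<lambda>z. gen z - gen (z - int (p * q))) = gen1"
    by (simp only: gen_diff_pq gen1_def[abs_def])
  finally have "int_fps gen * (1 - fps_X ^ (p * q)) = int_fps gen1" .
  moreover have "int_fps gen1 * (1 - fps_X ^ (p * r)) = int_fps g"
    unfolding g_def[abs_def] using neg1 by (rule int_fps_mult_one_minus_X_power)
  moreover have "int_fps g * (1 - fps_X ^ (q * r)) = int_fps (\<lambda>z. g z - g (z - int (q * r)))"
  proof (rule int_fps_mult_one_minus_X_power)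
    fix z :: int assume "z < 0"
    moreover have "0 \<le> int (p * r)" by (rule of_nat_0_le_iff)
    ultimately have "z - int (p * r) < 0" by linarith
    then show "g z = 0" using \<open>z < 0\<close> by (simp only: g_def neg1)
  qed
  ultimately have "(int_fps gen * (1 - fps_X ^ (p * q)) * (1 - fps_X ^ (p * r)) * (1 - fps_X ^ (q * r))) $ n =
      g (int n) - g (int n - int (q * r))"
    by (simp only: int_fps_def fps_nth_Abs_fps)
  also have "\<dots> = gen2 (int n) - gen2 (int n - int (q * r))"
  proof -
    have "int n < int (p * q * r)" using assms by (simp only: of_nat_less_iff)
    moreover have "0 \<le> int (q * r)" by (rule of_nat_0_le_iff)
    ultimately have "g (int n) = gen2 (int n)" "g (int n - int (q * r)) = gen2 (int n - int (q * r))"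
      by (intro g; linarith)+
    then show ?thesis by (simp only:)
  qed
  also have "\<dots> = of_bool (int n = 0)"
    by (rule gen2_diff) (use assms in \<open>simp only: of_nat_less_iff\<close>)
  finally show ?thesis by simp
qed

text \<open>After cancelling 1 - x in the product identity, 1 - x^p becomes a sum of
  \<open>p\<close> powers, which together with 1 - x^q and 1 - x^r multiplies \<open>gen\<close>.
  The remaining factor 1 - x^(pqr) does not touch coefficients below $pqr$.\<close>

lemma coeff_cyclotomic_gen:
  assumes n: "n < p * q * r"
  shows "coeff (cyclotomic (p * q * r)) n = (\<Sum>e<p.
      gen (int n - int e) - gen (int n - int e - int r) -
      (gen (int n - int e - int q) - gen (int n - int e - int q - int r)))"
proof -
  let ?X = "fps_X :: int fps"
  let ?F = "fps_of_poly (cyclotomic (p * q * r))" and ?E = "\<Sum>e<p. ?X ^ e"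
  let ?K = "(1 - ?X ^ (p * q)) * (1 - ?X ^ (p * r)) * (1 - ?X ^ (q * r))"
  have ne: "p \<noteq> q" "p \<noteq> r" "q \<noteq> r" using less by auto
  have "?F * (?K * (1 - ?X ^ 1)) = (1 - ?X ^ (p * q * r)) * ((1 - ?X ^ p) * (1 - ?X ^ q) * (1 - ?X ^ r))"
    using arg_cong[OF cyclotomic_ternary_identity[OF primes ne], of fps_of_poly]
    unfolding fps_of_poly_mult fps_of_monom_minus_1
    by (simp only: minus_mult_minus mult_minus_left mult_minus_right minus_minus)
  moreover have "1 - ?X ^ p = (1 - ?X) * ?E" by (rule one_diff_power_eq)
  ultimately have "(?F * ?K) * (1 - ?X) = ((1 - ?X ^ (p * q * r)) * (?E * (1 - ?X ^ q) * (1 - ?X ^ r))) * (1 - ?X)"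
    by (simp only: mult_ac power_one_right)
  moreover have "1 - ?X \<noteq> 0"
  proof
    assume "1 - ?X = 0"
    then have "(1 - ?X) $ 0 = 0" by (simp only: fps_zero_nth)
    then show False by simp
  qed
  ultimately have FK: "?F * ?K = (1 - ?X ^ (p * q * r)) * (?E * (1 - ?X ^ q) * (1 - ?X ^ r))"
    by (rule mult_right_cancel[THEN iffD1, rotated])
  define G where "G = int_fps gen * (1 - ?X ^ r) * (1 - ?X ^ q) * ?E"
  have eq: "?F * (int_fps gen * (1 - ?X ^ (p * q)) * (1 - ?X ^ (p * r)) * (1 - ?X ^ (q * r))) =
      G - G * ?X ^ (p * q * r)"
  proof -
    have "?F * (int_fps gen * (1 - ?X ^ (p * q)) * (1 - ?X ^ (p * r)) * (1 - ?X ^ (q * r))) =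
        int_fps gen * (?F * ?K)" by (simp only: mult_ac)
    also have "\<dots> = (1 - ?X ^ (p * q * r)) * G"
      unfolding FK G_def by (simp only: mult_ac)
    also have "\<dots> = G - G * ?X ^ (p * q * r)"
      by (simp only: left_diff_distrib mult_1_left) (simp only: mult.commute)
    finally show ?thesis .
  qed
  have "(?F * (int_fps gen * (1 - ?X ^ (p * q)) * (1 - ?X ^ (p * r)) * (1 - ?X ^ (q * r)))) $ n =
      (\<Sum>i=0..n. coeff (cyclotomic (p * q * r)) i * of_bool (n - i = 0))"
    unfolding fps_mult_nth[of ?F] using n by (intro sum.cong refl) (subst gen_product, auto)
  also have "\<dots> = (\<Sum>i\<in>{n}. coeff (cyclotomic (p * q * r)) i * of_bool (n - i = 0))"
    by (rule sum.mono_neutral_right) auto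
  also have "\<dots> = coeff (cyclotomic (p * q * r)) n" by simp
  finally have "coeff (cyclotomic (p * q * r)) n = (G - G * ?X ^ (p * q * r)) $ n"
    unfolding eq by simp
  also have "\<dots> = G $ n" using n by (simp add: fps_X_power_mult_right_nth)
  also have "G = int_fps (\<lambda>z. \<Sum>e<p. gen (z - int e) - gen (z - int e - int r) -
      (gen (z - int e - int q) - gen (z - int e - int q - int r)))"
  proof -
    have "int_fps gen * (1 - ?X ^ r) = int_fps (\<lambda>z. gen z - gen (z - int r))"
      using gen_neg by (rule int_fps_mult_one_minus_X_power)
    moreover have "int_fps (\<lambda>z. gen z - gen (z - int r)) * (1 - ?X ^ q) =
        int_fps (\<lambda>z. gen z - gen (z - int r) - (gen (z - int q) - gen (z - int q - int r)))"
      by (rule int_fps_mult_one_minus_X_power) (simp add: gen_neg)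
    moreover have "int_fps (\<lambda>z. gen z - gen (z - int r) - (gen (z - int q) - gen (z - int q - int r))) * ?E =
        int_fps (\<lambda>z. \<Sum>e<p. gen (z - int e) - gen (z - int e - int r) -
          (gen (z - int e - int q) - gen (z - int e - int q - int r)))"
      by (rule int_fps_mult_geometric) (simp add: gen_neg)
    ultimately show ?thesis unfolding G_def by (simp only:)
  qed
  finally show ?thesis by (simp add: int_fps_def)
qed

text \<open>These are the coordinates of the exponent \<open>r\<close>, so subtracting
  \<open>r\<close> moves a point by (\<open>X\<close>, \<open>Y\<close>). By
  \<open>r_inverse\<close> they are also the inverses of $p$ modulo $q$ and of $q$ modulo
  $p$.\<close>

definition "X = int r mod int q"

definition "Y = (s * int r) mod int p"

lemma XY: "0 < X" "X < int q" "0 < Y" "Y < int p" "int p * X + int q * Y = int p * int q + 1"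
proof -
  have pq: "1 < int p" "1 < int q" using pos less by simp_all
  have "[int p * X + int q * Y = int r * int p + 0] (mod int q)"
    by (intro cong_add) (auto simp: X_def cong_def mod_mult_right_eq mult.commute)
  then have q: "[int p * X + int q * Y = 1] (mod int q)"
    using r_inverse(1) by (simp add: cong_trans)
  have "[int p * X + int q * Y = 0 + s * int r * int q] (mod int p)"
    by (intro cong_add) (auto simp: Y_def cong_def mod_mult_right_eq mult.commute)
  then have p: "[int p * X + int q * Y = 1] (mod int p)"
    using r_inverse(2) by (simp add: cong_trans)
  have "[int p * X + int q * Y = 1] (mod int p * int q)"
    using p q coprime_pq by (rule coprime_cong_mult)
  then obtain k where k: "int p * X + int q * Y - 1 = int p * int q * k"
    by (auto simp: cong_iff_dvd_diff dvd_def)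
  have "X \<noteq> 0"
  proof
    assume "X = 0"
    then have "[0 = 1] (mod int q)" using q by (simp add: cong_def)
    then show False using pq by (simp add: cong_def)
  qed
  moreover have "Y \<noteq> 0"
  proof
    assume "Y = 0"
    then have "[0 = 1] (mod int p)" using p by (simp add: cong_def)
    then show False using pq by (simp add: cong_def)
  qed
  moreover have "0 \<le> X" "X < int q" "0 \<le> Y" "Y < int p"
    using pq by (simp_all add: X_def Y_def)
  ultimately show "0 < X" "X < int q" "0 < Y" "Y < int p" by auto
  \<comment> \<open>The sum is 1 modulo $pq$ and lies strictly between 1 and $2pq$, which leaves
    only $pq + 1$.\<close>
  then have "int p * 1 \<le> int p * X" "int q * 1 \<le> int q * Y"
    "int p * X \<le> int p * (int q - 1)" "int q * Y \<le> int q * (int p - 1)"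
    using pq by (intro mult_left_mono; simp)+
  then have "1 < int p * X + int q * Y" "int p * X + int q * Y < 2 * (int p * int q)"
    using pq unfolding right_diff_distrib mult.commute[of "int q" "int p"] by linarith+
  then have "0 < int p * int q * k" "int p * int q * k < int p * int q * 2"
    unfolding k[symmetric] by simp_all
  moreover have "0 < int p * int q" using pq by simp
  ultimately have "0 < k" "k < 2"
    by (auto simp: mult_less_cancel_left_pos dest: zero_less_mult_pos)
  then have "k = 1" by linarith
  then show "int p * X + int q * Y = int p * int q + 1" using k by simp
qed

text \<open>\<open>int r * weight (m - d)\<close> is congruent to \<open>m - d\<close> modulo $pq$,
  so it cannot fall between \<open>m - d\<close> and \<open>m\<close>, a gap shorter than $pq$. Thus
  the threshold does not depend on \<open>d\<close>, and all terms of a coefficient share one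
  level.\<close>

lemma gen_eq_weight_le:
  assumes "0 \<le> d" "d < int (p * q)"
  shows "gen (m - d) = of_bool (weight (m - d) \<le> m div int r)"
proof -
  have "int r * weight (m - d) \<le> m - d \<longleftrightarrow> int r * weight (m - d) \<le> m"
    using cong_le_imp_le[OF weight_cong[of "m - d"], of d] assms by auto
  also have "\<dots> \<longleftrightarrow> weight (m - d) \<le> m div int r"
    using pos by (subst le_int_div_iff) auto
  finally show ?thesis by (simp add: gen_def)
qed

lemma gen_diff_r:
  assumes d: "0 \<le> d" "d < int (p * q)" and n: "n < p * q * r"
  shows "gen (int n - d) - gen (int n - d - int r) =
    binary_coeff (int p) (int q) X Y (int (n div r)) ((int n - d) mod int q) ((s * (int n - d)) mod int p)"
proof -
  define z where "z = int n - d"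
  define J where "J = int (n div r)"
  have "n div r < p * q" using n pos by (simp add: less_mult_imp_div_less)
  then have J: "J < int p * int q" by (simp add: J_def del: of_nat_mult flip: of_nat_mult)
  have g1: "gen z = of_bool (weight z \<le> J)"
    unfolding z_def using gen_eq_weight_le[OF d, of "int n"] by (simp add: J_def zdiv_int)
  have "(int n - int r) div int r = J - 1"
    using div_add_self2[of "int r" "int n - int r"] pos by (simp add: J_def zdiv_int)
  moreover have "int n - int r - d = z - int r" by (simp add: z_def)
  ultimately have g2: "gen (z - int r) = of_bool (weight (z - int r) \<le> J - 1)"
    using gen_eq_weight_le[OF d, of "int n - int r"] by (simp only:)
  have "(z - int r) mod int q = (z mod int q - X) mod int q"
    by (simp add: X_def mod_diff_eq)
  moreover have "(s * (z - int r)) mod int p = ((s * z) mod int p - Y) mod int p"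
    unfolding Y_def mod_diff_eq by (simp add: algebra_simps)
  ultimately have "weight (z - int r) =
      int p * ((z mod int q - X) mod int q) + int q * (((s * z) mod int p - Y) mod int p)"
    by (simp only: weight_def)
  then have "gen z - gen (z - int r) = of_bool (int p * (z mod int q) + int q * ((s * z) mod int p) \<le> J) -
      of_bool (int p * ((z mod int q - X) mod int q) + int q * (((s * z) mod int p - Y) mod int p) \<le> J - 1)"
    unfolding g1 g2 by (simp only: weight_def)
  also have "\<dots> = binary_coeff (int p) (int q) X Y J (z mod int q) ((s * z) mod int p)"
    using XY pos J by (intro binary_coeff_eq) auto
  finally show ?thesis unfolding z_def J_def .
qed

text \<open>Since $q$ divides \<open>b\<close>, the exponent \<open>x + b\<close> has first
  coordinate \<open>x mod int q\<close>; subtracting $q$ keeps it and moves the second coordinate by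
  \<open>s * c\<close>.\<close>

theorem coeff_cyclotomic_shift_diff:
  assumes n: "n < p * q * r" and ab: "int n = a + b + int p - 1" and b: "int q dvd b"
    and c: "[int q = c] (mod int p)"
  shows "coeff (cyclotomic (p * q * r)) n = shift_diff (int p) s c b a (a + int p - 1)
    (\<lambda>x y. binary_coeff (int p) (int q) X Y (int (n div r)) (x mod int q) y)"
proof -
  let ?B = "\<lambda>x y. binary_coeff (int p) (int q) X Y (int (n div r)) (x mod int q) y"
  let ?T = "\<lambda>x. ?B x ((s * (x + b)) mod int p) - ?B x ((s * (x + b) - s * c) mod int p)"
  have "coeff (cyclotomic (p * q * r)) n = (\<Sum>e<p. ?T (a + int p - 1 - int e))"
    unfolding coeff_cyclotomic_gen[OF n]
  proof (intro sum.cong refl)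
    fix e assume "e \<in> {..<p}"
    define x where "x = a + int p - 1 - int e"
    have z: "int n - int e = x + b" using ab by (simp add: x_def)
    \<comment> \<open>Even the largest decrement stays below $pq$, as required for the common
      level.\<close>
    have "e + q < p * q"
    proof -
      have "2 * q \<le> p * q" using pos by (intro mult_le_mono1) simp
      moreover have "e < p" using \<open>e \<in> {..<p}\<close> by simp
      ultimately show ?thesis using less by linarith
    qed
    then have e: "int e < int (p * q)" "int e + int q < int (p * q)"
      unfolding of_nat_add[symmetric] of_nat_less_iff by simp_all
    have m: "(x + b) mod int q = x mod int q" "(x + b - int q) mod int q = x mod int q"
      using b by (auto elim!: dvdE simp: mod_diff_right_eq)
    have "[s * (x + b) - s * int q = s * (x + b) - s * c] (mod int p)"
      using c by (intro cong_diff cong_mult cong_refl)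
    then have m': "(s * (x + b - int q)) mod int p = (s * (x + b) - s * c) mod int p"
      by (simp add: cong_def algebra_simps)
    have "gen (int n - int e) - gen (int n - int e - int r) = ?B x ((s * (x + b)) mod int p)"
      using gen_diff_r[of "int e" n] e n unfolding z m by simp
    moreover have "gen (int n - int e - int q) - gen (int n - int e - int q - int r) =
        ?B x ((s * (x + b) - s * c) mod int p)"
    proof -
      have z': "int n - (int e + int q) = x + b - int q" "int n - int e - int q = x + b - int q"
        using z by simp_all
      show ?thesis
        using gen_diff_r[of "int e + int q" n] e n unfolding z' m m' by simp
    qed
    ultimately show "gen (int n - int e) - gen (int n - int e - int r) -
        (gen (int n - int e - int q) - gen (int n - int e - int q - int r)) = ?T (a + int p - 1 - int e)"
      by (simp only: x_def)
  qed
  also have "\<dots> = (\<Sum>x=a..a + int p - 1. ?T x)"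
    by (rule sum.reindex_bij_witness[of _ "\<lambda>x. nat (a + int p - 1 - x)" "\<lambda>e. a + int p - 1 - int e"]) auto
  finally show ?thesis by (simp only: shift_diff_def)
qed

lemma coeff_cyclotomic_bounded:
  assumes "window_estimate (int p) (int q) X Y s c lo hi" and c: "[int q = c] (mod int p)"
    and "lo \<le> 0" "0 \<le> hi"
  shows "coeff (cyclotomic (p * q * r)) n \<in> {lo..hi}"
proof (cases "n < p * q * r")
  case True
  define h where "h = int n mod int q"
  have h: "0 \<le> h" "h < int q" using pos by (simp_all add: h_def)
  have "int q dvd int n - h" by (simp add: h_def dvd_minus_mod)
  then have "coeff (cyclotomic (p * q * r)) n =
      shift_diff (int p) s c (int n - h) (h - int p + 1) (h - int p + 1 + int p - 1)
        (\<lambda>x y. binary_coeff (int p) (int q) X Y (int (n div r)) (x mod int q) y)"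
    by (intro coeff_cyclotomic_shift_diff True c) simp_all
  also have "\<dots> \<in> {lo..hi}"
    using assms(1) h by (intro window_estimate.window_bound) auto
  finally show ?thesis .
next
  case False
  have "1 < p * q * r" using primes prime_gt_1_nat by (metis less_1_mult)
  \<comment> \<open>The degree is at most the totient of $pqr$, so from $pqr$ on the coefficients
    are 0; the interval contains 0 by assumption.\<close>
  have "degree (cyclotomic (p * q * r)) = degree (cyclotomic_complex (p * q * r))"
    using degree_map_poly[of "of_int :: int \<Rightarrow> complex" "cyclotomic (p * q * r)"]
    by (simp add: of_int_cyclotomic)
  also have "\<dots> \<le> (\<Sum>k\<in>totatives (p * q * r). 1)"
    unfolding cyclotomic_complex_def by (rule order.trans[OF degree_prod_sum_le]) auto
  also have "\<dots> < p * q * r"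
    using totient_less[OF \<open>1 < p * q * r\<close>] by (simp add: totient_def)
  finally show ?thesis using False assms by (simp add: coeff_eq_0)
qed

text \<open>Every \<open>n = J * r + t\<close> with \<open>t < p * q\<close> has
  \<open>n div r = J\<close>, because $r > pq$. The Chinese remainder theorem then picks
  \<open>t\<close> so that the window ends at \<open>h\<close> modulo $q$ and has offset
  \<open>d\<close> modulo $p$.\<close>

lemma coeff_cyclotomic_attained:
  assumes r: "p * q < r" and J: "J < p * q" and c: "[int q = c] (mod int p)"
  shows "\<exists>n. coeff (cyclotomic (p * q * r)) n = shift_diff (int p) s c d (h - int p + 1) h
    (\<lambda>x y. binary_coeff (int p) (int q) X Y (int J) (x mod int q) y)"
proof -
  obtain v where v: "[v = h] (mod int q)" "[v = h + d] (mod int p)"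
    using binary_chinese_remainder_int[of "int q" "int p" h "h + d"] coprime_pq
    by (auto simp: coprime_commute)
  define t where "t = nat ((v - int (J * r)) mod int (p * q))"
  have pq: "0 < int (p * q)" using pos by simp
  have "t < p * q"
    using pos_mod_bound[OF pq, of "v - int (J * r)"] pq by (simp add: t_def nat_less_iff)
  define n where "n = J * r + t"
  have div: "n div r = J" using \<open>t < p * q\<close> r by (simp add: n_def)
  have "n < p * q * r"
    using mult_le_mono1[of "J + 1" "p * q" r] J \<open>t < p * q\<close> r by (simp add: n_def)
  have "[int n = int (J * r) + (v - int (J * r))] (mod int (p * q))"
    unfolding n_def of_nat_add by (intro cong_add cong_refl)
      (use pq in \<open>simp add: t_def cong_def del: of_nat_mult\<close>)
  then have nv: "[int n = v] (mod int (p * q))" by simp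
  have "[int n = v] (mod int q)" "[int n = v] (mod int p)"
    using nv by (rule cong_dvd_modulus; simp)+
  then have "[int n = h] (mod int q)" "[int n = h + d] (mod int p)"
    using v cong_trans by blast+
  then have "int q dvd int n - h" "[int n - h = h + d - h] (mod int p)"
    by (simp add: cong_iff_dvd_diff, intro cong_diff cong_refl)
  then have b: "int q dvd int n - h" "(int n - h) mod int p = d mod int p"
    by (simp_all add: cong_def)
  have "coeff (cyclotomic (p * q * r)) n =
      shift_diff (int p) s c (int n - h) (h - int p + 1) (h - int p + 1 + int p - 1)
        (\<lambda>x y. binary_coeff (int p) (int q) X Y (int (n div r)) (x mod int q) y)"
    by (intro coeff_cyclotomic_shift_diff \<open>n < p * q * r\<close> c b(1)) simp
  also have "\<dots> = shift_diff (int p) s c d (h - int p + 1) h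
      (\<lambda>x y. binary_coeff (int p) (int q) X Y (int J) (x mod int q) y)"
    unfolding div by (subst shift_diff_cong_offset[OF b(2)]) simp
  finally show ?thesis by blast
qed

end

text \<open>\<open>coeffs\<close> lists coefficients up to the degree only; being nonzero, the
  values \<open>lo\<close> and \<open>hi\<close> must occur in that list.\<close>

lemma poly_diameter_eq:
  assumes "\<And>n. coeff f n \<in> {lo..hi}" and "coeff f i = lo" "lo < 0" and "coeff f j = hi" "0 < hi"
  shows "poly_diameter f = hi - lo"
proof -
  have "f \<noteq> 0" using assms by auto
  have "i \<le> degree f" "j \<le> degree f" using assms by (auto intro: le_degree)
  then have "lo \<in> set (coeffs f)" "hi \<in> set (coeffs f)"
    using coeff_in_coeffs[OF \<open>f \<noteq> 0\<close>] assms by metis+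
  moreover have "lo \<le> x \<and> x \<le> hi" if "x \<in> set (coeffs f)" for x
    using that assms(1) by (auto simp: coeffs_def split: if_splits)
  ultimately have "Max (set (coeffs f)) = hi" "Min (set (coeffs f)) = lo"
    by (auto intro!: Max_eqI Min_eqI)
  then show ?thesis by (simp add: poly_diameter_def)
qed

section \<open>The even diameters and the diameter 3\<close>

lemma diameter_direct:
  assumes "prime p" "prime q" "prime r" "2 * p * p < q" "p * q < r"
    and inv: "[int r * (int p + int q) = 1] (mod int (p * q))"
    and c: "0 < c" "2 * c < p" "[q = c] (mod p)"
  shows "cyclotomic_diameter (p * q * r) = 2 * int c"
proof -
  have p1: "1 < p" using assms by (simp add: prime_gt_1_nat)
  then have "p * 1 < p * p" by (intro mult_strict_left_mono) auto
  then have "p < q" using assms by linarith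
  moreover have "1 * q \<le> p * q" using p1 by (intro mult_le_mono1) simp
  then have "q < r" using assms by linarith
  ultimately interpret ternary p q r 1
    using assms by unfold_locales auto
  have q: "2 * int p * int p < int q"
    using assms(4) by (metis of_nat_less_iff of_nat_mult of_nat_numeral)
  then have q': "int p * int p < int q"
  proof -
    have "0 < int p * int p" using p1 by simp
    then show ?thesis using q by linarith
  qed
  have est: "window_estimate (int p) (int q) X Y 1 (int c) (- int c) (int c)"
    using XY p1 q' c by (intro window_estimate_direct) auto
  have cong: "[int q = int c] (mod int p)" using c by (simp add: cong_int_iff)
  \<comment> \<open>The level of \<open>wrapping_window_eq\<close> that retains exactly the rows 0
    to \<open>c - 1\<close>, as in \<open>direct_extremes\<close>.\<close>
  define J where "J = q * (c - 1) + p * p"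
  have "p * p < q" using q' by (metis of_nat_less_iff of_nat_mult)
  moreover have "q * (c - 1) + q = q * c" using c by (cases c) auto
  moreover have "q * c \<le> q * p" using c by (intro mult_le_mono2) simp
  ultimately have J: "J < p * q" unfolding J_def mult.commute[of p q] by linarith
  have JJ: "int J = int q * (int c - 1) + int p * int p"
    using c by (simp add: J_def of_nat_diff)
  have eq: "shift_diff (int p) 1 (int c) d (int c - 1 - int p + 1) (int c - 1)
      (\<lambda>x y. binary_coeff (int p) (int q) X Y (int J) (x mod int q) y) =
      shift_diff (int p) 1 (int c) d 0 (int c - 1) (\<lambda>x y. of_bool (y \<le> int c - 1))" for d
    unfolding JJ using c q by (intro window_estimate.wrapping_window_eq[OF est]) auto
  obtain i where i: "coeff (cyclotomic (p * q * r)) i = - int c"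
    using coeff_cyclotomic_attained[OF assms(5) J cong, of "int c" "int c - 1"]
      direct_extremes(2)[of "int c" "int p"] c unfolding eq by auto
  obtain j where j: "coeff (cyclotomic (p * q * r)) j = int c"
    using coeff_cyclotomic_attained[OF assms(5) J cong, of 0 "int c - 1"]
      direct_extremes(1)[of "int c" "int p"] c unfolding eq by auto
  have "poly_diameter (cyclotomic (p * q * r)) = int c - (- int c)"
    using coeff_cyclotomic_bounded[OF est cong] i j c by (intro poly_diameter_eq) auto
  then show ?thesis by (simp add: cyclotomic_diameter_def)
qed

lemma diameter_reversed:
  assumes "prime p" "odd p" "prime q" "prime r" "2 * p * p < q" "p * q < r"
    and inv: "[int r * (int p - int q) = 1] (mod int (p * q))"
    and c: "[q = 1] (mod p)"
  shows "cyclotomic_diameter (p * q * r) = 3"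
proof -
  have p1: "2 < p" using assms prime_gt_1_nat[of p] by (cases "p = 2") auto
  then have "p * 1 < p * p" by (intro mult_strict_left_mono) auto
  then have "p < q" using assms by linarith
  moreover have "1 * q \<le> p * q" using p1 by (intro mult_le_mono1) simp
  then have "q < r" using assms by linarith
  ultimately interpret ternary p q r "- 1"
    using assms by unfold_locales auto
  have q: "2 * int p * int p < int q"
    using assms(5) by (metis of_nat_less_iff of_nat_mult of_nat_numeral)
  then have q': "int p * int p < int q"
  proof -
    have "0 < int p * int p" using p1 by simp
    then show ?thesis using q by linarith
  qed
  have cong: "[int q = 1] (mod int p)" using c by (metis cong_int_iff of_nat_1)
  \<comment> \<open>\<open>Y\<close> is the inverse of $q$ modulo $p$, so $q$ congruent to 1 forces
    \<open>Y = 1\<close>, the case of the reversed estimate.\<close>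
  have "[int p * X + int q * Y = 0 + 1 * Y] (mod int p)"
    using cong by (intro cong_add cong_mult) (auto simp: cong_def)
  moreover have "[int p * int q + 1 = 1] (mod int p)" by (simp add: cong_def)
  ultimately have "[Y = 1] (mod int p)"
    using XY(5) by (metis add_0 cong_sym cong_trans mult_1)
  then have Y: "Y = 1"
    using XY p1 by (simp add: cong_def mod_pos_pos_trivial)
  have XY': "int p * X + int q = int p * int q + 1" using XY(5) Y by simp
  have est: "window_estimate (int p) (int q) X Y (- 1) 1 (- 2) 1"
    unfolding Y using XY' p1 q' by (intro window_estimate_reversed) auto
  have "p * p < q" using q' by (metis of_nat_less_iff of_nat_mult)
  moreover have "1 * q \<le> p * q" using p1 by (intro mult_le_mono1) simp
  ultimately have J: "p * p < p * q" "q - 2 * p < p * q" using p1 less(1) by (simp, linarith)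
  have "2 * p \<le> p * p" using p1 by (intro mult_le_mono1) simp
  then have JJ: "int (q - 2 * p) = int q - 2 * int p" using \<open>p * p < q\<close> by linarith
  obtain i where i: "coeff (cyclotomic (p * q * r)) i = - 2"
    using coeff_cyclotomic_attained[OF assms(6) J(2) cong, of 1 "int p - 3"]
      reversed_extremes(2)[of "int p" "int q" X] p1 q' XY' unfolding JJ Y by auto
  have "shift_diff (int p) (- 1) 1 0 (0 - int p + 1) 0
      (\<lambda>x y. binary_coeff (int p) (int q) X Y (int q * 0 + int p * int p) (x mod int q) y) =
      shift_diff (int p) (- 1) 1 0 0 0 (\<lambda>x y. of_bool (y \<le> 0))"
    using p1 q by (intro window_estimate.wrapping_window_eq[OF est]) auto
  then obtain j where j: "coeff (cyclotomic (p * q * r)) j = 1"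
    using coeff_cyclotomic_attained[OF assms(6) J(1) cong, of 0 0]
      reversed_extremes(1)[of "int p" "int q" X] p1 q' XY' by auto
  have "poly_diameter (cyclotomic (p * q * r)) = 1 - (- 2)"
    using coeff_cyclotomic_bounded[OF est cong] i j by (intro poly_diameter_eq) auto
  then show ?thesis by (simp add: cyclotomic_diameter_def)
qed

section \<open>Dirichlet's theorem for odd moduli\<close>

lemma sum_divisors_hyperbola:
  fixes f :: "nat \<Rightarrow> nat \<Rightarrow> 'a :: comm_monoid_add"
  shows "(\<Sum>n=1..x. \<Sum>d | d dvd n. f d (n div d)) = (\<Sum>d=1..x. \<Sum>m=1..x div d. f d m)"
proof -
  have "(\<Sum>n=1..x. \<Sum>d | d dvd n. f d (n div d)) =
      (\<Sum>(n, d)\<in>(SIGMA n:{1..x}. {d. d dvd n}). f d (n div d))"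
    by (rule sum.Sigma) auto
  also have "\<dots> = (\<Sum>(d, m)\<in>(SIGMA d:{1..x}. {1..x div d}). f d m)"
  proof (rule sum.reindex_bij_witness[of _ "\<lambda>(d, m). (d * m, d)" "\<lambda>(n, d). (d, n div d)"])
    fix a assume "a \<in> (SIGMA d:{1..x}. {1..x div d})"
    then obtain d m where a: "a = (d, m)" "1 \<le> d" "1 \<le> m" "m \<le> x div d" by auto
    then have "d * m \<le> x"
      using mult_le_mono2[of m "x div d" d] div_times_less_eq_dividend[of x d]
      by (metis le_trans mult.commute)
    then show "(case a of (d, m) \<Rightarrow> (d * m, d)) \<in> (SIGMA n:{1..x}. {d. d dvd n})"
      using a by auto
  next
    fix a assume "a \<in> (SIGMA n:{1..x}. {d. d dvd n})"
    then obtain n d where a: "a = (n, d)" "1 \<le> n" "n \<le> x" "d dvd n" by auto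
    have "d \<noteq> 0" using a(2,4) by (intro notI) simp
    then have "1 \<le> d" by simp
    have "d \<le> n" using a(2,4) by (simp add: dvd_imp_le)
    moreover have "0 < n div d" using \<open>1 \<le> d\<close> \<open>d \<le> n\<close> by (simp add: div_greater_zero_iff)
    moreover have "n div d \<le> x div d" using a by (simp add: div_le_mono)
    ultimately show "(case a of (n, d) \<Rightarrow> (d, n div d)) \<in> (SIGMA d:{1..x}. {1..x div d})"
      using a \<open>1 \<le> d\<close> by simp
  qed auto
  also have "\<dots> = (\<Sum>d=1..x. \<Sum>m=1..x div d. f d m)"
    by (rule sum.Sigma[symmetric]) auto
  finally show ?thesis .
qed

section \<open>Chebyshev and Mertens estimates\<close>

abbreviation \<Lambda> :: "nat \<Rightarrow> real" where "\<Lambda> \<equiv> mangoldt"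

definition chebyshev_psi :: "nat \<Rightarrow> real"
  where "chebyshev_psi n = (\<Sum>d=1..n. \<Lambda> d)"

lemma ln_fact_eq_sum_ln: "ln (fact n) = (\<Sum>k=1..n. ln (real k))"
  by (induction n) (simp_all add: ln_mult_pos add.commute)

lemma ln_fact_eq_sum_mangoldt: "ln (fact n) = (\<Sum>d=1..n. \<Lambda> d * real (n div d))"
proof -
  have "ln (fact n) = (\<Sum>k=1..n. \<Sum>d | d dvd k. \<Lambda> d)"
    unfolding ln_fact_eq_sum_ln
    by (intro sum.cong refl) (use mangoldt_sum[where 'a = real] in auto)
  also have "\<dots> = (\<Sum>d=1..n. \<Lambda> d * real (n div d))"
    using sum_divisors_hyperbola[of "\<lambda>d _. \<Lambda> d" n] by (simp add: mult.commute)
  finally show ?thesis .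
qed

lemma ln_fact_le: "ln (fact n) \<le> real n * ln (real n)"
proof (cases "n = 0")
  case False
  have "ln (fact n) \<le> (\<Sum>k=1..n. ln (real n))"
    unfolding ln_fact_eq_sum_ln by (intro sum_mono) auto
  then show ?thesis by simp
qed auto

lemma ln_fact_ge: "ln (fact n) \<ge> real n * ln (real n) - real n"
proof (induction n)
  case (Suc n)
  show ?case
  proof (cases "n = 0")
    case False
    have "ln (real (Suc n)) - ln (real n) = ln (real (Suc n) / real n)"
      using False by (subst ln_div) auto
    also have "real (Suc n) / real n = 1 + 1 / real n" using False by (simp add: field_simps)
    also have "ln (1 + 1 / real n) \<le> 1 / real n" using False by (intro ln_add_one_self_le_self) auto
    finally have "real n * (ln (real (Suc n)) - ln (real n)) \<le> 1"
      using False by (simp add: field_simps)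
    then have "real (Suc n) * ln (real (Suc n)) - real (Suc n) \<le>
        real n * ln (real n) - real n + ln (real (Suc n))"
      by (simp add: algebra_simps)
    also have "\<dots> \<le> ln (fact n) + ln (real (Suc n))" using Suc by simp
    also have "\<dots> = ln (fact (Suc n))" by (simp add: ln_mult_pos add.commute)
    finally show ?thesis .
  qed auto
qed auto

lemma chebyshev_psi_mono: "m \<le> n \<Longrightarrow> chebyshev_psi m \<le> chebyshev_psi n"
  unfolding chebyshev_psi_def by (intro sum_mono2) (auto simp: mangoldt_nonneg)

lemma chebyshev_psi_double: "chebyshev_psi (2 * n) \<le> chebyshev_psi n + 2 * real n"
proof -
  have "ln (fact (2 * n)) - 2 * ln (fact n) =
      (\<Sum>d=1..2*n. \<Lambda> d * real (2 * n div d)) - 2 * (\<Sum>d=1..n. \<Lambda> d * real (n div d))"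
    by (simp add: ln_fact_eq_sum_mangoldt)
  also have "(\<Sum>d=1..n. \<Lambda> d * real (n div d)) = (\<Sum>d=1..2*n. \<Lambda> d * real (n div d))"
    by (rule sum.mono_neutral_left) auto
  also have "(\<Sum>d=1..2*n. \<Lambda> d * real (2 * n div d)) - 2 * \<dots> =
      (\<Sum>d=1..2*n. \<Lambda> d * (real (2 * n div d) - 2 * real (n div d)))"
    by (simp add: sum_distrib_left sum_subtractf algebra_simps)
  also have "\<dots> \<ge> (\<Sum>d=1..2*n. if d \<in> {n+1..2*n} then \<Lambda> d else 0)"
  proof (intro sum_mono)
    fix d assume d: "d \<in> {1..2*n}"
    have "2 * (n div d) \<le> 2 * n div d"
      by (metis div_mult2_eq div_times_less_eq_dividend d atLeastAtMost_iff less_eq_div_iff_mult_less_eq mult.assoc mult.commute mult_le_mono2 not_one_le_zero zero_less_iff_neq_zero)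
    then have le: "2 * real (n div d) \<le> real (2 * n div d)"
      by (metis of_nat_le_iff of_nat_mult of_nat_numeral)
    show "(if d \<in> {n+1..2*n} then \<Lambda> d else 0) \<le> \<Lambda> d * (real (2 * n div d) - 2 * real (n div d))"
    proof (cases "d \<in> {n+1..2*n}")
      case True
      then have "1 \<le> 2 * n div d" "n div d = 0" by (simp_all add: div_greater_zero_iff Suc_le_eq)
      then have "\<Lambda> d * 1 \<le> \<Lambda> d * (real (2 * n div d) - 2 * real (n div d))"
        by (intro mult_left_mono mangoldt_nonneg) simp
      then show ?thesis using True by simp
    qed (use le in \<open>auto intro!: mult_nonneg_nonneg mangoldt_nonneg\<close>)
  qed
  also have "(\<Sum>d=1..2*n. if d \<in> {n+1..2*n} then \<Lambda> d else 0) = (\<Sum>d=n+1..2*n. \<Lambda> d)"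
    by (subst sum.inter_restrict[symmetric]) (auto intro!: sum.cong)
  also have "\<dots> = chebyshev_psi (2 * n) - chebyshev_psi n"
    using sum.ub_add_nat[of 1 n \<Lambda> n] by (simp add: chebyshev_psi_def mult_2)
  finally have 1: "chebyshev_psi (2 * n) - chebyshev_psi n \<le> ln (fact (2 * n)) - 2 * ln (fact n)" by simp
  have "real (2 * n choose n) \<le> 2 ^ (2 * n)"
    using binomial_le_pow2[of "2 * n" n] by (metis of_nat_le_iff of_nat_numeral of_nat_power)
  moreover have "real (2 * n choose n) * (fact n * fact n) = fact (2 * n)"
    using binomial_fact_lemma[of n "2 * n"]
    by (metis le_add2 mult.commute mult_2 diff_add_inverse2 of_nat_fact of_nat_mult)
  ultimately have "fact (2 * n) \<le> (2 ^ (2 * n) * (fact n * fact n) :: real)"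
    by (metis fact_ge_zero mult_nonneg_nonneg mult_right_mono)
  then have "ln (fact (2 * n)) \<le> ln (2 ^ (2 * n) * (fact n * fact n) :: real)"
    by (subst ln_le_cancel_iff) auto
  also have "\<dots> = 2 * real n * ln 2 + 2 * ln (fact n)"
    by (simp add: ln_mult_pos ln_realpow)
  also have "\<dots> \<le> 2 * real n * 1 + 2 * ln (fact n)"
    using ln_2_less_1 by (intro add_mono mult_left_mono) auto
  finally show ?thesis using 1 by simp
qed

lemma chebyshev_psi_le: "chebyshev_psi n \<le> 4 * real n"
proof (induction n rule: less_induct)
  case (less n)
  consider "n \<le> 1" | "n = 2" | "n \<ge> 3" by linarith
  then show ?case
  proof cases
    case 2
    then show ?thesis using chebyshev_psi_double[of 1] by (simp add: chebyshev_psi_def)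
  next
    case 3
    define m where "m = (n + 1) div 2"
    have m: "n \<le> 2 * m" "2 * m \<le> n + 1" "m < n" using 3 by (auto simp: m_def)
    have "chebyshev_psi n \<le> chebyshev_psi m + 2 * real m" using chebyshev_psi_mono[OF m(1)] chebyshev_psi_double[of m] by simp
    also have "\<dots> \<le> 6 * real m" using less.IH[OF m(3)] by simp
    also have "\<dots> \<le> 4 * real n" using m 3 by simp
    finally show ?thesis .
  qed (auto simp: chebyshev_psi_def numeral_2_eq_2 le_Suc_eq)
qed

text \<open>Multiplied by \<open>x\<close>, the sum is compared with the logarithm of the factorial,
  where \<Lambda> has the weights floor(x/d). Dropping the floors costs at most psi(x), hence the 4;
  the other direction loses only the \<open>real n\<close> of \<open>ln_fact_ge\<close>.\<close>

lemma mertens: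
  assumes "0 < x"
  shows "\<bar>(\<Sum>d=1..x. \<Lambda> d / real d) - ln (real x)\<bar> \<le> 4"
proof -
  define S where "S = (\<Sum>d=1..x. \<Lambda> d / real d)"
  have bounds: "real (x div d) \<le> real x / real d" "real x / real d \<le> real (x div d) + 1" if "d \<ge> 1" for d
  proof -
    show "real (x div d) \<le> real x / real d" by (rule of_nat_div_le_of_nat)
    have "x < (x div d + 1) * d" using that dividend_less_div_times[of d x] by simp
    then have "real x \<le> real ((x div d + 1) * d)" by (simp only: of_nat_le_iff less_imp_le)
    then show "real x / real d \<le> real (x div d) + 1"
      using that by (simp add: field_simps)
  qed
  have xS: "real x * S = (\<Sum>d=1..x. \<Lambda> d * (real x / real d))"
    by (simp add: S_def sum_distrib_left mult_ac)
  have "ln (fact x) \<le> real x * S"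
    unfolding ln_fact_eq_sum_mangoldt xS
    by (intro sum_mono mult_left_mono mangoldt_nonneg bounds) auto
  then have "real x * (ln (real x) - 1) \<le> real x * S"
    using ln_fact_ge[of x] by (simp add: algebra_simps)
  then have 1: "ln (real x) - 1 \<le> S" using assms by simp
  have "real x * S \<le> (\<Sum>d=1..x. \<Lambda> d * (real (x div d) + 1))"
    unfolding xS by (intro sum_mono mult_left_mono mangoldt_nonneg bounds) auto
  also have "\<dots> = ln (fact x) + chebyshev_psi x"
    unfolding ln_fact_eq_sum_mangoldt chebyshev_psi_def by (simp add: algebra_simps sum.distrib)
  also have "\<dots> \<le> real x * (ln (real x) + 4)"
    using ln_fact_le[of x] chebyshev_psi_le[of x] by (simp add: algebra_simps)
  finally have 2: "S \<le> ln (real x) + 4" using assms by simp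
  show ?thesis using 1 2 by (simp add: S_def)
qed

text \<open>The sharper bound 2 - 2 / sqrt x telescopes.\<close>

lemma sum_inverse_n_sqrt_n_le: "(\<Sum>n=2..x. 1 / (real n * sqrt (real n))) \<le> 2"
proof -
  have "(\<Sum>n=2..x. 1 / (real n * sqrt (real n))) \<le> 2 - 2 / sqrt (real x)" if "x \<ge> 1" for x
    using that
  proof (induction x rule: nat_induct_at_least)
    case (Suc n)
    define a b where "a = sqrt (real n)" and "b = sqrt (real (Suc n))"
    have ab: "0 < a" "a \<le> b" "b * b = real (Suc n)" "a * a = real n"
      using Suc by (auto simp: a_def b_def)
    have "(b - a) * (b + a) = 1" using ab by (simp add: algebra_simps)
    have "(b - a) * (b + a) \<le> (b - a) * (2 * b)" using ab by (intro mult_left_mono) auto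
    then have "1 / (b * b * b) \<le> (b - a) * (2 * b) / (b * b * b)"
      using ab(1,2) \<open>(b - a) * (b + a) = 1\<close> by (intro divide_right_mono) auto
    also have "\<dots> = 2 * (b - a) / (b * b)" using ab(1,2) by simp
    also have "\<dots> \<le> 2 * (b - a) / (a * b)"
      using ab(1,2) by (intro divide_left_mono mult_right_mono) auto
    also have "\<dots> = 2 / a - 2 / b" using ab by (simp add: field_simps)
    finally have "1 / (real (Suc n) * b) \<le> 2 / a - 2 / b" by (simp only: ab(3))
    then show ?case using Suc by (simp add: a_def b_def)
  qed auto
  from this[of x] show ?thesis
    by (cases "x \<ge> 1") (auto intro: order.trans)
qed

text \<open>For fixed \<open>p\<close> the powers from the square on form a geometric series of size
  at most 2 ln p / p^2, and ln p <= 2 sqrt p makes this 4 / (p sqrt p). A constant bound lets proper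
  prime powers be ignored against ln x.\<close>

lemma sum_mangoldt_nonprime_le:
  "(\<Sum>n | n \<in> {1..x} \<and> \<not> prime n. \<Lambda> n / real n) \<le> 8"
proof -
  define I where "I = {p. prime p \<and> p \<in> {2..x}} \<times> {..<x}"
  define f where "f = (\<lambda>(p, k). p ^ (k + 2) :: nat)"
  have fin: "finite I" by (simp add: I_def)
  have "(\<Sum>n | n \<in> {1..x} \<and> \<not> prime n. \<Lambda> n / real n) =
      (\<Sum>n | n \<in> {1..x} \<and> \<not> prime n \<and> primepow n. \<Lambda> n / real n)"
    by (rule sum.mono_neutral_right) (auto simp: mangoldt_def)
  also have "\<dots> \<le> (\<Sum>n\<in>f ` I. \<Lambda> n / real n)"
  proof (rule sum_mono2)
    show "{n. n \<in> {1..x} \<and> \<not> prime n \<and> primepow n} \<subseteq> f ` I"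
    proof
      fix n assume n: "n \<in> {n. n \<in> {1..x} \<and> \<not> prime n \<and> primepow n}"
      then obtain p k where pk: "prime p" "k > 0" "n = p ^ k" by (auto simp: primepow_def)
      then have "k \<noteq> 1" using n by auto
      then have k: "k - 2 + 2 = k" using pk by simp
      have "p \<ge> 2" using pk by (simp add: prime_ge_2_nat)
      have "p ^ 1 \<le> p ^ k" using pk by (intro power_increasing) (auto simp: Suc_le_eq prime_gt_0_nat)
      moreover have "k < p ^ k" using \<open>p \<ge> 2\<close> by (simp add: power_gt_expt)
      ultimately have "(p, k - 2) \<in> I" using pk n \<open>p \<ge> 2\<close> by (auto simp: I_def)
      then show "n \<in> f ` I"
        by (rule rev_image_eqI) (simp only: f_def prod.case k pk)
    qed
  qed (use fin in \<open>auto simp: mangoldt_nonneg\<close>)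
  also have "\<dots> \<le> (\<Sum>i\<in>I. \<Lambda> (f i) / real (f i))"
    using sum_image_le[OF fin, of "\<lambda>n. \<Lambda> n / real n" f] by (simp add: mangoldt_nonneg o_def)
  also have "\<dots> = (\<Sum>(p, k)\<in>I. ln (real p) / real p ^ (k + 2))"
    by (intro sum.cong refl) (auto simp: I_def f_def simp del: power_Suc power_add)
  also have "\<dots> = (\<Sum>p | prime p \<and> p \<in> {2..x}. \<Sum>k<x. ln (real p) / real p ^ (k + 2))"
    unfolding I_def by (rule sum.cartesian_product[symmetric])
  also have "\<dots> \<le> (\<Sum>p | prime p \<and> p \<in> {2..x}. 4 / (real p * sqrt (real p)))"
  proof (rule sum_mono)
    fix p assume "p \<in> {p. prime p \<and> p \<in> {2..x}}"
    then have p: "real p \<ge> 2" by auto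
    define u where "u = 1 / real p"
    have u: "0 < u" "u \<le> 1 / 2" using p by (auto simp: u_def field_simps)
    have "(\<Sum>k<x. u ^ k) \<le> 2"
    proof -
      have "(\<Sum>k<x. u ^ k) = (1 - u ^ x) / (1 - u)" using u by (simp add: sum_gp_strict)
      also have "\<dots> \<le> 1 / (1 - u)" using u by (intro divide_right_mono) auto
      also have "\<dots> \<le> 2" using u by (simp add: field_simps)
      finally show ?thesis .
    qed
    moreover have "(\<Sum>k<x. ln (real p) / real p ^ (k + 2)) = ln (real p) * u ^ 2 * (\<Sum>k<x. u ^ k)"
      unfolding sum_distrib_left by (intro sum.cong refl) (simp add: u_def power_add power_divide power2_eq_square)
    moreover have "0 \<le> ln (real p) * u ^ 2" using p by simp
    ultimately have "(\<Sum>k<x. ln (real p) / real p ^ (k + 2)) \<le> ln (real p) * u ^ 2 * 2"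
      by (metis mult_left_mono)
    also have "ln (real p) \<le> 2 * sqrt (real p)"
    proof -
      have "ln (sqrt (real p)) \<le> sqrt (real p) - 1" using p by (intro ln_le_minus_one) auto
      then show ?thesis using p by (simp add: ln_sqrt)
    qed
    then have "ln (real p) * u ^ 2 * 2 \<le> 2 * sqrt (real p) * u ^ 2 * 2"
      by (intro mult_right_mono) auto
    also have "\<dots> = 4 / (real p * sqrt (real p))"
      using p by (simp add: u_def power2_eq_square field_simps)
    finally show "(\<Sum>k<x. ln (real p) / real p ^ (k + 2)) \<le> 4 / (real p * sqrt (real p))" .
  qed
  also have "\<dots> \<le> (\<Sum>p=2..x. 4 / (real p * sqrt (real p)))"
    by (intro sum_mono2) auto
  also have "\<dots> = 4 * (\<Sum>p=2..x. 1 / (real p * sqrt (real p)))"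
    by (simp add: sum_distrib_left)
  also have "\<dots> \<le> 4 * 2" using sum_inverse_n_sqrt_n_le[of x] by simp
  finally show ?thesis by simp
qed

section \<open>Dirichlet characters and orthogonality\<close>

definition dcharacter :: "nat \<Rightarrow> (nat \<Rightarrow> complex) \<Rightarrow> bool"
  where "dcharacter N \<chi> \<longleftrightarrow> (\<forall>m n. \<chi> (m * n) = \<chi> m * \<chi> n) \<and> (\<forall>n. \<chi> (n mod N) = \<chi> n) \<and>
    (\<forall>n. \<chi> n = 0 \<longleftrightarrow> \<not> coprime n N)"

definition principal :: "nat \<Rightarrow> nat \<Rightarrow> complex"
  where "principal N n = of_bool (coprime n N)"

lemma
  assumes "dcharacter N \<chi>"
  shows dchar_mult: "\<chi> (m * n) = \<chi> m * \<chi> n" and dchar_mod: "\<chi> (n mod N) = \<chi> n"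
    and dchar_eq_0_iff: "\<chi> n = 0 \<longleftrightarrow> \<not> coprime n N"
  using assms by (auto simp: dcharacter_def)

lemma dchar_cong:
  assumes "dcharacter N \<chi>" "[m = n] (mod N)"
  shows "\<chi> m = \<chi> n"
  using dchar_mod[OF assms(1)] assms(2) by (metis cong_def)

lemma dchar_1:
  assumes "dcharacter N \<chi>"
  shows "\<chi> 1 = 1"
  using dchar_mult[OF assms, of 1 1] dchar_eq_0_iff[OF assms, of 1] by auto

lemma dchar_power:
  assumes "dcharacter N \<chi>"
  shows "\<chi> (m ^ k) = \<chi> m ^ k"
proof (induction k)
  case 0
  then show ?case using dchar_1[OF assms] by simp
next
  case (Suc k)
  then show ?case using dchar_mult[OF assms, of m "m ^ k"] by simp
qed

lemma dchar_power_totient: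
  assumes "dcharacter N \<chi>" "coprime n N"
  shows "\<chi> n ^ totient N = 1"
  using dchar_power[OF assms(1), of n "totient N"] dchar_cong[OF assms(1) euler_theorem[OF assms(2)]]
    dchar_1[OF assms(1)] by simp

lemma norm_dchar:
  assumes "dcharacter N \<chi>" "N > 0"
  shows "norm (\<chi> n) = of_bool (coprime n N)"
proof (cases "coprime n N")
  case True
  have "totient N > 0" using assms by simp
  moreover have "norm (\<chi> n) ^ totient N = 1"
    using dchar_power_totient[OF assms(1) True] by (simp flip: norm_power)
  ultimately have "norm (\<chi> n) = 1"
    using power_eq_1_iff by fastforce
  then show ?thesis using True by simp
qed (use dchar_eq_0_iff[OF assms(1)] in simp)

lemma dcharacter_principal: "N > 0 \<Longrightarrow> dcharacter N (principal N)"
  by (auto simp: dcharacter_def principal_def coprime_commute)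

lemma dcharacter_cnj: "dcharacter N \<chi> \<Longrightarrow> dcharacter N (\<lambda>n. cnj (\<chi> n))"
  by (auto simp: dcharacter_def)

lemma dcharacter_times: "dcharacter N \<chi> \<Longrightarrow> dcharacter N \<psi> \<Longrightarrow> dcharacter N (\<lambda>n. \<chi> n * \<psi> n)"
  by (auto simp: dcharacter_def)

lemma dchar_mult_cnj:
  assumes "dcharacter N \<chi>" "N > 0" "coprime n N"
  shows "\<chi> n * cnj (\<chi> n) = 1"
  using norm_dchar[OF assms(1,2), of n] assms(3) by (simp add: complex_norm_square[symmetric])

text \<open>A character is determined by its first \<open>N\<close> values, each of them 0 or a root
  of unity of order dividing the totient.\<close>

lemma finite_dcharacters:
  assumes "N > 0"
  shows "finite {\<chi>. dcharacter N \<chi>}"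
proof -
  define A where "A = insert 0 {z :: complex. z ^ totient N = 1}"
  have "finite A"
    unfolding A_def using assms by (simp add: finite_roots_unity Suc_le_eq)
  have "inj_on (\<lambda>\<chi>. map \<chi> [0..<N]) {\<chi>. dcharacter N \<chi>}"
  proof (rule inj_onI, rule ext)
    fix \<chi> \<psi> n assume *: "\<chi> \<in> {\<chi>. dcharacter N \<chi>}" "\<psi> \<in> {\<chi>. dcharacter N \<chi>}"
      "map \<chi> [0..<N] = map \<psi> [0..<N]"
    then have "\<chi> (n mod N) = \<psi> (n mod N)" using assms by simp
    then show "\<chi> n = \<psi> n" using * dchar_mod by (metis mem_Collect_eq)
  qed
  moreover have "(\<lambda>\<chi>. map \<chi> [0..<N]) ` {\<chi>. dcharacter N \<chi>} \<subseteq> {xs. set xs \<subseteq> A \<and> length xs = N}"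
    using dchar_power_totient dchar_eq_0_iff by (fastforce simp: A_def)
  ultimately show ?thesis
    using finite_lists_length_eq[OF \<open>finite A\<close>] by (meson finite_imageD finite_subset)
qed

text \<open>With a primitive root \<open>g\<close> modulo \<open>M\<close>, the class of g^i is sent
  to the i-th power of a root of unity \<omega> of exact order \<open>totient M\<close>. This map is
  injective on units modulo \<open>M\<close>, so it separates \<open>n\<close> from 1; since
  \<open>M\<close> divides \<open>N\<close>, setting it to 0 off the residues coprime to
  \<open>N\<close> gives a character modulo \<open>N\<close>.\<close>

lemma exists_dcharacter_mod_prime_power:
  assumes M: "M = p ^ k" "prime p" "odd p" "k > 0" and "M dvd N" "N > 0"
    and n: "coprime n N" "\<not> [n = 1] (mod M)"
  shows "\<exists>\<chi>. dcharacter N \<chi> \<and> \<chi> n \<noteq> 1"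
proof -
  obtain g where g: "residue_primroot M g"
    using residue_primroot_odd_prime_power_exists[of p] M by auto
  then have gM: "coprime M g" "ord M g = totient M" "M > 0" by (auto simp: residue_primroot_def)
  define \<phi> where "\<phi> = totient M"
  have "\<phi> > 0" using gM by (simp add: \<phi>_def)
  have gen: "\<exists>i. [x = g ^ i] (mod M)" if "coprime x N" for x
  proof -
    have "coprime x M" using coprime_divisors[OF dvd_refl assms(5) that] .
    have "M > 1" unfolding M(1) using M(2,4) by (intro one_less_power prime_gt_1_nat)
    have "x mod M \<in> totatives M"
      using \<open>coprime x M\<close> \<open>M > 1\<close> by (auto simp: totatives_def intro!: Nat.gr0I)
    then have "x mod M \<in> (\<lambda>i. g ^ i mod M) ` {..<totient M}"
      using residue_primroot_is_generator[OF \<open>M > 1\<close> g] by (simp add: bij_betw_def)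
    then obtain i where "x mod M = g ^ i mod M" by blast
    then show ?thesis by (auto simp: cong_def intro!: exI[of _ i])
  qed
  \<comment> \<open>The chosen index matters only modulo the order of \<open>g\<close>;
    \<open>eqI\<close> makes the powers of \<omega> independent of the choice.\<close>
  define ind where "ind x = (SOME i. [x = g ^ i] (mod M))" for x
  have ind: "[x = g ^ ind x] (mod M)" if "coprime x N" for x
    unfolding ind_def using gen[OF that] by (rule someI_ex)
  define \<omega> where "\<omega> = cis (2 * pi / real \<phi>)"
  have \<omega>: "\<omega> ^ \<phi> = 1" using \<open>\<phi> > 0\<close> by (simp add: \<omega>_def DeMoivre)
  have \<omega>mod: "\<omega> ^ i = \<omega> ^ (i mod \<phi>)" for i
    using \<omega> by (metis mult_div_mod_eq power_add power_mult power_one mult_1)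
  have \<omega>_1: "i mod \<phi> = 0" if "\<omega> ^ i = 1" for i
  proof -
    have inj: "inj_on (\<lambda>k. cis (2 * pi * real k / real \<phi>)) {..<\<phi>}"
      using bij_betw_roots_unity[OF \<open>\<phi> > 0\<close>] by (simp add: bij_betw_def)
    have "cis (2 * pi * real (i mod \<phi>) / real \<phi>) = \<omega> ^ (i mod \<phi>)"
      by (simp add: \<omega>_def DeMoivre mult.commute)
    then have "cis (2 * pi * real (i mod \<phi>) / real \<phi>) = cis (2 * pi * real 0 / real \<phi>)"
      using that \<omega>mod[of i] by simp
    from inj_onD[OF inj this] show ?thesis using \<open>\<phi> > 0\<close> by simp
  qed
  have eqI: "\<omega> ^ i = \<omega> ^ j" if "[g ^ i = g ^ j] (mod M)" for i j
  proof -
    have "[i = j] (mod \<phi>)"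
      using that gM order_divides_expdiff[of M g i j] by (simp add: \<phi>_def coprime_commute)
    then show ?thesis using \<omega>mod[of i] \<omega>mod[of j] by (simp add: cong_def)
  qed
  define \<chi> where "\<chi> x = (if coprime x N then \<omega> ^ ind x else 0)" for x
  have "dcharacter N \<chi>"
    unfolding dcharacter_def
  proof (intro conjI allI)
    fix x y
    show "\<chi> (x * y) = \<chi> x * \<chi> y"
    proof (cases "coprime x N \<and> coprime y N")
      case True
      have "[x * y = g ^ ind x * g ^ ind y] (mod M)"
        using True by (intro cong_mult ind) auto
      moreover have "[x * y = g ^ ind (x * y)] (mod M)"
        using True by (intro ind) auto
      ultimately have "[g ^ ind (x * y) = g ^ (ind x + ind y)] (mod M)"
        unfolding power_add by (metis cong_sym cong_trans)
      then have "\<omega> ^ ind (x * y) = \<omega> ^ (ind x + ind y)" by (rule eqI)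
      then show ?thesis using True by (simp add: \<chi>_def power_add)
    qed (auto simp: \<chi>_def)
    show "\<chi> (x mod N) = \<chi> x"
    proof (cases "coprime x N")
      case True
      have "[x mod N = x] (mod M)"
        using \<open>M dvd N\<close> by (simp add: cong_def mod_mod_cancel)
      moreover have "[x mod N = g ^ ind (x mod N)] (mod M)" "[x = g ^ ind x] (mod M)"
        using True \<open>N > 0\<close> by (auto intro!: ind)
      ultimately have "[g ^ ind (x mod N) = g ^ ind x] (mod M)"
        by (metis cong_sym cong_trans)
      then have "\<omega> ^ ind (x mod N) = \<omega> ^ ind x" by (rule eqI)
      then show ?thesis using True \<open>N > 0\<close> by (simp add: \<chi>_def)
    qed (use \<open>N > 0\<close> in \<open>auto simp: \<chi>_def\<close>)
    show "\<chi> x = 0 \<longleftrightarrow> \<not> coprime x N"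
      by (auto simp: \<chi>_def \<omega>_def)
  qed
  moreover have "\<chi> n \<noteq> 1"
  proof
    assume "\<chi> n = 1"
    then have "ind n mod \<phi> = 0" using n \<omega>_1 by (simp add: \<chi>_def)
    then have "[ind n = 0] (mod ord M g)" using gM by (simp add: \<phi>_def cong_def)
    then have "[g ^ ind n = g ^ 0] (mod M)"
      using gM order_divides_expdiff[of M g "ind n" 0] by (simp add: coprime_commute)
    then have "[n = 1] (mod M)" using ind[OF n(1)] cong_trans by fastforce
    then show False using n by simp
  qed
  ultimately show ?thesis by blast
qed

text \<open>Some full prime power \<open>p ^ k\<close> of \<open>N\<close> does not divide
  \<open>n - 1\<close>, and \<open>p\<close> is odd because \<open>N\<close> is.\<close>

lemma exists_dcharacter_neq_1:
  assumes "odd N" "coprime n N" "\<not> [n = 1] (mod N)"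
  shows "\<exists>\<chi>. dcharacter N \<chi> \<and> \<chi> n \<noteq> 1"
proof -
  have "N > 0" using assms by (auto intro: Nat.gr0I)
  have "n > 0"
    using assms by (auto intro!: Nat.gr0I)
  define m where "m = n - 1"
  have m: "n = m + 1" using \<open>n > 0\<close> by (simp add: m_def)
  have cong_iff: "[n = 1] (mod M) \<longleftrightarrow> M dvd m" for M
    unfolding m using cong_add_rcancel_0_nat[of m 1 M] by (simp add: cong_0_iff)
  then have "\<not> N dvd m" using assms by simp
  then have "m \<noteq> 0" by (intro notI) simp
  have "\<exists>p. prime p \<and> multiplicity p m < multiplicity p N"
  proof (rule ccontr)
    assume "\<not> ?thesis"
    then have "N dvd m"
      using \<open>N > 0\<close> by (intro multiplicity_le_imp_dvd) (auto simp: not_less)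
    then show False using \<open>\<not> N dvd m\<close> by simp
  qed
  then obtain p where p: "prime p" "multiplicity p m < multiplicity p N" by blast
  define k where "k = multiplicity p N"
  have "\<not> p ^ k dvd m"
  proof
    assume "p ^ k dvd m"
    then have "k \<le> multiplicity p m"
      using \<open>m \<noteq> 0\<close> p(1) by (intro multiplicity_geI) auto
    then show False using p by (simp add: k_def)
  qed
  then have "\<not> [n = 1] (mod p ^ k)" using cong_iff by simp
  have "p ^ k dvd N" by (simp add: k_def multiplicity_dvd)
  have "k > 0" using p by (simp add: k_def)
  have "p dvd N"
    using p not_dvd_imp_multiplicity_0[of p N] by (cases "p dvd N") auto
  then have "odd p" using assms(1) dvd_trans by blast
  show ?thesis
    using exists_dcharacter_mod_prime_power[OF refl p(1) \<open>odd p\<close> \<open>k > 0\<close> \<open>p ^ k dvd N\<close> \<open>N > 0\<close>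
        assms(2) \<open>\<not> [n = 1] (mod p ^ k)\<close>] .
qed

text \<open>A character that is not 1 at \<open>n\<close> permutes all characters by multiplication,
  with its conjugate as inverse. The sum is thus a multiple of itself by a factor different from
  1.\<close>

lemma sum_dcharacters:
  assumes "odd N" "coprime n N"
  shows "(\<Sum>\<chi> | dcharacter N \<chi>. \<chi> n) = (if [n = 1] (mod N) then of_nat (card {\<chi>. dcharacter N \<chi>}) else 0)"
proof (cases "[n = 1] (mod N)")
  case True
  then have "(\<Sum>\<chi> | dcharacter N \<chi>. \<chi> n) = (\<Sum>\<chi> | dcharacter N \<chi>. 1)"
    by (intro sum.cong refl) (use dchar_cong dchar_1 in fastforce)
  then show ?thesis using True by simp
next
  case False
  have N: "N > 0" using assms by (auto intro: Nat.gr0I)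
  obtain \<psi> where \<psi>: "dcharacter N \<psi>" "\<psi> n \<noteq> 1"
    using exists_dcharacter_neq_1[OF assms False] by blast
  have inv: "(\<lambda>m. cnj (\<psi> m) * (\<psi> m * \<chi> m)) = \<chi>" "(\<lambda>m. \<psi> m * (cnj (\<psi> m) * \<chi> m)) = \<chi>"
    if "dcharacter N \<chi>" for \<chi>
  proof -
    have e: "cnj (\<psi> m) * (\<psi> m * \<chi> m) = \<chi> m" for m
      using dchar_mult_cnj[OF \<psi>(1) N, of m] dchar_eq_0_iff[OF that, of m]
      by (cases "coprime m N") (auto simp: mult_ac simp flip: mult.assoc)
    show "(\<lambda>m. cnj (\<psi> m) * (\<psi> m * \<chi> m)) = \<chi>" by (simp only: e)
    have "\<psi> m * (cnj (\<psi> m) * \<chi> m) = \<chi> m" for m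
      using e[of m] by (subst mult.left_commute)
    then show "(\<lambda>m. \<psi> m * (cnj (\<psi> m) * \<chi> m)) = \<chi>" by (simp only:)
  qed
  have "(\<Sum>\<chi> | dcharacter N \<chi>. \<chi> n) = (\<Sum>\<chi> | dcharacter N \<chi>. \<psi> n * \<chi> n)"
    by (rule sum.reindex_bij_witness[of _ "\<lambda>\<chi> m. \<psi> m * \<chi> m" "\<lambda>\<chi> m. cnj (\<psi> m) * \<chi> m"])
       (use \<psi>(1) inv fun_cong[OF inv(2)] in \<open>auto intro!: dcharacter_times dcharacter_cnj\<close>)
  also have "\<dots> = \<psi> n * (\<Sum>\<chi> | dcharacter N \<chi>. \<chi> n)" by (simp add: sum_distrib_left)
  finally show ?thesis using \<psi>(2) False by simp
qed

text \<open>The conjugate of the value at \<open>a\<close> is the value at an inverse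
  \<open>b\<close> of \<open>a\<close>, which reduces the claim to the sum at
  \<open>n * b\<close>.\<close>

lemma dcharacter_orthogonality:
  assumes "odd N" "coprime a N"
  shows "(\<Sum>\<chi> | dcharacter N \<chi>. \<chi> n * cnj (\<chi> a)) =
           (if [n = a] (mod N) then of_nat (card {\<chi>. dcharacter N \<chi>}) else 0)"
proof (cases "coprime n N")
  case True
  have N: "N > 0" using assms by (auto intro: Nat.gr0I)
  obtain b where b: "[a * b = 1] (mod N)"
    using cong_solve_coprime_nat[OF assms(2)] by auto
  then have "coprime (a * b) N"
    using cong_imp_coprime[OF cong_sym[OF b]] by simp
  then have "coprime b N" by simp
  have "cnj (\<chi> a) = \<chi> b" if "dcharacter N \<chi>" for \<chi>
  proof -
    have "\<chi> a * \<chi> b = 1"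
      using dchar_cong[OF that b] dchar_mult[OF that, of a b] dchar_1[OF that] by simp
    moreover have "\<chi> a * cnj (\<chi> a) = 1" using that N assms(2) by (rule dchar_mult_cnj)
    ultimately have "\<chi> a * cnj (\<chi> a) = \<chi> a * \<chi> b" by simp
    moreover have "\<chi> a \<noteq> 0" using dchar_eq_0_iff[OF that] assms(2) by simp
    ultimately show ?thesis by simp
  qed
  then have "(\<Sum>\<chi> | dcharacter N \<chi>. \<chi> n * cnj (\<chi> a)) = (\<Sum>\<chi> | dcharacter N \<chi>. \<chi> (n * b))"
    by (intro sum.cong refl) (simp add: dchar_mult)
  also have "\<dots> = (if [n * b = 1] (mod N) then of_nat (card {\<chi>. dcharacter N \<chi>}) else 0)"
    using True \<open>coprime b N\<close> assms(1) by (intro sum_dcharacters) auto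
  also have "[n * b = 1] (mod N) \<longleftrightarrow> [n * b = a * b] (mod N)"
    using b by (metis cong_sym cong_trans)
  also have "\<dots> \<longleftrightarrow> [n = a] (mod N)"
    using \<open>coprime b N\<close> by (rule cong_mult_rcancel_nat)
  finally show ?thesis .
next
  case False
  then have "\<not> [n = a] (mod N)" using assms(2) cong_imp_coprime[of a n N] cong_sym[of n a N] by blast
  moreover have "(\<Sum>\<chi> | dcharacter N \<chi>. \<chi> n * cnj (\<chi> a)) = 0"
    using False by (intro sum.neutral) (auto simp: dchar_eq_0_iff)
  ultimately show ?thesis by simp
qed

lemma sum_dchar_period:
  assumes "dcharacter N \<chi>" "N > 0" "\<chi> \<noteq> principal N"
  shows "(\<Sum>n<N. \<chi> n) = 0"
proof -
  obtain a where a: "\<chi> a \<noteq> principal N a" using assms(3) by auto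
  then have cop: "coprime a N" and "\<chi> a \<noteq> 1"
    using dchar_eq_0_iff[OF assms(1), of a] by (auto simp: principal_def split: if_splits)
  have inj: "inj_on (\<lambda>n. a * n mod N) {..<N}"
  proof (rule inj_onI)
    fix m n assume mn: "m \<in> {..<N}" "n \<in> {..<N}" "a * m mod N = a * n mod N"
    then have "[m = n] (mod N)" using cop by (simp add: cong_mult_lcancel_nat flip: cong_def)
    then show "m = n" using mn by (simp add: cong_def)
  qed
  have "(\<lambda>n. a * n mod N) ` {..<N} = {..<N}"
    using \<open>N > 0\<close> by (intro card_subset_eq) (auto simp: card_image[OF inj])
  then have "(\<Sum>n<N. \<chi> n) = (\<Sum>n\<in>(\<lambda>n. a * n mod N) ` {..<N}. \<chi> n)" by simp
  also have "\<dots> = (\<Sum>n<N. \<chi> a * \<chi> n)"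
    using inj by (simp add: sum.reindex dchar_mod[OF assms(1)] dchar_mult[OF assms(1)])
  also have "\<dots> = \<chi> a * (\<Sum>n<N. \<chi> n)" by (simp add: sum_distrib_left)
  finally show ?thesis using \<open>\<chi> a \<noteq> 1\<close> by simp
qed

text \<open>Full periods cancel, and fewer than \<open>N\<close> terms of norm at most 1
  remain.\<close>

lemma norm_sum_dchar_le:
  assumes "dcharacter N \<chi>" "N > 0" "\<chi> \<noteq> principal N"
  shows "norm (\<Sum>n<k. \<chi> n) \<le> real N"
proof (induction k rule: less_induct)
  case (less k)
  show ?case
  proof (cases "k < N")
    case True
    have "norm (\<Sum>n<k. \<chi> n) \<le> (\<Sum>n<k. 1)"
      using norm_dchar[OF assms(1,2)] by (intro sum_norm_le) simp
    then show ?thesis using True by simp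
  next
    case False
    have "(\<Sum>n<k. \<chi> n) = (\<Sum>n<N. \<chi> n) + (\<Sum>n\<in>{N..<k}. \<chi> n)"
      using False by (subst sum.union_disjoint[symmetric]) (auto intro!: sum.cong)
    also have "(\<Sum>n\<in>{N..<k}. \<chi> n) = (\<Sum>n<k - N. \<chi> (n + N))"
      using False by (intro sum.reindex_bij_witness[of _ "\<lambda>n. n + N" "\<lambda>n. n - N"]) auto
    also have "\<dots> = (\<Sum>n<k - N. \<chi> n)"
      by (intro sum.cong refl dchar_cong[OF assms(1)]) (simp add: cong_def)
    finally show ?thesis
      using less.IH[of "k - N"] False assms(2) sum_dchar_period[OF assms] by simp
  qed
qed

section \<open>Summation against antitone weights\<close>

lemma norm_sum_antitone_le:
  fixes a :: "nat \<Rightarrow> complex" and f :: "nat \<Rightarrow> real"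
  assumes B: "\<And>k. norm (\<Sum>n<k. a n) \<le> B"
    and anti: "\<And>n. m \<le> n \<Longrightarrow> f (Suc n) \<le> f n" and nonneg: "\<And>n. m \<le> n \<Longrightarrow> 0 \<le> f n"
  shows "norm (\<Sum>n=m..<k. a n * of_real (f n)) \<le> 2 * B * f m"
proof (cases "m \<le> k")
  case True
  define T where "T k = (\<Sum>n<k. a n)" for k
  \<comment> \<open>Abel summation. Its three parts are bounded by \<open>B * f k\<close>,
    \<open>B * f m\<close> and \<open>B * (f m - f k)\<close>, which add up to
    \<open>2 * B * f m\<close>.\<close>
  have parts: "(\<Sum>n=m..<k. a n * of_real (f n)) =
      T k * of_real (f k) - T m * of_real (f m) + (\<Sum>n=m..<k. T (Suc n) * of_real (f n - f (Suc n)))"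
    using True by (induction k rule: dec_induct) (simp_all add: T_def algebra_simps)
  have tel: "(\<Sum>n=m..<k. f n - f (Suc n)) = f m - f k"
    using sum_Suc_diff'[OF True, of "\<lambda>n. - f n"] by simp
  have T: "norm (T k) \<le> B" for k using B by (simp add: T_def)
  have 1: "norm (T k * of_real (f k)) \<le> B * f k" if "m \<le> k" for k
    using T[of k] nonneg[OF that] by (simp add: norm_mult mult_right_mono)
  have "norm (\<Sum>n=m..<k. T (Suc n) * of_real (f n - f (Suc n))) \<le> (\<Sum>n=m..<k. B * (f n - f (Suc n)))"
  proof (rule sum_norm_le)
    fix n assume "n \<in> {m..<k}"
    then have "0 \<le> f n - f (Suc n)" using anti by simp
    then show "norm (T (Suc n) * of_real (f n - f (Suc n))) \<le> B * (f n - f (Suc n))"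
      using T[of "Suc n"] by (simp only: norm_mult norm_of_real abs_of_nonneg mult_right_mono)
  qed
  also have "\<dots> = B * (f m - f k)" by (simp only: sum_distrib_left[symmetric] tel)
  finally have 2: "norm (\<Sum>n=m..<k. T (Suc n) * of_real (f n - f (Suc n))) \<le> B * (f m - f k)" .
  have "norm (\<Sum>n=m..<k. a n * of_real (f n)) \<le> B * f k + B * f m + B * (f m - f k)"
    unfolding parts by (intro norm_triangle_mono norm_triangle_le_diff add_mono 1 2 order.refl True order.trans[OF norm_triangle_ineq4])
  then show ?thesis by (simp add: algebra_simps)
next
  case False
  have "0 \<le> B" using order.trans[OF norm_ge_zero B] .
  then show ?thesis using False nonneg[of m] by simp
qed

text \<open>The tail bound gives the Cauchy property and, in the limit, an explicit rate, which the
  later error estimates rely on. The start \<open>l\<close> excludes index 0, where the weight 1/n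
  has the default value 0 and antitonicity fails.\<close>

lemma antitone_sum_converges:
  fixes a :: "nat \<Rightarrow> complex" and f :: "nat \<Rightarrow> real"
  assumes B: "\<And>k. norm (\<Sum>n<k. a n) \<le> B"
    and anti: "\<And>m n. l \<le> m \<Longrightarrow> m \<le> n \<Longrightarrow> f n \<le> f m" and lim: "f \<longlonglongrightarrow> 0"
  shows "\<exists>L. \<forall>k\<ge>l. norm ((\<Sum>n<k. a n * of_real (f n)) - L) \<le> 2 * B * f k"
proof -
  define s where "s k = (\<Sum>n<k. a n * of_real (f n))" for k
  have "0 \<le> B" using order.trans[OF norm_ge_zero B] .
  have nonneg: "0 \<le> f m" if "l \<le> m" for m
    using lim by (rule LIMSEQ_le_const2) (use anti[OF that] in blast)
  have diff: "norm (s j - s k) \<le> 2 * B * f k" if "l \<le> k" "k \<le> j" for j k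
  proof -
    have "s j = s k + (\<Sum>n=k..<j. a n * of_real (f n))"
      unfolding s_def using that by (simp add: sum.atLeastLessThan_concat lessThan_atLeast0)
    then have "s j - s k = (\<Sum>n=k..<j. a n * of_real (f n))" by simp
    then show ?thesis
      using that nonneg by (simp only:) (intro norm_sum_antitone_le B anti; simp)
  qed
  have "Cauchy s"
  proof (rule metric_CauchyI)
    fix e :: real assume "e > 0"
    have "(\<lambda>n. 2 * B * f n) \<longlonglongrightarrow> 2 * B * 0" by (intro tendsto_intros lim)
    then have "\<forall>\<^sub>F n in sequentially. 2 * B * f n < e / 2"
      using \<open>e > 0\<close> by (intro order_tendstoD) auto
    then obtain M where M: "\<And>n. M \<le> n \<Longrightarrow> 2 * B * f n < e / 2"
      by (auto simp: eventually_sequentially)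
    define K where "K = max M l"
    have K: "dist (s n) (s K) < e / 2" if "K \<le> n" for n
      using diff[of K n] M[of K] that by (simp add: K_def dist_norm)
    show "\<exists>M. \<forall>m\<ge>M. \<forall>n\<ge>M. dist (s m) (s n) < e"
    proof (intro exI[of _ K] allI impI)
      fix m n assume "K \<le> m" "K \<le> n"
      then show "dist (s m) (s n) < e"
        using K[of m] K[of n] dist_triangle_half_l by blast
    qed
  qed
  then obtain L where L: "s \<longlonglongrightarrow> L" by (auto simp: Cauchy_convergent_iff convergent_def)
  have "norm (s k - L) \<le> 2 * B * f k" if "l \<le> k" for k
  proof -
    have "(\<lambda>j. norm (s j - s k)) \<longlonglongrightarrow> norm (L - s k)" by (intro tendsto_intros L)
    then have "norm (L - s k) \<le> 2 * B * f k"
      by (rule LIMSEQ_le_const2) (use diff[OF that] in blast)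
    then show ?thesis by (simp add: norm_minus_commute)
  qed
  then show ?thesis unfolding s_def by blast
qed

section \<open>Moebius function\<close>

definition moebius :: "nat \<Rightarrow> real"
  where "moebius n = (if squarefree n then (- 1) ^ card (prime_factors n) else 0)"

lemma abs_moebius_le: "\<bar>moebius n\<bar> \<le> 1"
  by (simp add: moebius_def power_abs)

lemma moebius_prime_times:
  assumes "prime p" "\<not> p dvd d" "d > 0"
  shows "moebius (p * d) = - moebius d"
proof -
  have "coprime p d" using assms by (simp add: prime_imp_coprime)
  then have "squarefree (p * d) \<longleftrightarrow> squarefree d"
    using assms(1)
    by (auto simp: squarefree_prime intro: squarefree_mult_coprime squarefree_mono[of d "p * d"])
  moreover have "prime_factors (p * d) = insert p (prime_factors d)"
    using assms by (subst prime_factors_product) (auto simp: prime_prime_factors)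
  moreover have "p \<notin> prime_factors d" using assms by auto
  ultimately show ?thesis by (simp add: moebius_def)
qed

text \<open>Inserting or removing a fixed prime divisor of \<open>n\<close> is an involution on the
  squarefree divisors that changes the sign of \<open>moebius\<close>.\<close>

lemma sum_moebius_divisors:
  assumes "n > 0"
  shows "(\<Sum>d | d dvd n. moebius d) = of_bool (n = 1)"
proof (cases "n = 1")
  case False
  then obtain p where p: "prime p" "p dvd n" using prime_factor_nat by blast
  have p0: "p > 0" using p by (simp add: prime_gt_0_nat)
  define h where "h d = (if p dvd d then d div p else p * d)" for d
  define D where "D = {d. d dvd n \<and> squarefree d}"
  have pos: "d > 0" if "d \<in> D" for d using that by (auto simp: D_def intro!: Nat.gr0I)
  have ndvd: "\<not> p dvd d div p" if "d \<in> D" "p dvd d" for d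
  proof
    assume "p dvd d div p"
    then have "p\<^sup>2 dvd d" using that(2) p0 by (auto elim!: dvdE simp: power2_eq_square)
    then have "is_unit p" using that(1) by (auto simp: D_def squarefree_def)
    then show False using p by auto
  qed
  have hD: "h d \<in> D" if "d \<in> D" for d
  proof (cases "p dvd d")
    case True
    then obtain e where e: "d = p * e" by blast
    have "e dvd n" "squarefree e"
      using that e by (auto simp: D_def dest: dvd_mult_right intro: squarefree_mono[of _ d])
    then show ?thesis using True e p0 by (simp add: D_def h_def)
  next
    case False
    then have "coprime p d" using p by (simp add: prime_imp_coprime)
    then have "p * d dvd n" "squarefree (p * d)"
      using that p by (auto simp: D_def divides_mult squarefree_mult_coprime squarefree_prime)
    then show ?thesis using False by (simp add: D_def h_def)
  qed
  have hh: "h (h d) = d" if "d \<in> D" for d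
    using ndvd[OF that] p0 by (cases "p dvd d") (auto simp: h_def)
  have moebius_h: "moebius (h d) = - moebius d" if "d \<in> D" for d
  proof (cases "p dvd d")
    case True
    then have "moebius (p * (d div p)) = - moebius (d div p)"
      using ndvd[OF that True] pos[OF that] p(1) by (intro moebius_prime_times) (auto elim!: dvdE)
    then show ?thesis using True by (simp add: h_def)
  next
    case False
    then show ?thesis using moebius_prime_times[OF p(1) False pos[OF that]] by (simp add: h_def)
  qed
  have "(\<Sum>d | d dvd n. moebius d) = (\<Sum>d\<in>D. moebius d)"
    using assms by (intro sum.mono_neutral_right) (auto simp: D_def moebius_def)
  also have "(\<Sum>d\<in>D. moebius d) = (\<Sum>d\<in>D. - moebius d)"
    by (rule sum.reindex_bij_witness[of _ h h]) (auto simp: hD hh moebius_h)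
  then have "(\<Sum>d\<in>D. moebius d) = 0" by (simp add: sum_negf)
  finally show ?thesis using False by simp
qed (simp add: moebius_def)

text \<open>Expand ln(n/d) as a sum of \<Lambda>(e) over the divisors e of n/d and exchange the
  sums; the inner sum of \<open>moebius\<close> over the divisors of n/e leaves only e = n.\<close>

lemma sum_moebius_ln:
  assumes "n > 0"
  shows "(\<Sum>d | d dvd n. moebius d * ln (real n / real d)) = \<Lambda> n"
proof -
  have "(\<Sum>d | d dvd n. moebius d * ln (real n / real d)) = (\<Sum>d | d dvd n. \<Sum>e | e dvd n div d. moebius d * \<Lambda> e)"
  proof (rule sum.cong[OF refl])
    fix d assume d: "d \<in> {d. d dvd n}"
    then have "n div d \<noteq> 0" using assms by (auto elim!: dvdE)
    then have "ln (real (n div d)) = (\<Sum>e | e dvd n div d. \<Lambda> e)"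
      using mangoldt_sum[of "n div d", where 'a = real] by simp
    moreover have "real (n div d) = real n / real d" using d by (simp add: real_of_nat_div)
    ultimately show "moebius d * ln (real n / real d) = (\<Sum>e | e dvd n div d. moebius d * \<Lambda> e)"
      by (simp add: sum_distrib_left)
  qed
  also have "\<dots> = (\<Sum>(d, e)\<in>(SIGMA d:{d. d dvd n}. {e. e dvd n div d}). moebius d * \<Lambda> e)"
    using assms by (intro sum.Sigma) (auto elim!: dvdE)
  also have "\<dots> = (\<Sum>(e, d)\<in>(SIGMA e:{e. e dvd n}. {d. d dvd n div e}). moebius d * \<Lambda> e)"
  proof -
    have "e dvd n \<and> d dvd n div e" if "d dvd n" "e dvd n div d" for d e
    proof -
      have "d \<noteq> 0" "e \<noteq> 0" using that assms by (auto elim!: dvdE)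
      then have "e * d dvd n" using that by (simp add: dvd_div_iff_mult)
      moreover from this have "e dvd n" by (rule dvd_mult_left)
      ultimately show ?thesis using \<open>e \<noteq> 0\<close> by (simp add: dvd_div_iff_mult mult.commute)
    qed
    then show ?thesis
      by (intro sum.reindex_bij_witness[of _ "\<lambda>(e, d). (d, e)" "\<lambda>(d, e). (e, d)"]) auto
  qed
  also have "\<dots> = (\<Sum>e | e dvd n. \<Sum>d | d dvd n div e. moebius d * \<Lambda> e)"
    using assms by (intro sum.Sigma[symmetric]) (auto elim!: dvdE)
  also have "\<dots> = (\<Sum>e | e dvd n. \<Lambda> e * of_bool (n div e = 1))"
  proof (rule sum.cong[OF refl])
    fix e assume "e \<in> {e. e dvd n}"
    then have "n div e > 0" using assms by (auto elim!: dvdE)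
    then show "(\<Sum>d | d dvd n div e. moebius d * \<Lambda> e) = \<Lambda> e * of_bool (n div e = 1)"
      by (simp add: sum_moebius_divisors flip: sum_distrib_right)
  qed
  also have "\<dots> = (\<Sum>e\<in>{n}. \<Lambda> e * of_bool (n div e = 1))"
    using assms by (intro sum.mono_neutral_right) (auto elim!: dvdE)
  finally show ?thesis using assms by simp
qed

section \<open>Prime sums twisted by a nonprincipal character\<close>

definition twisted_sum :: "(nat \<Rightarrow> complex) \<Rightarrow> nat \<Rightarrow> complex"
  where "twisted_sum \<chi> x = (\<Sum>n=1..x. \<chi> n * of_real (\<Lambda> n / real n))"

definition partial_L :: "(nat \<Rightarrow> complex) \<Rightarrow> nat \<Rightarrow> complex"
  where "partial_L \<chi> x = (\<Sum>n=1..x. \<chi> n * of_real (1 / real n))"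

lemma sum_lessThan_Suc_drop_0: "f 0 = (0::'a::comm_monoid_add) \<Longrightarrow> (\<Sum>n<Suc x. f n) = (\<Sum>n=1..x. f n)"
  by (rule sum.mono_neutral_right) (auto simp: not_less_eq_eq)

text \<open>Converts the convergence rate at \<open>x div d\<close> into the factor d/x, whose
  numerator cancels the weight 1/d in the convolution sums.\<close>

lemma inverse_le_div: "1 / (real (x div d) + 1) \<le> real d / real x" if "d \<in> {1..x}" for d x :: nat
proof -
  have d: "1 \<le> d" "0 < x" using that by auto
  have "x < (x div d + 1) * d" using d dividend_less_div_times[of d x] by simp
  then have "real x \<le> real ((x div d + 1) * d)" by (simp only: of_nat_le_iff less_imp_le)
  then show ?thesis using d by (simp add: field_simps)
qed

locale nonprincipal =
  fixes N :: nat and \<chi> :: "nat \<Rightarrow> complex"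
  assumes char: "dcharacter N \<chi>" and N: "N > 0" and nonprincipal: "\<chi> \<noteq> principal N"
begin

lemma norm_le_1: "norm (\<chi> n) \<le> 1"
  using norm_dchar[OF char N, of n] by simp

lemma partial_L_converges:
  "\<exists>L. \<forall>x. norm (partial_L \<chi> x - L) \<le> 2 * real N / (real x + 1)"
proof -
  have "\<exists>L. \<forall>k\<ge>1. norm ((\<Sum>n<k. \<chi> n * of_real (1 / real n)) - L) \<le> 2 * real N * (1 / real k)"
    using norm_sum_dchar_le[OF char N nonprincipal] lim_1_over_n[where 'a = real]
    by (intro antitone_sum_converges) (auto simp: frac_le)
  then obtain L where L: "\<And>k. k \<ge> 1 \<Longrightarrow> norm ((\<Sum>n<k. \<chi> n * of_real (1 / real n)) - L) \<le> 2 * real N * (1 / real k)"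
    by blast
  have "(\<Sum>n<Suc x. \<chi> n * of_real (1 / real n)) = partial_L \<chi> x" for x
    unfolding partial_L_def by (rule sum_lessThan_Suc_drop_0) simp
  then have "norm (partial_L \<chi> x - L) \<le> 2 * real N / (real x + 1)" for x
    using L[of "Suc x"] by (simp add: add.commute)
  then show ?thesis by blast
qed

definition "L = (SOME L. \<forall>x. norm (partial_L \<chi> x - L) \<le> 2 * real N / (real x + 1))"

lemma L: "norm (partial_L \<chi> x - L) \<le> 2 * real N / (real x + 1)"
  using someI_ex[OF partial_L_converges] unfolding L_def by blast

text \<open>
  Used with $w = \Lambda$, whose divisor sum is $\ln n$, and with $w(d) = \mu(d) \ln (x/d)$, whose
  divisor sum is $\Lambda(n)$, plus $\ln x$ for $n = 1$.
\<close>

lemma weighted_L_error: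
  assumes "x > 0" "\<And>d. d \<in> {1..x} \<Longrightarrow> \<bar>w d\<bar> \<le> v d"
  shows "norm ((\<Sum>d=1..x. \<chi> d * of_real (w d / real d) * partial_L \<chi> (x div d)) -
      L * (\<Sum>d=1..x. \<chi> d * of_real (w d / real d))) \<le> 2 * real N / real x * (\<Sum>d=1..x. v d)"
proof -
  have "(\<Sum>d=1..x. \<chi> d * of_real (w d / real d) * partial_L \<chi> (x div d)) -
      L * (\<Sum>d=1..x. \<chi> d * of_real (w d / real d)) =
      (\<Sum>d=1..x. \<chi> d * of_real (w d / real d) * (partial_L \<chi> (x div d) - L))"
    unfolding sum_distrib_left sum_subtractf[symmetric]
    by (simp only: right_diff_distrib mult.commute[of L])
  also have "norm \<dots> \<le> (\<Sum>d=1..x. 2 * real N / real x * v d)"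
  proof (rule sum_norm_le)
    fix d assume d: "d \<in> {1..x}"
    have "norm (partial_L \<chi> (x div d) - L) \<le> 2 * real N * (1 / (real (x div d) + 1))"
      using L[of "x div d"] by simp
    also have "\<dots> \<le> 2 * real N * (real d / real x)"
      using inverse_le_div[OF d] by (intro mult_left_mono) auto
    finally have 1: "norm (partial_L \<chi> (x div d) - L) \<le> 2 * real N * (real d / real x)" .
    have "norm (\<chi> d * of_real (w d / real d)) = norm (\<chi> d) * (\<bar>w d\<bar> / real d)"
      by (simp add: norm_mult norm_divide)
    also have "\<dots> \<le> 1 * (v d / real d)"
      using norm_le_1[of d] assms(2)[OF d] by (intro mult_mono divide_right_mono) auto
    finally have 2: "norm (\<chi> d * of_real (w d / real d)) \<le> v d / real d" by simp
    have "0 \<le> v d" using assms(2)[OF d] by linarith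
    then have "norm (\<chi> d * of_real (w d / real d)) * norm (partial_L \<chi> (x div d) - L) \<le>
        v d / real d * (2 * real N * (real d / real x))"
      by (intro mult_mono 1 2) auto
    also have "\<dots> = 2 * real N / real x * v d" using d by simp
    finally show "norm (\<chi> d * of_real (w d / real d) * (partial_L \<chi> (x div d) - L)) \<le>
        2 * real N / real x * v d" by (simp only: norm_mult)
  qed
  finally show ?thesis by (simp only: sum_distrib_left)
qed

text \<open>By complete multiplicativity the terms with d m = n share the factor \<chi>(n)/n, so
  that only the divisor sum of \<open>w\<close> remains.\<close>

lemma convolution:
  assumes "\<And>n. n \<in> {1..x} \<Longrightarrow> (\<Sum>d | d dvd n. w d) = W n"
  shows "(\<Sum>d=1..x. \<chi> d * of_real (w d / real d) * partial_L \<chi> (x div d)) =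
           (\<Sum>n=1..x. \<chi> n * of_real (W n / real n))"
proof -
  have "(\<Sum>d=1..x. \<chi> d * of_real (w d / real d) * partial_L \<chi> (x div d)) =
      (\<Sum>d=1..x. \<Sum>m=1..x div d. \<chi> (d * m) * of_real (w d / real (d * m)))"
    unfolding partial_L_def sum_distrib_left by (simp add: dchar_mult[OF char] mult_ac)
  also have "\<dots> = (\<Sum>n=1..x. \<Sum>d | d dvd n. \<chi> (d * (n div d)) * of_real (w d / real (d * (n div d))))"
    by (rule sum_divisors_hyperbola[symmetric])
  also have "\<dots> = (\<Sum>n=1..x. \<chi> n * of_real (W n / real n))"
  proof (rule sum.cong[OF refl])
    fix n assume n: "n \<in> {1..x}"
    have "(\<Sum>d | d dvd n. \<chi> (d * (n div d)) * of_real (w d / real (d * (n div d)))) =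
        (\<Sum>d | d dvd n. \<chi> n * of_real (w d / real n))"
      by (intro sum.cong refl) auto
    also have "\<dots> = \<chi> n * of_real ((\<Sum>d | d dvd n. w d) / real n)"
      by (simp add: sum_distrib_left sum_divide_distrib)
    finally show "(\<Sum>d | d dvd n. \<chi> (d * (n div d)) * of_real (w d / real (d * (n div d)))) =
        \<chi> n * of_real (W n / real n)" using assms[OF n] by simp
  qed
  finally show ?thesis .
qed

text \<open>The weight ln n / n decreases from n = 3 > e on, so Abel summation starts there and the
  first three terms are bounded separately.\<close>

lemma ln_weighted_bounded:
  "\<exists>C. \<forall>x. norm (\<Sum>n=1..x. \<chi> n * of_real (ln (real n) / real n)) \<le> C"
proof -
  let ?f = "\<lambda>n. ln (real n) / real n"
  have anti: "?f (Suc n) \<le> ?f n" if "3 \<le> n" for n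
  proof -
    have n: "0 < real n" using that by simp
    have "1 \<le> ln (3::real)" using exp_le by (simp add: ln_ge_iff)
    also have "\<dots> \<le> ln (real n)" using that by simp
    finally have 1: "1 \<le> ln (real n)" .
    have "real (Suc n) = real n * (1 + 1 / real n)"
      using n by (simp add: field_simps)
    then have "ln (real (Suc n)) = ln (real n * (1 + 1 / real n))" by (simp only:)
    also have "\<dots> = ln (real n) + ln (1 + 1 / real n)"
      using n by (intro ln_mult_pos) (auto intro: add_pos_pos)
    also have "\<dots> \<le> ln (real n) + 1 / real n"
      using n by (intro add_left_mono ln_add_one_self_le_self) auto
    finally have "real n * ln (real (Suc n)) \<le> real n * (ln (real n) + 1 / real n)"
      using n by (intro mult_left_mono) auto
    also have "\<dots> \<le> real (Suc n) * ln (real n)" using n 1 by (simp add: algebra_simps)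
    finally show ?thesis using n by (simp add: field_simps)
  qed
  define g where "g n = \<chi> n * of_real (?f n)" for n
  define C where "C = (\<Sum>n<3. norm (g n)) + 2 * real N * ?f 3"
  have f3: "0 \<le> 2 * real N * ?f 3" by simp
  have C: "norm (\<Sum>n<k. g n) \<le> C" for k
  proof (cases "k < 3")
    case True
    have "norm (\<Sum>n<k. g n) \<le> (\<Sum>n<k. norm (g n))" by (rule norm_sum)
    also have "\<dots> \<le> (\<Sum>n<3. norm (g n))" using True by (intro sum_mono2) auto
    finally show ?thesis using f3 by (simp only: C_def)
  next
    case False
    have "(\<Sum>n<k. g n) = (\<Sum>n<3. g n) + (\<Sum>n=3..<k. g n)"
      using False unfolding lessThan_atLeast0 by (intro sum.atLeastLessThan_concat[symmetric]) auto
    moreover have "norm (\<Sum>n=3..<k. g n) \<le> 2 * real N * ?f 3"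
      unfolding g_def
      by (rule norm_sum_antitone_le) (use norm_sum_dchar_le[OF char N nonprincipal] anti in auto)
    moreover have "norm (\<Sum>n<3. g n) \<le> (\<Sum>n<3. norm (g n))" by (rule norm_sum)
    ultimately show ?thesis
      using norm_triangle_ineq[of "\<Sum>n<3. g n" "\<Sum>n=3..<k. g n"] by (simp only: C_def)
  qed
  have "(\<Sum>n<Suc x. g n) = (\<Sum>n=1..x. \<chi> n * of_real (?f n))" for x
    unfolding g_def by (rule sum_lessThan_Suc_drop_0) simp
  then have "norm (\<Sum>n=1..x. \<chi> n * of_real (?f n)) \<le> C" for x
    using C[of "Suc x"] by (simp only:)
  then show ?thesis by blast
qed

text \<open>For the weight \<Lambda> the convolution is the bounded sum with ln n / n, and its main
  term is \<open>L\<close> times the twisted sum. The error is at most 2N/x times psi(x), hence the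
  \<open>8 * real N\<close>.\<close>

lemma twisted_sum_bounded:
  assumes "L \<noteq> 0"
  shows "\<exists>C. \<forall>x>0. norm (twisted_sum \<chi> x) \<le> C"
proof -
  obtain C where C: "\<And>x. norm (\<Sum>n=1..x. \<chi> n * of_real (ln (real n) / real n)) \<le> C"
    using ln_weighted_bounded by blast
  have "norm (twisted_sum \<chi> x) \<le> (C + 8 * real N) / norm L" if "x > 0" for x
  proof -
    let ?A = "\<Sum>n=1..x. \<chi> n * of_real (ln (real n) / real n)"
    have "(\<Sum>d | d dvd n. \<Lambda> d) = ln (real n)" if "n \<in> {1..x}" for n
      using that mangoldt_sum[of n, where 'a = real] by simp
    then have conv: "(\<Sum>d=1..x. \<chi> d * of_real (\<Lambda> d / real d) * partial_L \<chi> (x div d)) = ?A"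
      by (rule convolution)
    have "norm (?A - L * twisted_sum \<chi> x) \<le> 2 * real N / real x * chebyshev_psi x"
      using weighted_L_error[of x \<Lambda> \<Lambda>] that unfolding conv twisted_sum_def chebyshev_psi_def by (simp add: mangoldt_nonneg)
    also have "\<dots> \<le> 2 * real N / real x * (4 * real x)"
      using chebyshev_psi_le[of x] by (intro mult_left_mono) auto
    also have "\<dots> = 8 * real N" using that by simp
    finally have "norm (L * twisted_sum \<chi> x) \<le> C + 8 * real N"
      using C[of x] norm_triangle_sub[of "L * twisted_sum \<chi> x" ?A] by (simp add: norm_minus_commute)
    then show ?thesis using assms by (simp add: norm_mult pos_le_divide_eq mult.commute)
  qed
  then show ?thesis by blast
qed

text \<open>For the Moebius weight the main term disappears with \<open>L = 0\<close>, while the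
  convolution is the twisted sum plus the ln x contributed by n = 1. The error is 2N/x times x ln x
  - ln x!, and this difference is at most x.\<close>

lemma twisted_sum_asymptotic:
  assumes "L = 0" "x > 0"
  shows "norm (twisted_sum \<chi> x + of_real (ln (real x))) \<le> 2 * real N"
proof -
  let ?w = "\<lambda>d. moebius d * ln (real x / real d)"
  let ?W = "\<lambda>n. \<Lambda> n + of_bool (n = 1) * ln (real x)"
  have "(\<Sum>d | d dvd n. ?w d) = ?W n" if n: "n \<in> {1..x}" for n
  proof -
    have "(\<Sum>d | d dvd n. ?w d) = (\<Sum>d | d dvd n. moebius d * ln (real n / real d) + moebius d * ln (real x / real n))"
    proof (rule sum.cong[OF refl])
      fix d assume "d \<in> {d. d dvd n}"
      then have "d > 0" using n by (auto intro!: Nat.gr0I)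
      then have "ln (real x / real d) = ln (real n / real d) + ln (real x / real n)"
        using n assms(2) by (simp add: ln_div)
      then show "?w d = moebius d * ln (real n / real d) + moebius d * ln (real x / real n)"
        by (simp add: algebra_simps)
    qed
    also have "\<dots> = \<Lambda> n + of_bool (n = 1) * ln (real x / real n)"
      using n sum_moebius_ln[of n] sum_moebius_divisors[of n] by (simp add: sum.distrib flip: sum_distrib_right)
    also have "\<dots> = ?W n" by auto
    finally show ?thesis .
  qed
  then have "(\<Sum>d=1..x. \<chi> d * of_real (?w d / real d) * partial_L \<chi> (x div d)) =
      (\<Sum>n=1..x. \<chi> n * of_real (?W n / real n))"
    by (rule convolution)
  also have "\<dots> = twisted_sum \<chi> x + (\<Sum>n=1..x. \<chi> n * of_real (of_bool (n = 1) * ln (real x) / real n))"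
    by (simp add: twisted_sum_def sum.distrib add_divide_distrib algebra_simps)
  also have "(\<Sum>n=1..x. \<chi> n * of_real (of_bool (n = 1) * ln (real x) / real n)) =
      (\<Sum>n\<in>{1}. \<chi> n * of_real (of_bool (n = 1) * ln (real x) / real n))"
    using assms(2) by (intro sum.mono_neutral_right) auto
  also have "\<dots> = of_real (ln (real x))" using dchar_1[OF char] by simp
  finally have conv: "(\<Sum>d=1..x. \<chi> d * of_real (?w d / real d) * partial_L \<chi> (x div d)) =
      twisted_sum \<chi> x + of_real (ln (real x))" .
  have "norm (twisted_sum \<chi> x + of_real (ln (real x))) \<le> 2 * real N / real x * (\<Sum>d=1..x. ln (real x / real d))"
    using weighted_L_error[of x ?w "\<lambda>d. ln (real x / real d)"] assms abs_moebius_le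
    unfolding conv by (simp add: abs_mult mult_left_le_one_le)
  also have "(\<Sum>d=1..x. ln (real x / real d)) = real x * ln (real x) - ln (fact x)"
    using assms(2) by (simp add: ln_fact_eq_sum_ln ln_div sum_subtractf)
  also have "2 * real N / real x * \<dots> \<le> 2 * real N / real x * real x"
    using ln_fact_ge[of x] by (intro mult_left_mono) auto
  finally show ?thesis using assms(2) by simp
qed

end

section \<open>Nonvanishing for real characters\<close>

lemma sum_divisors_times_prime_power:
  fixes h :: "nat \<Rightarrow> real"
  assumes mult: "\<And>m n. h (m * n) = h m * h n" and p: "prime p" "\<not> p dvd m" "m > 0"
  shows "(\<Sum>d | d dvd p ^ k * m. h d) = (\<Sum>i\<le>k. h p ^ i) * (\<Sum>d | d dvd m. h d)"
proof (induction k)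
  case (Suc k)
  have p0: "p > 0" using p by (simp add: prime_gt_0_nat)
  have h_power: "h (p ^ Suc k * d) = h p ^ Suc k * h d" for d
  proof -
    have "h (p ^ j * d) = h p ^ j * h d" for j
      by (induction j) (simp_all add: mult mult.assoc)
    then show ?thesis .
  qed
  have split: "{d. d dvd p ^ Suc k * m} = {d. d dvd p ^ k * m} \<union> (\<lambda>d. p ^ Suc k * d) ` {d. d dvd m}"
  proof (intro equalityI subsetI)
    fix d assume "d \<in> {d. d dvd p ^ Suc k * m}"
    then obtain a b where ab: "d = a * b" "a dvd p ^ Suc k" "b dvd m"
      using division_decomp[of d "p ^ Suc k" m] by auto
    then obtain i where i: "i \<le> Suc k" "a = p ^ i"
      using divides_primepow_nat[OF p(1), of a "Suc k"] ab(2) by blast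
    show "d \<in> {d. d dvd p ^ k * m} \<union> (\<lambda>d. p ^ Suc k * d) ` {d. d dvd m}"
    proof (cases "i = Suc k")
      case False
      then have "a dvd p ^ k" using i by (simp add: le_imp_power_dvd)
      then show ?thesis using ab by (simp add: mult_dvd_mono)
    qed (use ab i in auto)
  qed (auto intro: dvd_trans mult_dvd_mono)
  have "(\<Sum>d | d dvd p ^ Suc k * m. h d) =
      (\<Sum>d | d dvd p ^ k * m. h d) + (\<Sum>d\<in>(\<lambda>d. p ^ Suc k * d) ` {d. d dvd m}. h d)"
    unfolding split
  proof (rule sum.union_disjoint)
    have "\<not> p ^ Suc k * d dvd p ^ k * m" for d
    proof
      assume "p ^ Suc k * d dvd p ^ k * m"
      then have "p ^ k * (p * d) dvd p ^ k * m" by (simp add: mult_ac)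
      then have "p dvd m" using p0 dvd_mult_left by (simp add: dvd_mult_cancel1) blast
      then show False using p by simp
    qed
    then show "{d. d dvd p ^ k * m} \<inter> (\<lambda>d. p ^ Suc k * d) ` {d. d dvd m} = {}" by auto
  qed (use p p0 in auto)
  also have "(\<Sum>d\<in>(\<lambda>d. p ^ Suc k * d) ` {d. d dvd m}. h d) = (\<Sum>d | d dvd m. h (p ^ Suc k * d))"
    using p0 by (subst sum.reindex) (auto simp: inj_on_def)
  also have "\<dots> = h p ^ Suc k * (\<Sum>d | d dvd m. h d)"
    by (simp only: h_power sum_distrib_left)
  finally show ?case unfolding Suc.IH by (simp add: algebra_simps)
qed simp

lemma sum_powers_sign:
  fixes u :: real
  assumes "u \<in> {-1, 0, 1}"
  shows "0 \<le> (\<Sum>i\<le>k. u ^ i)" and "even k \<Longrightarrow> 1 \<le> (\<Sum>i\<le>k. u ^ i)"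
proof -
  have alt: "(\<Sum>i\<le>k. (-1 :: real) ^ i) = of_bool (even k)" for k
    by (induction k) auto
  have zero: "(\<Sum>i\<le>k. (0 :: real) ^ i) = 1" for k
    by (induction k) auto
  show "0 \<le> (\<Sum>i\<le>k. u ^ i)" using assms by (auto simp: alt zero)
  show "1 \<le> (\<Sum>i\<le>k. u ^ i)" if "even k" using assms that by (auto simp: alt zero)
qed

text \<open>The divisor sum factors over the prime powers of \<open>n\<close>. At
  \<open>p ^ k\<close> it is 1 + h(p) + ... + h(p)^k, which is nonnegative for h(p) in {-1, 0, 1}
  and at least 1 for even \<open>k\<close>.\<close>

lemma sum_divisors_real_character:
  fixes h :: "nat \<Rightarrow> real"
  assumes mult: "\<And>m n. h (m * n) = h m * h n" and range: "\<And>n. h n \<in> {-1, 0, 1}" and h1: "h 1 = 1"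
  shows "n > 0 \<Longrightarrow> 0 \<le> (\<Sum>d | d dvd n. h d)" and "n > 0 \<Longrightarrow> 1 \<le> (\<Sum>d | d dvd n ^ 2. h d)"
proof -
  have "n > 0 \<Longrightarrow> 0 \<le> (\<Sum>d | d dvd n. h d) \<and> 1 \<le> (\<Sum>d | d dvd n ^ 2. h d)"
  proof (induction n rule: less_induct)
    case (less n)
    show ?case
    proof (cases "n = 1")
      case True
      then show ?thesis using h1 by simp
    next
      case False
      then obtain p where p: "prime p" "p dvd n" using prime_factor_nat by blast
      define k where "k = multiplicity p n"
      obtain m where m: "n = p ^ k * m" "\<not> p dvd m"
        using multiplicity_decompose'[of n p] p less.prems unfolding k_def
        by (metis not_prime_unit not_gr_zero)
      have "k > 0" using p less.prems by (simp add: k_def prime_multiplicity_gt_zero_iff)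
      have m0: "m > 0" using m less.prems by (auto intro!: Nat.gr0I)
      have "1 < p ^ k" using p \<open>k > 0\<close> by (intro one_less_power prime_gt_1_nat)
      then have "m < n" using m m0 by simp
      then have IH: "0 \<le> (\<Sum>d | d dvd m. h d)" "1 \<le> (\<Sum>d | d dvd m ^ 2. h d)"
        using less.IH m0 by auto
      have n2: "n ^ 2 = p ^ (2 * k) * m ^ 2" using m by (simp add: power_mult_distrib power_mult mult.commute)
      have "\<not> p dvd m ^ 2" using p m prime_dvd_power by blast
      then have e2: "(\<Sum>d | d dvd n ^ 2. h d) = (\<Sum>i\<le>2 * k. h p ^ i) * (\<Sum>d | d dvd m ^ 2. h d)"
        unfolding n2 using mult p(1) m0 by (intro sum_divisors_times_prime_power) auto
      have e1: "(\<Sum>d | d dvd n. h d) = (\<Sum>i\<le>k. h p ^ i) * (\<Sum>d | d dvd m. h d)"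
        unfolding m(1) using mult p(1) m(2) m0 by (rule sum_divisors_times_prime_power)
      have "1 * 1 \<le> (\<Sum>i\<le>2 * k. h p ^ i) * (\<Sum>d | d dvd m ^ 2. h d)"
        using IH sum_powers_sign[OF range[of p]] by (intro mult_mono) auto
      moreover have "0 \<le> (\<Sum>i\<le>k. h p ^ i) * (\<Sum>d | d dvd m. h d)"
        using IH sum_powers_sign[OF range[of p]] by (intro mult_nonneg_nonneg) auto
      ultimately show ?thesis unfolding e1 e2 by simp
    qed
  qed
  then show "n > 0 \<Longrightarrow> 0 \<le> (\<Sum>d | d dvd n. h d)" and "n > 0 \<Longrightarrow> 1 \<le> (\<Sum>d | d dvd n ^ 2. h d)"
    by auto
qed

definition geometric_sum :: "real \<Rightarrow> nat \<Rightarrow> real" where "geometric_sum t n = (\<Sum>i<n. t ^ i)"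

text \<open>The first term is the leading behaviour of t^n / (1 - t^n) as t tends to 1. Summed
  against \<chi> it gives L(1, \<chi>) / (1 - t), so for L(1, \<chi>) = 0 only the defect
  remains.\<close>

definition lambert_defect :: "real \<Rightarrow> nat \<Rightarrow> real"
  where "lambert_defect t n = 1 / (real n * (1 - t)) - t ^ n / (1 - t ^ n)"

text \<open>The terms i and n - 1 - i are paired by the inequality of arithmetic and geometric
  means. Writing the ratio as a square avoids the half-integral exponent (n - 1)/2.\<close>

lemma geometric_sum_ge:
  assumes "0 < s" "s < 1" "n > 0"
  shows "real n * s ^ (n - 1) \<le> geometric_sum (s\<^sup>2) n"
proof -
  have rev: "geometric_sum (s\<^sup>2) n = (\<Sum>i<n. (s\<^sup>2) ^ (n - 1 - i))"
    unfolding geometric_sum_def by (rule sum.reindex_bij_witness[of _ "\<lambda>i. n - 1 - i" "\<lambda>i. n - 1 - i"]) auto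
  have "2 * (real n * s ^ (n - 1)) = (\<Sum>i<n. 2 * s ^ (n - 1))" by simp
  also have "\<dots> \<le> (\<Sum>i<n. (s\<^sup>2) ^ i + (s\<^sup>2) ^ (n - 1 - i))"
  proof (rule sum_mono)
    fix i assume "i \<in> {..<n}"
    then have "s ^ (n - 1) = s ^ i * s ^ (n - 1 - i)" by (simp flip: power_add)
    moreover have "0 \<le> (s ^ i - s ^ (n - 1 - i))\<^sup>2" by simp
    ultimately show "2 * s ^ (n - 1) \<le> (s\<^sup>2) ^ i + (s\<^sup>2) ^ (n - 1 - i)"
      by (simp add: power2_eq_square algebra_simps power_mult_distrib)
  qed
  also have "\<dots> = 2 * geometric_sum (s\<^sup>2) n"
    unfolding sum.distrib rev[symmetric] geometric_sum_def[symmetric] by simp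
  finally show ?thesis by simp
qed

text \<open>Write G(n) for \<open>geometric_sum t n\<close>. As G(n+1) = 1 + t G(n), consecutive
  values of t^n / G(n) differ by t^n / (G(n) G(n+1)), and everything reduces to n (n+1) t^n <= G(n)
  G(n+1), which follows from \<open>geometric_sum_ge\<close>.\<close>

lemma lambert_defect_antitone:
  assumes s: "0 < s" "s < 1" and t: "t = s\<^sup>2" and n: "n > 0"
  shows "lambert_defect t (Suc n) \<le> lambert_defect t n" and "0 \<le> lambert_defect t n"
proof -
  have t01: "0 < t" "t < 1" using s by (simp_all add: t abs_square_less_1)
  have one_minus: "1 - t ^ n = (1 - t) * geometric_sum t n" for n
    unfolding geometric_sum_def by (rule one_diff_power_eq)
  have defect: "lambert_defect t n = (1 / real n - t ^ n / geometric_sum t n) / (1 - t)" for n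
    unfolding lambert_defect_def one_minus by (simp add: diff_divide_distrib mult.commute)
  have pos: "0 < geometric_sum t n" if "n > 0" for n
  proof -
    have "0 < real n * s ^ (n - 1)" using that s by simp
    then show ?thesis using geometric_sum_ge[OF s that] t by simp
  qed
  have sn: "s ^ n \<le> s ^ (n - 1)" using s by (intro power_decreasing) auto
  have tn: "t ^ n = s ^ n * s ^ n" by (simp add: t power_mult_distrib power2_eq_square)
  have "real n * (real n + 1) * t ^ n \<le> (real n * s ^ (n - 1)) * (real (Suc n) * s ^ n)"
  proof -
    have "s ^ n * s ^ n \<le> s ^ (n - 1) * s ^ n" using sn s by (intro mult_right_mono) auto
    then have "real n * (real n + 1) * (s ^ n * s ^ n) \<le> real n * (real n + 1) * (s ^ (n - 1) * s ^ n)"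
      by (intro mult_left_mono) auto
    then show ?thesis unfolding tn by (simp only: mult_ac of_nat_Suc add.commute[of 1])
  qed
  also have "\<dots> \<le> geometric_sum t n * geometric_sum t (Suc n)"
    using geometric_sum_ge[OF s n] geometric_sum_ge[OF s, of "Suc n"] s pos[OF n]
    unfolding t by (intro mult_mono) auto
  finally have prod: "real n * (real n + 1) * t ^ n \<le> geometric_sum t n * geometric_sum t (Suc n)" .
  have rec: "geometric_sum t (Suc n) = 1 + t * geometric_sum t n"
    unfolding geometric_sum_def by (subst sum.lessThan_Suc_shift) (simp add: sum_distrib_left)
  have "t ^ n / geometric_sum t n - t ^ Suc n / geometric_sum t (Suc n) =
      t ^ n * (geometric_sum t (Suc n) - t * geometric_sum t n) / (geometric_sum t n * geometric_sum t (Suc n))"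
    using pos[of n] pos[of "Suc n"] n by (simp add: field_simps)
  also have "\<dots> = t ^ n / (geometric_sum t n * geometric_sum t (Suc n))" by (simp add: rec)
  also have "\<dots> \<le> 1 / (real n * (real n + 1))"
  proof -
    have R: "0 < real n * (real n + 1)" and G: "0 < geometric_sum t n * geometric_sum t (Suc n)"
      using pos[of n] pos[of "Suc n"] n by simp_all
    have "t ^ n \<le> geometric_sum t n * geometric_sum t (Suc n) / (real n * (real n + 1))"
      unfolding pos_le_divide_eq[OF R] using prod by (simp only: mult.commute)
    then show ?thesis unfolding pos_divide_le_eq[OF G] by simp
  qed
  also have "\<dots> = 1 / real n - 1 / real (Suc n)" using n by (simp add: field_simps)
  finally have "1 / real (Suc n) - t ^ Suc n / geometric_sum t (Suc n) \<le> 1 / real n - t ^ n / geometric_sum t n" by simp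
  then show "lambert_defect t (Suc n) \<le> lambert_defect t n"
    unfolding defect using t01 by (intro divide_right_mono) auto
  have "real n * t ^ n \<le> real n * s ^ (n - 1)"
    unfolding tn using sn s
    by (intro mult_left_mono order.trans[OF _ sn]) (auto intro: mult_left_le power_le_one)
  then have "real n * t ^ n \<le> geometric_sum t n" using geometric_sum_ge[OF s n] unfolding t by linarith
  then have "t ^ n \<le> geometric_sum t n / real n" using n by (simp add: pos_le_divide_eq mult.commute)
  then have "t ^ n / geometric_sum t n \<le> 1 / real n" unfolding pos_divide_le_eq[OF pos[OF n]] by simp
  then show "0 \<le> lambert_defect t n" unfolding defect using t01 by simp
qed

lemma sum_power_from_1:
  fixes u :: real
  assumes "u \<noteq> 1"
  shows "(\<Sum>m=1..M. u ^ m) = u / (1 - u) - u ^ Suc M / (1 - u)"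
proof -
  have "(\<Sum>m=1..M. u ^ m) * (1 - u) = u - u ^ Suc M"
  proof (induction M)
    case (Suc M)
    have "(\<Sum>m=1..Suc M. u ^ m) * (1 - u) = (\<Sum>m=1..M. u ^ m) * (1 - u) + u ^ Suc M * (1 - u)"
      by (simp add: distrib_right)
    also have "\<dots> = u - u ^ Suc M + u ^ Suc M * (1 - u)" by (simp only: Suc.IH)
    also have "\<dots> = u - u ^ Suc (Suc M)" by (simp add: algebra_simps)
    finally show ?case .
  qed simp
  then have "(\<Sum>m=1..M. u ^ m) = (u - u ^ Suc M) / (1 - u)"
    using assms by (simp only: eq_divide_eq) simp
  then show ?thesis by (simp only: diff_divide_distrib)
qed

context nonprincipal
begin

lemma L_limit: "partial_L \<chi> \<longlonglongrightarrow> L"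
proof (rule LIM_zero_cancel, rule tendsto_0_le)
  show "(\<lambda>x. 1 / real (Suc x)) \<longlonglongrightarrow> 0"
    by (rule LIMSEQ_Suc[OF lim_1_over_n])
  show "\<forall>\<^sub>F x in sequentially. norm (partial_L \<chi> x - L) \<le> norm (1 / real (Suc x)) * (2 * real N)"
    using L by (simp add: add.commute)
qed

text \<open>
  Monsky's argument: if $L(1, \chi) = 0$ then $\sum_n \chi(n) t^n / (1 - t^n)$ stays bounded as
  $t \to 1$, because it equals $-\sum_n \chi(n) b_n$ with $b_n$ = \<open>lambert_defect t n\<close> decreasing;
  but its power series has nonnegative coefficients that are at least $1$ at the squares.
\<close>

lemma lambert_sum_le:
  assumes real: "\<And>n. \<chi> n = of_real (h n)" and L0: "L = 0"
    and s: "0 < s" "s < 1" and t: "t = s\<^sup>2"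
  shows "(\<Sum>n=1..x. (\<Sum>d | d dvd n. h d) * t ^ n) \<le>
    2 * real N + 2 * real N / (real x + 1) / (1 - t) + real x * t ^ x / (1 - t)"
proof -
  have t01: "0 < t" "t < 1" using s by (simp_all add: t abs_square_less_1)
  have h1: "\<bar>h n\<bar> \<le> 1" for n using norm_le_1[of n] by (simp add: real)
  have tpow: "0 < t ^ d" "t ^ d < 1" "t ^ d \<le> t" if "d \<ge> 1" for d
    using t01 that power_decreasing[of 1 d t] by (auto simp: power_less_one_iff)
  have "(\<Sum>n=1..x. (\<Sum>d | d dvd n. h d) * t ^ n) = (\<Sum>n=1..x. \<Sum>d | d dvd n. h d * t ^ (d * (n div d)))"
    by (intro sum.cong refl) (simp add: sum_distrib_right)
  also have "\<dots> = (\<Sum>d=1..x. \<Sum>m=1..x div d. h d * t ^ (d * m))"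
    by (rule sum_divisors_hyperbola)
  \<comment> \<open>The inner geometric series stops at \<open>x div d\<close>; the last term is its
    missing tail. Like the tail of the L-series, it disappears for fixed \<open>t\<close> as
    \<open>x\<close> grows.\<close>
  also have "\<dots> = (\<Sum>d=1..x. h d * (1 / real d) / (1 - t) - h d * lambert_defect t d -
      h d * ((t ^ d) ^ Suc (x div d) / (1 - t ^ d)))"
  proof (rule sum.cong[OF refl])
    fix d assume d: "d \<in> {1..x}"
    have "(\<Sum>m=1..x div d. h d * t ^ (d * m)) = h d * (\<Sum>m=1..x div d. (t ^ d) ^ m)"
      by (simp only: sum_distrib_left power_mult)
    also have "\<dots> = h d * (t ^ d / (1 - t ^ d) - (t ^ d) ^ Suc (x div d) / (1 - t ^ d))"
      using tpow[of d] d by (subst sum_power_from_1) auto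
    also have "t ^ d / (1 - t ^ d) = 1 / real d / (1 - t) - lambert_defect t d"
      by (simp add: lambert_defect_def)
    finally show "(\<Sum>m=1..x div d. h d * t ^ (d * m)) = h d * (1 / real d) / (1 - t) -
        h d * lambert_defect t d - h d * ((t ^ d) ^ Suc (x div d) / (1 - t ^ d))"
      by (simp only: right_diff_distrib times_divide_eq_right)
  qed
  also have "\<dots> = (\<Sum>d=1..x. h d * (1 / real d)) / (1 - t) - (\<Sum>d=1..x. h d * lambert_defect t d) -
      (\<Sum>d=1..x. h d * ((t ^ d) ^ Suc (x div d) / (1 - t ^ d)))"
    by (simp only: sum_subtractf sum_divide_distrib)
  also have "\<dots> \<le> 2 * real N / (real x + 1) / (1 - t) + 2 * real N + real x * t ^ x / (1 - t)"
  proof -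
    have "norm (partial_L \<chi> x) = \<bar>\<Sum>d=1..x. h d * (1 / real d)\<bar>"
      unfolding partial_L_def real of_real_mult[symmetric] of_real_sum[symmetric] norm_of_real ..
    then have "(\<Sum>d=1..x. h d * (1 / real d)) \<le> 2 * real N / (real x + 1)"
      using L[of x] L0 by simp
    then have 1: "(\<Sum>d=1..x. h d * (1 / real d)) / (1 - t) \<le> 2 * real N / (real x + 1) / (1 - t)"
      using t01 by (intro divide_right_mono) auto
    have "norm (\<Sum>d=1..<Suc x. \<chi> d * of_real (lambert_defect t d)) \<le> 2 * real N * lambert_defect t 1"
      using lambert_defect_antitone[OF s t]
      by (intro norm_sum_antitone_le norm_sum_dchar_le[OF char N nonprincipal]) auto
    moreover have "lambert_defect t 1 = 1"
      using t01 by (simp add: lambert_defect_def flip: diff_divide_distrib)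
    moreover have "norm (\<Sum>d=1..<Suc x. \<chi> d * of_real (lambert_defect t d)) =
        \<bar>\<Sum>d=1..x. h d * lambert_defect t d\<bar>"
      unfolding real of_real_mult[symmetric] of_real_sum[symmetric] norm_of_real atLeastLessThanSuc_atLeastAtMost ..
    ultimately have 2: "- (\<Sum>d=1..x. h d * lambert_defect t d) \<le> 2 * real N" by simp
    have "- (\<Sum>d=1..x. h d * ((t ^ d) ^ Suc (x div d) / (1 - t ^ d))) =
        (\<Sum>d=1..x. - h d * ((t ^ d) ^ Suc (x div d) / (1 - t ^ d)))"
      by (simp add: sum_negf)
    also have "\<dots> \<le> (\<Sum>d=1..x. t ^ x / (1 - t))"
    proof (rule sum_mono)
      fix d assume d: "d \<in> {1..x}"
      have "x \<le> d * Suc (x div d)"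
        using dividend_less_times_div[of d x] d by simp
      then have "t ^ (d * Suc (x div d)) \<le> t ^ x" using t01 by (intro power_decreasing) auto
      then have "(t ^ d) ^ Suc (x div d) \<le> t ^ x" by (simp only: power_mult)
      then have "(t ^ d) ^ Suc (x div d) / (1 - t ^ d) \<le> t ^ x / (1 - t)"
        using tpow[of d] d t01 by (intro frac_le) auto
      moreover have "0 \<le> (t ^ d) ^ Suc (x div d) / (1 - t ^ d)"
        using tpow[of d] d t01 by (intro divide_nonneg_nonneg) auto
      moreover from this have "- h d * ((t ^ d) ^ Suc (x div d) / (1 - t ^ d)) \<le>
          1 * ((t ^ d) ^ Suc (x div d) / (1 - t ^ d))"
        using h1[of d] by (intro mult_right_mono) auto
      ultimately show "- h d * ((t ^ d) ^ Suc (x div d) / (1 - t ^ d)) \<le> t ^ x / (1 - t)"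
        by linarith
    qed
    finally have 3: "- (\<Sum>d=1..x. h d * ((t ^ d) ^ Suc (x div d) / (1 - t ^ d))) \<le> real x * t ^ x / (1 - t)"
      by simp
    show ?thesis using 1 2 3 by linarith
  qed
  finally show ?thesis by simp
qed

lemma real_L_nonzero:
  assumes cnj: "\<And>n. cnj (\<chi> n) = \<chi> n"
  shows "L \<noteq> 0"
proof
  assume L0: "L = 0"
  define h where "h n = Re (\<chi> n)" for n
  have real: "\<chi> n = of_real (h n)" for n
    using cnj[of n] by (simp add: h_def complex_eq_iff)
  have mult: "h (m * n) = h m * h n" for m n
    using dchar_mult[OF char, of m n] unfolding real by (simp only: of_real_mult[symmetric] of_real_eq_iff)
  have range: "h n \<in> {-1, 0, 1}" for n
  proof -
    have "\<bar>h n\<bar> = of_bool (coprime n N)" using norm_dchar[OF char N, of n] by (simp add: real)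
    then show ?thesis by (cases "coprime n N") (auto simp: abs_if split: if_splits)
  qed
  have "h 1 = 1" using dchar_1[OF char] by (simp add: h_def)
  note f = sum_divisors_real_character[OF mult range this]
  \<comment> \<open>The bound to beat is 2N. The squares up to K^2 contribute at least K t^(K^2),
    and by Bernoulli's inequality t = 1 - 1/(2 K^3) makes this at least K - 1/2, which exceeds
    2N.\<close>
  define K where "K = 2 * N + 1"
  have K: "0 < real K" by (simp add: K_def)
  define t where "t = 1 - 1 / (2 * real K ^ 3)"
  have "1 \<le> real K ^ 3" by (rule one_le_power) (simp add: K_def)
  then have y: "1 < 2 * real K ^ 3" by linarith
  have "0 < 1 / y" "1 / y < 1" if "1 < y" for y :: real using that by simp_all
  from this[OF y] have t01: "0 < t" "t < 1" unfolding t_def by linarith+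
  define s where "s = sqrt t"
  have s: "0 < s" "s < 1" "t = s\<^sup>2" using t01 by (simp_all add: s_def)
  have lower: "real K - 1 / 2 \<le> (\<Sum>n=1..x. (\<Sum>d | d dvd n. h d) * t ^ n)" if "K ^ 2 \<le> x" for x
  proof -
    have "real K * (1 + real (K ^ 2) * (t - 1)) \<le> real K * t ^ (K ^ 2)"
      using Bernoulli_inequality[of "t - 1" "K ^ 2"] t01 K by (intro mult_left_mono) auto
    moreover have "real K * (1 + real (K ^ 2) * (t - 1)) = real K - 1 / 2"
      using K by (simp add: t_def field_simps power2_eq_square power3_eq_cube)
    ultimately have "real K - 1 / 2 \<le> real K * t ^ (K ^ 2)" by simp
    also have "\<dots> = (\<Sum>k=1..K. t ^ (K ^ 2))" by simp
    also have "\<dots> \<le> (\<Sum>k=1..K. (\<Sum>d | d dvd k ^ 2. h d) * t ^ (k ^ 2))"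
    proof (rule sum_mono)
      fix k assume k: "k \<in> {1..K}"
      have "t ^ (K ^ 2) \<le> t ^ (k ^ 2)" using k t01 by (intro power_decreasing power_mono) auto
      moreover have "1 * t ^ (k ^ 2) \<le> (\<Sum>d | d dvd k ^ 2. h d) * t ^ (k ^ 2)"
        using k f(2)[of k] t01 by (intro mult_right_mono) auto
      ultimately show "t ^ (K ^ 2) \<le> (\<Sum>d | d dvd k ^ 2. h d) * t ^ (k ^ 2)" by simp
    qed
    also have "\<dots> = (\<Sum>n\<in>(\<lambda>k. k ^ 2) ` {1..K}. (\<Sum>d | d dvd n. h d) * t ^ n)"
      by (subst sum.reindex) (auto simp: inj_on_def)
    also have "\<dots> \<le> (\<Sum>n=1..x. (\<Sum>d | d dvd n. h d) * t ^ n)"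
    proof (rule sum_mono2)
      show "(\<lambda>k. k ^ 2) ` {1..K} \<subseteq> {1..x}"
      proof
        fix n assume "n \<in> (\<lambda>k. k ^ 2) ` {1..K}"
        then obtain k where k: "1 \<le> k" "k \<le> K" "n = k ^ 2" by auto
        have "k ^ 2 \<le> K ^ 2" using k by (intro power_mono) auto
        then have "k ^ 2 \<le> x" using that by (rule le_trans)
        then show "n \<in> {1..x}" using k by simp
      qed
    qed (use f(1) t01 in auto)
    finally show ?thesis .
  qed
  \<comment> \<open>With \<open>t\<close> fixed, letting \<open>x\<close> grow removes both
    truncation errors and leaves 2N as the upper bound.\<close>
  have "(\<lambda>x. 2 * real N + 2 * real N * (1 / real (Suc x)) / (1 - t) + real x * t ^ x / (1 - t)) \<longlonglongrightarrow>
      2 * real N + 2 * real N * 0 / (1 - t) + 0 / (1 - t)"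
    using t01 by (intro tendsto_intros LIMSEQ_Suc[OF lim_1_over_n] powser_times_n_limit_0) auto
  then have "real K - 1 / 2 \<le> 2 * real N + 2 * real N * 0 / (1 - t) + 0 / (1 - t)"
  proof (rule LIMSEQ_le_const)
    show "\<exists>M. \<forall>x\<ge>M. real K - 1 / 2 \<le>
        2 * real N + 2 * real N * (1 / real (Suc x)) / (1 - t) + real x * t ^ x / (1 - t)"
    proof (intro exI[of _ "K ^ 2"] allI impI)
      fix x assume "K ^ 2 \<le> x"
      from lower[OF this] lambert_sum_le[OF real L0 s, of x]
      show "real K - 1 / 2 \<le> 2 * real N + 2 * real N * (1 / real (Suc x)) / (1 - t) + real x * t ^ x / (1 - t)"
        by (simp add: add.commute)
    qed
  qed
  then show False by (simp add: K_def)
qed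

end

section \<open>Nonvanishing in general and primes in progressions\<close>

lemma sum_Un_le:
  fixes g :: "'a \<Rightarrow> real"
  assumes "finite A" "finite B" "\<And>x. 0 \<le> g x"
  shows "sum g (A \<union> B) \<le> sum g A + sum g B"
  using sum.union_inter[OF assms(1,2), of g] sum_nonneg[of "A \<inter> B" g] assms(3) by simp

text \<open>The 12 consists of 4 from \<open>mertens\<close> and 8 for the prime powers that are not
  prime; a prime that is not coprime to \<open>N\<close> divides it and is counted in the sum up to
  \<open>N\<close>.\<close>

lemma twisted_sum_principal:
  assumes "N > 0" "x > 0"
  shows "twisted_sum (principal N) x = of_real (Re (twisted_sum (principal N) x))"
    and "\<bar>Re (twisted_sum (principal N) x) - ln (real x)\<bar> \<le> 12 + (\<Sum>n=1..N. \<Lambda> n / real n)"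
proof -
  let ?g = "\<lambda>n. \<Lambda> n / real n"
  define P where "P = (\<Sum>n\<in>{n\<in>{1..x}. coprime n N}. ?g n)"
  have "twisted_sum (principal N) x = of_real (\<Sum>n=1..x. of_bool (coprime n N) * ?g n)"
  proof -
    have "principal N n = of_real (of_bool (coprime n N))" for n by (simp add: principal_def)
    then show ?thesis unfolding twisted_sum_def by (simp only: of_real_sum of_real_mult)
  qed
  also have "(\<Sum>n=1..x. of_bool (coprime n N) * ?g n) = P"
    unfolding P_def by (subst sum_of_bool_mult_eq) (auto intro!: sum.cong)
  finally have eq: "twisted_sum (principal N) x = of_real P" .
  then show "twisted_sum (principal N) x = of_real (Re (twisted_sum (principal N) x))" by simp
  have nonneg: "0 \<le> ?g n" for n by (simp add: mangoldt_nonneg)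
  have split: "(\<Sum>n=1..x. ?g n) = P + (\<Sum>n\<in>{n\<in>{1..x}. \<not> coprime n N}. ?g n)"
    unfolding P_def by (subst sum.union_disjoint[symmetric]) (auto intro!: sum.cong)
  have "(\<Sum>n\<in>{n\<in>{1..x}. \<not> coprime n N}. ?g n) \<le> (\<Sum>n\<in>{n. n \<in> {1..x} \<and> \<not> prime n} \<union> {1..N}. ?g n)"
  proof (rule sum_mono2)
    show "{n\<in>{1..x}. \<not> coprime n N} \<subseteq> {n. n \<in> {1..x} \<and> \<not> prime n} \<union> {1..N}"
      using assms(1) by (auto simp: prime_gt_0_nat Suc_le_eq dest: prime_imp_coprime dvd_imp_le)
         (meson assms(1) dvd_imp_le prime_imp_coprime)
  qed (use nonneg in auto)
  also have "\<dots> \<le> (\<Sum>n | n \<in> {1..x} \<and> \<not> prime n. ?g n) + (\<Sum>n=1..N. ?g n)"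
    by (rule sum_Un_le) (use nonneg in auto)
  finally have "(\<Sum>n\<in>{n\<in>{1..x}. \<not> coprime n N}. ?g n) \<le> 8 + (\<Sum>n=1..N. ?g n)"
    using sum_mangoldt_nonprime_le[of x] by linarith
  moreover have "0 \<le> (\<Sum>n\<in>{n\<in>{1..x}. \<not> coprime n N}. ?g n)" "0 \<le> (\<Sum>n=1..N. ?g n)"
    using nonneg by (auto intro!: sum_nonneg)
  ultimately have "\<bar>P - ln (real x)\<bar> \<le> 12 + (\<Sum>n=1..N. ?g n)"
    using mertens[OF assms(2)] split by linarith
  then show "\<bar>Re (twisted_sum (principal N) x) - ln (real x)\<bar> \<le> 12 + (\<Sum>n=1..N. ?g n)"
    by (simp add: eq)
qed

lemma sum_twisted_sum_progression:
  assumes "odd N" "coprime a N"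
  shows "(\<Sum>\<chi> | dcharacter N \<chi>. twisted_sum \<chi> x * cnj (\<chi> a)) =
    of_real (real (card {\<chi>. dcharacter N \<chi>}) * (\<Sum>n\<in>{n\<in>{1..x}. [n = a] (mod N)}. \<Lambda> n / real n))"
proof -
  let ?X = "{\<chi>. dcharacter N \<chi>}"
  have "(\<Sum>\<chi>\<in>?X. twisted_sum \<chi> x * cnj (\<chi> a)) =
      (\<Sum>\<chi>\<in>?X. \<Sum>n=1..x. of_real (\<Lambda> n / real n) * (\<chi> n * cnj (\<chi> a)))"
    unfolding twisted_sum_def sum_distrib_right by (simp only: mult_ac)
  also have "\<dots> = (\<Sum>n=1..x. of_real (\<Lambda> n / real n) * (\<Sum>\<chi>\<in>?X. \<chi> n * cnj (\<chi> a)))"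
    by (subst sum.swap) (simp only: sum_distrib_left)
  also have "\<dots> = (\<Sum>n=1..x. if [n = a] (mod N) then of_real (real (card ?X) * (\<Lambda> n / real n)) else 0)"
    unfolding dcharacter_orthogonality[OF assms] by (intro sum.cong refl) (simp add: mult.commute)
  also have "\<dots> = (\<Sum>n\<in>{n\<in>{1..x}. [n = a] (mod N)}. of_real (real (card ?X) * (\<Lambda> n / real n)))"
    by (rule sum.inter_filter[symmetric]) simp
  finally show ?thesis by (simp only: of_real_sum sum_distrib_left)
qed

lemma nonprincipalI: "dcharacter N \<chi> \<Longrightarrow> N > 0 \<Longrightarrow> \<chi> \<noteq> principal N \<Longrightarrow> nonprincipal N \<chi>"
  by (simp add: nonprincipal_def)

text \<open>The twisted sum is bounded if \<open>L\<close> is nonzero and about - ln x otherwise. A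
  one-sided bound is thus available before nonvanishing is known, and it is what the positivity
  argument for \<open>L_zero_unique\<close> uses.\<close>

lemma Re_twisted_sum_bounded_above:
  assumes "dcharacter N \<chi>" "N > 0" "\<chi> \<noteq> principal N"
  shows "\<exists>C. \<forall>x>0. Re (twisted_sum \<chi> x) \<le> C"
proof -
  interpret nonprincipal N \<chi> by (rule nonprincipalI[OF assms])
  show ?thesis
  proof (cases "L = 0")
    case True
    have "Re (twisted_sum \<chi> x) \<le> 2 * real N" if "x > 0" for x
    proof -
      have "Re (twisted_sum \<chi> x) + ln (real x) \<le> norm (twisted_sum \<chi> x + of_real (ln (real x)))"
        using complex_Re_le_cmod[of "twisted_sum \<chi> x + of_real (ln (real x))"] by simp
      moreover have "0 \<le> ln (real x)" using that by simp
      ultimately show ?thesis using twisted_sum_asymptotic[OF True that] by linarith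
    qed
    then show ?thesis by blast
  next
    case False
    then obtain C where "\<And>x. x > 0 \<Longrightarrow> norm (twisted_sum \<chi> x) \<le> C" using twisted_sum_bounded by blast
    then show ?thesis using complex_Re_le_cmod order.trans by blast
  qed
qed

lemma ln_unbounded: "\<exists>x>0. C < ln (real x)"
proof -
  obtain x where "exp C < real x" using reals_Archimedean2 by blast
  then have "0 < real x" using exp_gt_zero order.strict_trans by blast
  have "ln (exp C) < ln (real x)"
    using \<open>exp C < real x\<close> \<open>0 < real x\<close> by (subst ln_less_cancel_iff) auto
  then show ?thesis using \<open>0 < real x\<close> by (intro exI[of _ x]) simp
qed

text \<open>At a = 1 the sum over all characters is nonnegative. Two characters with vanishing
  L-value would contribute -2 ln x, against ln x from the principal one and bounded-above
  contributions from the others.\<close>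

lemma L_zero_unique:
  assumes "odd N" and \<chi>: "dcharacter N \<chi>" "\<chi> \<noteq> principal N" "nonprincipal.L N \<chi> = 0"
    and \<psi>: "dcharacter N \<psi>" "\<psi> \<noteq> principal N" "nonprincipal.L N \<psi> = 0"
  shows "\<chi> = \<psi>"
proof (rule ccontr)
  assume "\<chi> \<noteq> \<psi>"
  have N: "N > 0" using assms(1) by (auto intro: Nat.gr0I)
  let ?X = "{\<chi>. dcharacter N \<chi>}"
  define Y where "Y = ?X - {principal N, \<chi>, \<psi>}"
  have fin: "finite Y" using finite_dcharacters[OF N] by (simp add: Y_def)
  have "\<forall>\<phi>\<in>Y. \<exists>C. \<forall>x>0. Re (twisted_sum \<phi> x) \<le> C"
    using Re_twisted_sum_bounded_above[OF _ N] by (auto simp: Y_def)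
  then obtain C where C: "\<And>\<phi> x. \<phi> \<in> Y \<Longrightarrow> x > 0 \<Longrightarrow> Re (twisted_sum \<phi> x) \<le> C \<phi>" by metis
  define C0 where "C0 = 12 + (\<Sum>n=1..N. \<Lambda> n / real n) + 4 * real N + (\<Sum>\<phi>\<in>Y. C \<phi>)"
  obtain x where x: "x > 0" "C0 < ln (real x)" using ln_unbounded by blast
  have X: "?X = insert (principal N) (insert \<chi> (insert \<psi> Y))"
    using \<chi> \<psi> dcharacter_principal[OF N] by (auto simp: Y_def)
  have "Re (\<Sum>\<phi>\<in>?X. twisted_sum \<phi> x * cnj (\<phi> 1)) \<ge> 0"
    unfolding sum_twisted_sum_progression[OF assms(1) coprime_1_left]
    by (auto intro!: mult_nonneg_nonneg sum_nonneg divide_nonneg_nonneg mangoldt_nonneg)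
  also have "(\<Sum>\<phi>\<in>?X. twisted_sum \<phi> x * cnj (\<phi> 1)) = (\<Sum>\<phi>\<in>?X. twisted_sum \<phi> x)"
    by (intro sum.cong refl) (use dchar_1 in simp)
  also have "\<dots> = twisted_sum (principal N) x + (twisted_sum \<chi> x + (twisted_sum \<psi> x + (\<Sum>\<phi>\<in>Y. twisted_sum \<phi> x)))"
    unfolding X using fin \<chi> \<psi> \<open>\<chi> \<noteq> \<psi>\<close> by (simp add: Y_def)
  finally have ge: "0 \<le> Re (twisted_sum (principal N) x) + Re (twisted_sum \<chi> x) + Re (twisted_sum \<psi> x) + (\<Sum>\<phi>\<in>Y. Re (twisted_sum \<phi> x))"
    by (simp add: add.assoc)
  have le: "Re (twisted_sum \<phi> x) \<le> 2 * real N - ln (real x)"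
    if "dcharacter N \<phi>" "\<phi> \<noteq> principal N" "nonprincipal.L N \<phi> = 0" for \<phi>
  proof -
    interpret nonprincipal N \<phi> by (rule nonprincipalI[OF that(1) N that(2)])
    show ?thesis
      using twisted_sum_asymptotic[OF that(3) x(1)] complex_Re_le_cmod[of "twisted_sum \<phi> x + of_real (ln (real x))"] by simp
  qed
  have "(\<Sum>\<phi>\<in>Y. Re (twisted_sum \<phi> x)) \<le> (\<Sum>\<phi>\<in>Y. C \<phi>)"
    using C x(1) by (intro sum_mono) auto
  then show False
    using ge le[OF \<chi>] le[OF \<psi>] twisted_sum_principal(2)[OF N x(1)] x(2) by (simp add: C0_def)
qed

text \<open>Conjugating \<chi> conjugates its L-value, so a zero at \<chi> is also one at its
  conjugate. Uniqueness makes \<chi> real, and \<open>real_L_nonzero\<close> applies.\<close>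

lemma L_nonzero:
  assumes "odd N" and \<chi>: "dcharacter N \<chi>" "\<chi> \<noteq> principal N"
  shows "nonprincipal.L N \<chi> \<noteq> 0"
proof
  assume L0: "nonprincipal.L N \<chi> = 0"
  have N: "N > 0" using assms(1) by (auto intro: Nat.gr0I)
  interpret nonprincipal N \<chi> by (rule nonprincipalI[OF \<chi>(1) N \<chi>(2)])
  let ?\<chi>' = "\<lambda>n. cnj (\<chi> n)"
  have char': "dcharacter N ?\<chi>'" using \<chi>(1) by (rule dcharacter_cnj)
  have np': "?\<chi>' \<noteq> principal N"
  proof
    assume "?\<chi>' = principal N"
    then have "cnj (cnj (\<chi> n)) = cnj (principal N n)" for n by metis
    then have "\<chi> = principal N" by (auto simp: principal_def)
    then show False using \<chi> by simp
  qed
  interpret c: nonprincipal N ?\<chi>' by (rule nonprincipalI[OF char' N np'])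
  have "partial_L ?\<chi>' = (\<lambda>x. cnj (partial_L \<chi> x))"
    by (rule ext) (simp add: partial_L_def)
  moreover have "(\<lambda>x. cnj (partial_L \<chi> x)) \<longlonglongrightarrow> cnj L" by (intro tendsto_intros L_limit)
  ultimately have "c.L = cnj L" using c.L_limit LIMSEQ_unique by metis
  then have "?\<chi>' = \<chi>" using L0 L_zero_unique[OF assms(1) char' np' _ \<chi> L0] by simp
  then have "cnj (\<chi> n) = \<chi> n" for n by metis
  then show False using real_L_nonzero L0 by blast
qed

text \<open>If the primes of the progression stopped at \<open>M\<close>, the sum of \<Lambda>(n)/n
  over it would be bounded. By orthogonality a fixed multiple of this sum is ln x up to a bounded
  error, since every nonprincipal character contributes a bounded amount.\<close>

theorem infinite_primes_in_progression:
  fixes N a M :: nat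
  assumes "odd N" "coprime a N"
  obtains l where "prime l" "M < l" "[l = a] (mod N)"
proof -
  have "\<exists>l. prime l \<and> M < l \<and> [l = a] (mod N)"
  proof (rule ccontr)
    assume "\<not> ?thesis"
    then have small: "l \<le> M" if "prime l" "[l = a] (mod N)" for l
      using that by (auto simp: not_less)
    have N: "N > 0" using assms(1) by (auto intro: Nat.gr0I)
    let ?X = "{\<chi>. dcharacter N \<chi>}" and ?g = "\<lambda>n. \<Lambda> n / real n"
    have "\<forall>\<chi>\<in>?X - {principal N}. \<exists>C. \<forall>x>0. norm (twisted_sum \<chi> x) \<le> C"
    proof
      fix \<chi> assume "\<chi> \<in> ?X - {principal N}"
      then have \<chi>: "dcharacter N \<chi>" "\<chi> \<noteq> principal N" by auto
      interpret nonprincipal N \<chi> by (rule nonprincipalI[OF \<chi>(1) N \<chi>(2)])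
      show "\<exists>C. \<forall>x>0. norm (twisted_sum \<chi> x) \<le> C" using twisted_sum_bounded[OF L_nonzero[OF assms(1) \<chi>]] .
    qed
    then obtain C where C: "\<And>\<chi> x. \<chi> \<in> ?X - {principal N} \<Longrightarrow> x > 0 \<Longrightarrow> norm (twisted_sum \<chi> x) \<le> C \<chi>" by metis
    define B where "B = real (card ?X) * (8 + (\<Sum>n=1..M. ?g n)) + (\<Sum>\<chi>\<in>?X - {principal N}. C \<chi>) +
        12 + (\<Sum>n=1..N. ?g n)"
    obtain x where x: "x > 0" "B < ln (real x)" using ln_unbounded by blast
    have nonneg: "0 \<le> ?g n" for n by (simp add: mangoldt_nonneg)
    have "(\<Sum>n\<in>{n\<in>{1..x}. [n = a] (mod N)}. ?g n) \<le> (\<Sum>n\<in>{n. n \<in> {1..x} \<and> \<not> prime n} \<union> {1..M}. ?g n)"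
      using small nonneg by (intro sum_mono2) auto
    also have "\<dots> \<le> (\<Sum>n | n \<in> {1..x} \<and> \<not> prime n. ?g n) + (\<Sum>n=1..M. ?g n)"
      by (rule sum_Un_le) (use nonneg in auto)
    also have "\<dots> \<le> 8 + (\<Sum>n=1..M. ?g n)" using sum_mangoldt_nonprime_le[of x] by linarith
    finally have "real (card ?X) * (\<Sum>n\<in>{n\<in>{1..x}. [n = a] (mod N)}. ?g n) \<le>
        real (card ?X) * (8 + (\<Sum>n=1..M. ?g n))"
      by (intro mult_left_mono) auto
    moreover have "real (card ?X) * (\<Sum>n\<in>{n\<in>{1..x}. [n = a] (mod N)}. ?g n) =
        Re (\<Sum>\<chi>\<in>?X. twisted_sum \<chi> x * cnj (\<chi> a))"
      unfolding sum_twisted_sum_progression[OF assms] by (simp only: Re_complex_of_real)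
    moreover have "(\<Sum>\<chi>\<in>?X. twisted_sum \<chi> x * cnj (\<chi> a)) =
        twisted_sum (principal N) x + (\<Sum>\<chi>\<in>?X - {principal N}. twisted_sum \<chi> x * cnj (\<chi> a))"
      using assms(2) dcharacter_principal[OF N]
      by (subst sum.remove[OF finite_dcharacters[OF N], of "principal N"]) (auto simp: principal_def)
    moreover have "norm (\<Sum>\<chi>\<in>?X - {principal N}. twisted_sum \<chi> x * cnj (\<chi> a)) \<le> (\<Sum>\<chi>\<in>?X - {principal N}. C \<chi>)"
    proof (rule sum_norm_le)
      fix \<chi> assume \<chi>: "\<chi> \<in> ?X - {principal N}"
      then have "norm (\<chi> a) = 1" using norm_dchar[of N \<chi> a] N assms(2) by simp
      then show "norm (twisted_sum \<chi> x * cnj (\<chi> a)) \<le> C \<chi>" using C[OF \<chi> x(1)] by (simp add: norm_mult)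
    qed
    moreover have "- norm z \<le> Re z" for z using abs_Re_le_cmod[of z] by linarith
    ultimately have "Re (twisted_sum (principal N) x) - (\<Sum>\<chi>\<in>?X - {principal N}. C \<chi>) \<le>
        real (card ?X) * (8 + (\<Sum>n=1..M. ?g n))"
      by (smt (verit) plus_complex.simps(1))
    then show False
      using twisted_sum_principal(2)[OF N x(1)] x(2) by (simp add: B_def)
  qed
  then show ?thesis using that by blast
qed

section \<open>Attained diameters\<close>

text \<open>Dirichlet's theorem for the class inverse to \<open>a\<close>; in the use below,
  \<open>a\<close> may be negative, hence the integer congruence.\<close>

lemma prime_with_inverse_residue:
  fixes m M :: nat and a :: int
  assumes "odd m" "coprime a (int m)"
  obtains r where "prime r" "M < r" "[int r * a = 1] (mod int m)"
proof -
  have m: "0 < int m" using assms by (auto intro: Nat.gr0I)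
  obtain b where b: "[a * b = 1] (mod int m)"
    using assms(2) cong_solve_coprime_int by blast
  define b' where "b' = nat (b mod int m)"
  have b': "[int b' = b] (mod int m)" using m by (simp add: b'_def cong_def)
  have "[a * int b' = 1] (mod int m)"
    using cong_mult[OF cong_refl b', of a] b cong_trans by blast
  then have "coprime (a * int b') (int m)"
    using cong_imp_coprime[OF cong_sym, of "a * int b'" 1 "int m"] by simp
  then have "coprime b' m" by simp
  then obtain r where r: "prime r" "M < r" "[r = b'] (mod m)"
    using infinite_primes_in_progression[OF assms(1), of b' M] by blast
  have "[int r * a = int b' * a] (mod int m)"
    using r(3) by (intro cong_mult cong_refl) (simp add: cong_int_iff)
  also have "[int b' * a = 1] (mod int m)"
    using \<open>[a * int b' = 1] (mod int m)\<close> by (simp add: mult.commute)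
  finally show ?thesis using that r by blast
qed

lemma coprime_combination:
  assumes "prime p" "prime q" "p \<noteq> q" "s = 1 \<or> s = (-1::int)"
  shows "coprime (int p + s * int q) (int (p * q))"
proof -
  have pq: "coprime (int p) (int q)" using assms by (simp add: primes_coprime)
  have "coprime (s * int q) (int p)"
    using pq assms(4) by (auto simp: coprime_commute)
  moreover have "[s * int q = int p + s * int q] (mod int p)"
    by (simp add: cong_iff_dvd_diff)
  ultimately have "coprime (int p + s * int q) (int p)"
    by (rule cong_imp_coprime[rotated])
  moreover have "[int p = int p + s * int q] (mod int q)"
    by (simp add: cong_iff_dvd_diff)
  with pq have "coprime (int p + s * int q) (int q)"
    by (rule cong_imp_coprime[rotated])
  ultimately show ?thesis by simp
qed

theorem corollary6:
  fixes p :: nat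
  assumes "prime p" and "odd p"
  shows "card {d :: int. 2 \<le> d \<and> d \<le> int p \<and>
           (\<forall>N :: nat. \<exists>q r :: nat. prime q \<and> prime r \<and> N < q \<and> p < q \<and> q < r \<and>
              cyclotomic_diameter (p * q * r) = d)}
         \<ge> (p + 1) div 2"
proof -
  have p: "2 < p" using assms prime_gt_1_nat[of p] by (cases "p = 2") auto
  obtain k where k: "p = 2 * k + 1" using assms(2) by (elim oddE)
  have exq: "\<exists>q. prime q \<and> N < q \<and> 2 * p * p < q \<and> p < q \<and> odd q \<and> [q = c] (mod p)"
    if "0 < c" "c < p" for N c
  proof -
    have "coprime c p"
      using prime_imp_coprime[OF assms(1), of c] that dvd_imp_le[of p c]
      by (force simp: coprime_commute)
    then obtain q where "prime q" "N + 2 * p * p + p < q" "[q = c] (mod p)"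
      using infinite_primes_in_progression[OF assms(2), of c "N + 2 * p * p + p"] by blast
    moreover from this have "odd q" using p by (intro prime_odd_nat) linarith+
    moreover from calculation have "N < q" "2 * p * p < q" "p < q" by linarith+
    ultimately show ?thesis by blast
  qed
  have exr: "\<exists>r. prime r \<and> p * q < r \<and> [int r * (int p + s * int q) = 1] (mod int (p * q))"
    if "prime q" "p < q" "odd q" "s = 1 \<or> s = -1" for q s
  proof -
    have "coprime (int p + s * int q) (int (p * q))"
      using that by (intro coprime_combination assms) auto
    moreover have "odd (p * q)" using assms that by simp
    ultimately show ?thesis using prime_with_inverse_residue[of "p * q"] by metis
  qed
  have less: "q < r" if "p * q < r" for q r
  proof -
    have "1 * q \<le> p * q" using p by (intro mult_le_mono1) simp
    then show ?thesis using that by linarith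
  qed
  define attained where "attained d \<longleftrightarrow> (\<forall>N. \<exists>q r. prime q \<and> prime r \<and> N < q \<and> p < q \<and> q < r \<and>
    cyclotomic_diameter (p * q * r) = d)" for d
  define D where "D = {d. 2 \<le> d \<and> d \<le> int p \<and> attained d}"
  have even: "2 * int c \<in> D" if c: "c \<in> {1..k}" for c
  proof -
    have c': "0 < c" "2 * c < p" "c < p" using c k by simp_all
    have "attained (2 * int c)"
      unfolding attained_def
    proof
      fix N
      obtain q where q: "prime q" "N < q" "2 * p * p < q" "p < q" "odd q" "[q = c] (mod p)"
        using exq[OF c'(1,3)] by blast
      obtain r where r: "prime r" "p * q < r" "[int r * (int p + 1 * int q) = 1] (mod int (p * q))"
        using exr[OF q(1,4,5) disjI1[OF refl]] by blast
      have "cyclotomic_diameter (p * q * r) = 2 * int c"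
        using r(3) by (intro diameter_direct assms q r c') simp
      then show "\<exists>q r. prime q \<and> prime r \<and> N < q \<and> p < q \<and> q < r \<and>
          cyclotomic_diameter (p * q * r) = 2 * int c"
        using q(1,2,4) r(1) less[OF r(2)] by blast
    qed
    then show ?thesis using c' by (simp add: D_def)
  qed
  have three: "3 \<in> D"
  proof -
    have "attained 3"
      unfolding attained_def
    proof
      fix N
      obtain q where q: "prime q" "N < q" "2 * p * p < q" "p < q" "odd q" "[q = 1] (mod p)"
        using exq[of 1 N] p by auto
      obtain r where r: "prime r" "p * q < r" "[int r * (int p + - 1 * int q) = 1] (mod int (p * q))"
        using exr[OF q(1,4,5) disjI2[OF refl]] by blast
      have "cyclotomic_diameter (p * q * r) = 3"
        using r(3) by (intro diameter_reversed assms q r) simp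
      then show "\<exists>q r. prime q \<and> prime r \<and> N < q \<and> p < q \<and> q < r \<and>
          cyclotomic_diameter (p * q * r) = 3"
        using q(1,2,4) r(1) less[OF r(2)] by blast
    qed
    then show ?thesis using p by (simp add: D_def)
  qed
  define E where "E = (\<lambda>c. 2 * int c) ` {1..k}"
  have "3 \<notin> E"
  proof
    assume "3 \<in> E"
    then obtain c where "3 = 2 * int c" by (auto simp: E_def)
    then show False by presburger
  qed
  then have "(p + 1) div 2 = card (insert 3 E)"
    by (simp add: k E_def card_image inj_on_def)
  also have "\<dots> \<le> card D"
  proof (rule card_mono)
    show "finite D"
      unfolding D_def by (rule finite_subset[of _ "{2..int p}"]) auto
    show "insert 3 E \<subseteq> D" using even three by (auto simp: E_def)
  qed
  finally show ?thesis
    unfolding D_def attained_def .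
qed

end
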